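(* Let $d\in\mathbb{N}_{\ge1}$, $n\in\mathbb{N}_{\ge2}$, $0<\alpha<\beta\le1$ and $I=[0,1]$. Then the flow map $$L^1(I,C^{n,\beta}_0(\mathbb{R}^d,\mathbb{R}^d))\to C(I,\mathcal{D}^{n,\alpha}(\mathbb{R}^d)),\quad u\mapsto\Phi,$$ is continuous, even $C^{0,\beta-\alpha}$ (i.e. locally Hölder continuous of order $\beta-\alpha$).
   Context: $C^{n,\alpha}_0(\mathbb{R}^d,\mathbb{R}^d)$ is the Banach space of $C^n$-maps $f:\mathbb{R}^d\to\mathbb{R}^d$ with $f^{(l)}(x)\to0$ as $\|x\|\to\infty$ for $0\le l\le n$ and $\|f\|_{n,\alpha}:=\max\{\sup_{x,\,0\le l\le n}\|f^{(l)}(x)\|,\ \sup_{x\ne y}\|f^{(n)}(x)-f^{(n)}(y)\|/\|x-y\|^\alpha\}<\infty$. $\mathcal{D}^{n,\alpha}(\mathbb{R}^d):=\{\Phi\in\mathrm{Id}+C^{n,\alpha}_0(\mathbb{R}^d,\mathbb{R}^d):\det d\Phi(x)>0\ \forall x\}$ with metric $\|\Phi_1-\Phi_2\|_{n,\alpha}$. $L^1(I,C^{n,\beta}_0(\mathbb{R}^d,\mathbb{R}^d))$ is the Banach space of (classes of) Bochner integrable functions, with norm $\int_0^1\|u(t)\|_{n,\beta}\,dt$. Each such $u$ has a unique pointwise flow $\Phi:I\times\mathbb{R}^d\to\mathbb{R}^d$, $\Phi(t,x)=x+\int_0^tu(s)(\Phi(s,x))\,ds$, and $t\mapsto\Phi(t,\cdot)$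 is a continuous map $I\to\mathcal{D}^{n,\beta}(\mathbb{R}^d)\subseteq\mathcal{D}^{n,\alpha}(\mathbb{R}^d)$; the flow map sends $u$ to this map. $C(I,\mathcal{D}^{n,\alpha}(\mathbb{R}^d))$ carries the metric $\sup_{t\in I}\|\Phi(t)-\Psi(t)\|_{n,\alpha}$. A map $T$ between (open subsets of) Banach spaces is $C^{0,\gamma}$ if every point has a neighborhood on which $\|T(u)-T(v)\|/\|u-v\|^\gamma$, $u\neq v$, is bounded; here this is understood after subtracting $\mathrm{Id}$ in the target. *)

theory Defs
  imports "HOL-Analysis.Analysis"
begin

section \<open>The Banach space of \<open>C\<^sup>n\<close>-maps with Hoelder continuous top derivative\<close>

text \<open>
  Iterated Frechet derivatives are written as multilinear maps on argument lists:
  \<open>nderiv f [v\<^sub>1, \<dots>, v\<^sub>l] x = f\<^sup>(\<^sup>l\<^sup>)(x)(v\<^sub>1, \<dots>, v\<^sub>l)\<close>.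
\<close>

primrec nderiv :: "('a::real_normed_vector \<Rightarrow> 'b::real_normed_vector) \<Rightarrow> 'a list \<Rightarrow> 'a \<Rightarrow> 'b" where
  "nderiv f [] = f"
| "nderiv f (v # vs) = (\<lambda>x. frechet_derivative (nderiv f vs) (at x) v)"

text \<open>
  As \<open>'a\<close> is finite dimensional in all uses below, differentiability and continuity of
  \<open>f\<^sup>(\<^sup>l\<^sup>)\<close> as a map into the \<open>l\<close>-linear maps can be required for fixed arguments.
\<close>

definition Cn_map :: "nat \<Rightarrow> ('a::euclidean_space \<Rightarrow> 'b::real_normed_vector) \<Rightarrow> bool" where
  "Cn_map n f \<longleftrightarrow>
     (\<forall>vs. length vs < n \<longrightarrow> (\<forall>x. nderiv f vs differentiable (at x))) \<and>
     (\<forall>vs. length vs \<le> n \<longrightarrow> continuous_on UNIV (nderiv f vs))"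

text \<open>Operator norm of an \<open>l\<close>-linear map.\<close>

definition mlin_norm :: "nat \<Rightarrow> ('a::real_normed_vector list \<Rightarrow> 'b::real_normed_vector) \<Rightarrow> ennreal" where
  "mlin_norm l T = (SUP vs\<in>{vs. length vs = l \<and> (\<forall>v\<in>set vs. norm v \<le> 1)}. ennreal (norm (T vs)))"

definition Cna_norm :: "nat \<Rightarrow> real \<Rightarrow> ('a::euclidean_space \<Rightarrow> 'b::real_normed_vector) \<Rightarrow> ennreal" where
  "Cna_norm n \<alpha> f = max
     (SUP (x, l)\<in>UNIV \<times> {0..n}. mlin_norm l (\<lambda>vs. nderiv f vs x))
     (SUP (x, y)\<in>{(x, y). x \<noteq> y}.
        mlin_norm n (\<lambda>vs. nderiv f vs x - nderiv f vs y) / ennreal (norm (x - y) powr \<alpha>))"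

definition C0_space :: "nat \<Rightarrow> real \<Rightarrow> ('a::euclidean_space \<Rightarrow> 'b::real_normed_vector) set" where
  "C0_space n \<alpha> = {f. Cn_map n f \<and>
     (\<forall>l\<le>n. ((\<lambda>x. mlin_norm l (\<lambda>vs. nderiv f vs x)) \<longlongrightarrow> 0) at_infinity) \<and>
     Cna_norm n \<alpha> f < \<infinity>}"

definition diff_group :: "nat \<Rightarrow> real \<Rightarrow> (real^'d \<Rightarrow> real^'d) set" where
  "diff_group n \<alpha> = {\<Phi>. (\<lambda>x. \<Phi> x - x) \<in> C0_space n \<alpha> \<and> (\<forall>x. det (jacobian \<Phi> (at x)) > 0)}"

text \<open>
  Values of the library type \<open>'a metric\<close> are only meaningful if the pair is a metric space;
  for the two metrics defined here this is shown in \<open>Metric_space_diff_group\<close>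
  and \<open>Metric_space_L1\<close>. As the locale \<open>Metric_space\<close> demands symmetry on the whole type,
  distances are set to \<open>0\<close> outside the carrier.
\<close>

definition diff_dist :: "nat \<Rightarrow> real \<Rightarrow> (real^'d \<Rightarrow> real^'d) \<Rightarrow> (real^'d \<Rightarrow> real^'d) \<Rightarrow> real" where
  "diff_dist n \<alpha> f g = (if f \<in> diff_group n \<alpha> \<and> g \<in> diff_group n \<alpha>
     then enn2real (Cna_norm n \<alpha> (\<lambda>x. f x - g x)) else 0)"

definition diff_metric :: "nat \<Rightarrow> real \<Rightarrow> (real^'d \<Rightarrow> real^'d) metric" where
  "diff_metric n \<alpha> = metric (diff_group n \<alpha>, diff_dist n \<alpha>)"

section \<open>Bochner integrable functions on the unit interval\<close>

text \<open>
  The library's \<open>integrable\<close> needs a second countable type as codomain, whereas \<open>C0_space n \<beta>\<close>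
  is a set depending on \<open>n\<close> and \<open>\<beta>\<close>, and is not separable.
\<close>

definition bochner_fun :: "nat \<Rightarrow> real \<Rightarrow> (real \<Rightarrow> real^'d \<Rightarrow> real^'d) set" where
  "bochner_fun n \<beta> = {u. (\<forall>t\<in>{0..1}. u t \<in> C0_space n \<beta>) \<and>
     (\<exists>s. (\<forall>k. simple_function (lebesgue_on {0..1}) (s k) \<and> (\<forall>t\<in>{0..1}. s k t \<in> C0_space n \<beta>)) \<and>
          (AE t in lebesgue_on {0..1}. (\<lambda>k. Cna_norm n \<beta> (\<lambda>x. u t x - s k t x)) \<longlonglongrightarrow> 0) \<and>
          (\<lambda>k. \<integral>\<^sup>+t. Cna_norm n \<beta> (\<lambda>x. u t x - s k t x) \<partial>lebesgue_on {0..1}) \<longlonglongrightarrow> 0)}"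

definition ae_rel :: "nat \<Rightarrow> real \<Rightarrow> ((real \<Rightarrow> real^'d \<Rightarrow> real^'d) \<times> (real \<Rightarrow> real^'d \<Rightarrow> real^'d)) set" where
  "ae_rel n \<beta> = {(u, v). u \<in> bochner_fun n \<beta> \<and> v \<in> bochner_fun n \<beta> \<and>
     (AE t in lebesgue_on {0..1}. u t = v t)}"

definition fun_dist :: "nat \<Rightarrow> real \<Rightarrow> (real \<Rightarrow> real^'d \<Rightarrow> real^'d) \<Rightarrow> (real \<Rightarrow> real^'d \<Rightarrow> real^'d) \<Rightarrow> real" where
  "fun_dist n \<beta> u v = enn2real (\<integral>\<^sup>+t. Cna_norm n \<beta> (\<lambda>x. u t x - v t x) \<partial>lebesgue_on {0..1})"

text \<open>The distance of two classes is the common value for all representatives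
  (see \<open>L1_dist_eq\<close>).\<close>

definition L1_dist :: "nat \<Rightarrow> real \<Rightarrow> (real \<Rightarrow> real^'d \<Rightarrow> real^'d) set \<Rightarrow> (real \<Rightarrow> real^'d \<Rightarrow> real^'d) set \<Rightarrow> real" where
  "L1_dist n \<beta> U V = (if U \<in> bochner_fun n \<beta> // ae_rel n \<beta> \<and> V \<in> bochner_fun n \<beta> // ae_rel n \<beta>
     then the_elem ((\<lambda>(u, v). fun_dist n \<beta> u v) ` (U \<times> V)) else 0)"

definition L1_metric :: "nat \<Rightarrow> real \<Rightarrow> (real \<Rightarrow> real^'d \<Rightarrow> real^'d) set metric" where
  "L1_metric n \<beta> = metric (bochner_fun n \<beta> // ae_rel n \<beta>, L1_dist n \<beta>)"

section \<open>The flow map\<close>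

text \<open>The integrability requirement excludes spurious solutions, as the library integral
  of a non-integrable function is \<open>0\<close>.\<close>

definition is_flow :: "(real \<Rightarrow> real^'d \<Rightarrow> real^'d) \<Rightarrow> (real \<Rightarrow> real^'d \<Rightarrow> real^'d) \<Rightarrow> bool" where
  "is_flow u \<Phi> \<longleftrightarrow> (\<forall>t\<in>{0..1}. \<forall>x.
     set_integrable lebesgue {0..t} (\<lambda>s. u s (\<Phi> s x)) \<and>
     \<Phi> t x = x + (LINT s:{0..t}|lebesgue. u s (\<Phi> s x)))"

text \<open>\<open>extensional\<close> fixes the junk value for \<open>t \<notin> {0..1}\<close>, in accordance with \<open>cfunspace\<close>.\<close>

definition flow_map :: "(real \<Rightarrow> real^'d \<Rightarrow> real^'d) set \<Rightarrow> (real \<Rightarrow> real^'d \<Rightarrow> real^'d)" where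
  "flow_map U = (THE \<Phi>. \<Phi> \<in> extensional {0..1} \<and> (\<forall>u\<in>U. is_flow u \<Phi>))"

text \<open>Target of the flow map: continuous paths, with the supremum metric.\<close>

definition path_metric :: "nat \<Rightarrow> real \<Rightarrow> (real \<Rightarrow> real^'d \<Rightarrow> real^'d) metric" where
  "path_metric n \<alpha> = cfunspace (top_of_set {0..1}) (diff_metric n \<alpha>)"

section \<open>Local Hoelder continuity\<close>

text \<open>
  Subtracting the identity from the values does not change the distances in \<open>diff_metric\<close> and
  \<open>path_metric\<close>, so maps into these metric spaces need no separate notion.
\<close>

definition locally_holder_map :: "real \<Rightarrow> 'a metric \<Rightarrow> 'b metric \<Rightarrow> ('a \<Rightarrow> 'b) \<Rightarrow> bool" where
  "locally_holder_map \<gamma> m1 m2 T \<longleftrightarrow> T ` mspace m1 \<subseteq> mspace m2 \<and>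
     (\<forall>w\<in>mspace m1. \<exists>N. openin (mtopology_of m1) N \<and> w \<in> N \<and>
        (\<exists>C. \<forall>u\<in>N. \<forall>v\<in>N. u \<noteq> v \<longrightarrow> mdist m2 (T u) (T v) / mdist m1 u v powr \<gamma> \<le> C))"

section \<open>Well-definedness of the metrics\<close>

lemma nderiv_diff:
  assumes "Cn_map n f" "Cn_map n g" "length vs \<le> n"
  shows "nderiv (\<lambda>x. f x - g x) vs = (\<lambda>x. nderiv f vs x - nderiv g vs x)"
  using assms(3)
proof (induction vs)
  case Nil
  then show ?case by simp
next
  case (Cons v vs)
  then have "nderiv f vs differentiable at x" "nderiv g vs differentiable at x" for x
    using assms(1,2) by (auto simp: Cn_map_def)
  then have "frechet_derivative (\<lambda>x. nderiv f vs x - nderiv g vs x) (at x) =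
      (\<lambda>v. frechet_derivative (nderiv f vs) (at x) v - frechet_derivative (nderiv g vs) (at x) v)" for x
    by (intro frechet_derivative_at [symmetric] has_derivative_diff)
       (auto simp: frechet_derivative_works)
  with Cons show ?case by simp
qed

lemma Cn_map_diff:
  assumes "Cn_map n f" "Cn_map n g"
  shows "Cn_map n (\<lambda>x. f x - g x)"
  using assms
  by (auto simp: Cn_map_def nderiv_diff [OF assms] intro!: differentiable_diff continuous_intros)

lemma mlin_norm_le_iff:
  "mlin_norm l T \<le> c \<longleftrightarrow>
     (\<forall>vs. length vs = l \<longrightarrow> (\<forall>v\<in>set vs. norm v \<le> 1) \<longrightarrow> ennreal (norm (T vs)) \<le> c)"
  by (auto simp: mlin_norm_def SUP_le_iff)

lemma mlin_norm_upper:
  "length vs = l \<Longrightarrow> (\<And>v. v \<in> set vs \<Longrightarrow> norm v \<le> 1) \<Longrightarrow> ennreal (norm (T vs)) \<le> mlin_norm l T"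
  using mlin_norm_le_iff [of l T "mlin_norm l T"] by auto

lemma mlin_norm_diff_triangle:
  assumes "\<And>vs. length vs = l \<Longrightarrow> T vs = S vs + R vs"
  shows "mlin_norm l T \<le> mlin_norm l S + mlin_norm l R"
  unfolding mlin_norm_le_iff
proof (intro allI impI)
  fix vs :: "'a list"
  assume vs: "length vs = l" "\<forall>v\<in>set vs. norm v \<le> 1"
  have "ennreal (norm (T vs)) \<le> ennreal (norm (S vs)) + ennreal (norm (R vs))"
    using assms [OF vs(1)]
    by (simp add: norm_triangle_ineq flip: ennreal_plus)
  also have "\<dots> \<le> mlin_norm l S + mlin_norm l R"
    using vs by (intro add_mono mlin_norm_upper) auto
  finally show "ennreal (norm (T vs)) \<le> mlin_norm l S + mlin_norm l R" .
qed

lemma mlin_norm_cong_norm: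
  assumes "\<And>vs. length vs = l \<Longrightarrow> norm (T vs) = norm (S vs)"
  shows "mlin_norm l T = mlin_norm l S"
  unfolding mlin_norm_def using assms by (intro SUP_cong) auto

lemma Cna_norm_le_iff:
  "Cna_norm n \<alpha> f \<le> c \<longleftrightarrow>
     (\<forall>x l. l \<le> n \<longrightarrow> mlin_norm l (\<lambda>vs. nderiv f vs x) \<le> c) \<and>
     (\<forall>x y. x \<noteq> y \<longrightarrow> mlin_norm n (\<lambda>vs. nderiv f vs x - nderiv f vs y) / ennreal (norm (x - y) powr \<alpha>) \<le> c)"
  by (auto simp: Cna_norm_def SUP_le_iff)

lemma Cna_norm_upper:
  "l \<le> n \<Longrightarrow> mlin_norm l (\<lambda>vs. nderiv f vs x) \<le> Cna_norm n \<alpha> f"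
  "x \<noteq> y \<Longrightarrow> mlin_norm n (\<lambda>vs. nderiv f vs x - nderiv f vs y) / ennreal (norm (x - y) powr \<alpha>) \<le> Cna_norm n \<alpha> f"
  using Cna_norm_le_iff [of n \<alpha> f "Cna_norm n \<alpha> f"] by auto

lemma Cna_norm_triangle:
  assumes "Cn_map n f" "Cn_map n g" "Cn_map n h"
  shows "Cna_norm n \<alpha> (\<lambda>x. f x - h x) \<le> Cna_norm n \<alpha> (\<lambda>x. f x - g x) + Cna_norm n \<alpha> (\<lambda>x. g x - h x)"
  unfolding Cna_norm_le_iff
proof (intro conjI allI impI)
  note D = nderiv_diff [OF assms(1,3)] nderiv_diff [OF assms(1,2)] nderiv_diff [OF assms(2,3)]
  fix x l assume l: "l \<le> n"
  have "mlin_norm l (\<lambda>vs. nderiv (\<lambda>x. f x - h x) vs x) \<le>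
     mlin_norm l (\<lambda>vs. nderiv (\<lambda>x. f x - g x) vs x) + mlin_norm l (\<lambda>vs. nderiv (\<lambda>x. g x - h x) vs x)"
    using l by (intro mlin_norm_diff_triangle) (simp add: D)
  also have "\<dots> \<le> Cna_norm n \<alpha> (\<lambda>x. f x - g x) + Cna_norm n \<alpha> (\<lambda>x. g x - h x)"
    using l by (intro add_mono Cna_norm_upper)
  finally show "mlin_norm l (\<lambda>vs. nderiv (\<lambda>x. f x - h x) vs x) \<le>
     Cna_norm n \<alpha> (\<lambda>x. f x - g x) + Cna_norm n \<alpha> (\<lambda>x. g x - h x)" .
next
  note D = nderiv_diff [OF assms(1,3)] nderiv_diff [OF assms(1,2)] nderiv_diff [OF assms(2,3)]
  fix x y :: 'a assume xy: "x \<noteq> y"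
  define c where "c = ennreal (norm (x - y) powr \<alpha>)"
  have "mlin_norm n (\<lambda>vs. nderiv (\<lambda>x. f x - h x) vs x - nderiv (\<lambda>x. f x - h x) vs y) / c \<le>
     (mlin_norm n (\<lambda>vs. nderiv (\<lambda>x. f x - g x) vs x - nderiv (\<lambda>x. f x - g x) vs y) +
      mlin_norm n (\<lambda>vs. nderiv (\<lambda>x. g x - h x) vs x - nderiv (\<lambda>x. g x - h x) vs y)) / c"
    by (intro divide_right_mono_ennreal mlin_norm_diff_triangle) (simp add: D)
  also have "\<dots> \<le> Cna_norm n \<alpha> (\<lambda>x. f x - g x) + Cna_norm n \<alpha> (\<lambda>x. g x - h x)"
    unfolding add_divide_distrib_ennreal c_def
    using xy by (intro add_mono Cna_norm_upper)
  finally show "mlin_norm n (\<lambda>vs. nderiv (\<lambda>x. f x - h x) vs x - nderiv (\<lambda>x. f x - h x) vs y) /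
      ennreal (norm (x - y) powr \<alpha>) \<le>
     Cna_norm n \<alpha> (\<lambda>x. f x - g x) + Cna_norm n \<alpha> (\<lambda>x. g x - h x)"
    unfolding c_def .
qed

lemma Cna_norm_commute:
  assumes "Cn_map n f" "Cn_map n g"
  shows "Cna_norm n \<alpha> (\<lambda>x. f x - g x) = Cna_norm n \<alpha> (\<lambda>x. g x - f x)"
proof -
  note D = nderiv_diff [OF assms] nderiv_diff [OF assms(2,1)]
  have 1: "mlin_norm l (\<lambda>vs. nderiv (\<lambda>x. f x - g x) vs x) = mlin_norm l (\<lambda>vs. nderiv (\<lambda>x. g x - f x) vs x)"
    if "l \<le> n" for l x
    using that by (intro mlin_norm_cong_norm) (simp add: D norm_minus_commute)
  have 2: "mlin_norm n (\<lambda>vs. nderiv (\<lambda>x. f x - g x) vs x - nderiv (\<lambda>x. f x - g x) vs y) =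
      mlin_norm n (\<lambda>vs. nderiv (\<lambda>x. g x - f x) vs x - nderiv (\<lambda>x. g x - f x) vs y)" for x y
  proof (intro mlin_norm_cong_norm)
    fix vs :: "'a list" assume "length vs = n"
    then have "nderiv (\<lambda>x. f x - g x) vs x - nderiv (\<lambda>x. f x - g x) vs y =
        - (nderiv (\<lambda>x. g x - f x) vs x - nderiv (\<lambda>x. g x - f x) vs y)"
      by (simp add: D)
    then show "norm (nderiv (\<lambda>x. f x - g x) vs x - nderiv (\<lambda>x. f x - g x) vs y) =
        norm (nderiv (\<lambda>x. g x - f x) vs x - nderiv (\<lambda>x. g x - f x) vs y)"
      by (metis norm_minus_cancel)
  qed
  show ?thesis
    unfolding Cna_norm_def by (intro arg_cong2 [of _ _ _ _ max] SUP_cong) (auto simp: 1 2)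
qed

lemma norm_le_Cna_norm: "ennreal (norm (f x)) \<le> Cna_norm n \<alpha> f"
  using mlin_norm_upper [of "[]" 0 "\<lambda>vs. nderiv f vs x"] Cna_norm_upper(1) [of 0 n f x \<alpha>] by simp

lemma nderiv_zero: "nderiv (\<lambda>x. 0) vs = (\<lambda>x. 0)"
  by (induction vs) (auto simp: frechet_derivative_const)

lemma mlin_norm_zero: "mlin_norm l (\<lambda>vs. 0) = 0"
  using mlin_norm_le_iff [of l "\<lambda>vs. 0" 0] by simp

lemma Cna_norm_zero: "Cna_norm n \<alpha> (\<lambda>x. 0) = 0"
  using Cna_norm_le_iff [of n \<alpha> "\<lambda>x. 0" 0] by (simp add: nderiv_zero mlin_norm_zero)

lemma Cna_norm_diff_eq_0_iff: "Cna_norm n \<alpha> (\<lambda>x. f x - g x) = 0 \<longleftrightarrow> f = g"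
proof
  assume 0: "Cna_norm n \<alpha> (\<lambda>x. f x - g x) = 0"
  show "f = g"
  proof
    fix x show "f x = g x"
      using norm_le_Cna_norm [of "\<lambda>x. f x - g x" x n \<alpha>] by (simp add: 0)
  qed
qed (simp add: Cna_norm_zero)

lemma C0_space_Cn_map: "f \<in> C0_space n \<alpha> \<Longrightarrow> Cn_map n f"
  and C0_space_finite: "f \<in> C0_space n \<alpha> \<Longrightarrow> Cna_norm n \<alpha> f < \<infinity>"
  by (auto simp: C0_space_def)

lemma zero_Cn_map: "Cn_map n (\<lambda>x. 0)"
  by (auto simp: Cn_map_def nderiv_zero)

lemma C0_diff_finite:
  assumes "f \<in> C0_space n \<alpha>" "g \<in> C0_space n \<alpha>"
  shows "Cna_norm n \<alpha> (\<lambda>x. f x - g x) < \<infinity>"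
proof -
  have fg: "Cn_map n f" "Cn_map n g"
    using assms by (auto intro: C0_space_Cn_map)
  have "Cna_norm n \<alpha> (\<lambda>x. f x - g x) \<le> Cna_norm n \<alpha> (\<lambda>x. f x - 0) + Cna_norm n \<alpha> (\<lambda>x. 0 - g x)"
    by (rule Cna_norm_triangle [OF fg(1) zero_Cn_map fg(2)])
  also have "Cna_norm n \<alpha> (\<lambda>x. 0 - g x) = Cna_norm n \<alpha> (\<lambda>x. g x - 0)"
    by (rule Cna_norm_commute [OF zero_Cn_map fg(2)])
  finally show ?thesis
    using C0_space_finite [OF assms(1)] C0_space_finite [OF assms(2)]
    by (simp add: ennreal_add_less_top order.strict_trans1 less_top)
qed

theorem Metric_space_diff_group: "Metric_space (diff_group n \<alpha>) (diff_dist n \<alpha>)"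
proof -
  let ?r = "\<lambda>(\<Phi> :: real^'d \<Rightarrow> real^'d) x. \<Phi> x - x"
  have C0: "?r f \<in> C0_space n \<alpha>" if "f \<in> diff_group n \<alpha>" for f
    using that by (simp add: diff_group_def)
  have eq: "(\<lambda>x. f x - g x) = (\<lambda>x. ?r f x - ?r g x)" for f g
    by simp
  have fin: "Cna_norm n \<alpha> (\<lambda>x. f x - g x) < \<infinity>" if "f \<in> diff_group n \<alpha>" "g \<in> diff_group n \<alpha>" for f g
    unfolding eq [of f g] using that by (intro C0_diff_finite C0)
  have comm: "Cna_norm n \<alpha> (\<lambda>x. f x - g x) = Cna_norm n \<alpha> (\<lambda>x. g x - f x)"
    if "f \<in> diff_group n \<alpha>" "g \<in> diff_group n \<alpha>" for f g
    unfolding eq [of f g] eq [of g f] using that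
    by (intro Cna_norm_commute C0_space_Cn_map [of _ n \<alpha>] C0)
  show ?thesis
  proof
    fix f g h :: "real^'d \<Rightarrow> real^'d"
    show "0 \<le> diff_dist n \<alpha> f g"
      by (simp add: diff_dist_def)
    show "diff_dist n \<alpha> f g = diff_dist n \<alpha> g f"
      using comm [of f g] by (auto simp: diff_dist_def)
    assume fg: "f \<in> diff_group n \<alpha>" "g \<in> diff_group n \<alpha>"
    show "diff_dist n \<alpha> f g = 0 \<longleftrightarrow> f = g"
      using fin [OF fg] Cna_norm_diff_eq_0_iff [of n \<alpha> f g] fg
      by (auto simp: diff_dist_def enn2real_eq_0_iff)
    assume h: "h \<in> diff_group n \<alpha>"
    have "Cna_norm n \<alpha> (\<lambda>x. f x - h x) \<le> Cna_norm n \<alpha> (\<lambda>x. f x - g x) + Cna_norm n \<alpha> (\<lambda>x. g x - h x)"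
      unfolding eq [of f h] eq [of f g] eq [of g h]
      by (intro Cna_norm_triangle C0_space_Cn_map [of _ n \<alpha>] C0 fg h)
    then show "diff_dist n \<alpha> f h \<le> diff_dist n \<alpha> f g + diff_dist n \<alpha> g h"
      using fin [OF fg] fin [OF fg(2) h] fg h
      by (simp add: diff_dist_def enn2real_mono flip: enn2real_plus)
  qed
qed

lemma lebesgue_on_null_subset:
  assumes "N \<in> null_sets (lebesgue_on {0..1::real})" "A \<subseteq> N"
  shows "A \<in> sets (lebesgue_on {0..1})"
proof -
  have "N \<in> null_sets lebesgue" "N \<subseteq> {0..1}"
    using assms(1) by (auto simp: null_sets_restrict_space)
  then have "A \<in> null_sets lebesgue"
    using assms(2) null_sets_completion_subset by blast
  then show ?thesis
    using assms(2) \<open>N \<subseteq> {0..1}\<close> by (subst sets_restrict_space_iff) auto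
qed

lemma borel_measurable_AE_LIMSEQ:
  fixes f :: "real \<Rightarrow> ennreal"
  assumes F: "\<And>k. F k \<in> borel_measurable (lebesgue_on {0..1})"
    and lim: "AE t in lebesgue_on {0..1}. (\<lambda>k. F k t) \<longlonglongrightarrow> f t"
  shows "f \<in> borel_measurable (lebesgue_on {0..1})"
proof -
  let ?M = "lebesgue_on {0..1::real}"
  obtain N where N: "{t \<in> space ?M. \<not> (\<lambda>k. F k t) \<longlonglongrightarrow> f t} \<subseteq> N" "N \<in> null_sets ?M"
    using lim by (auto elim!: AE_E simp: null_sets_def)
  define g where "g t = (if t \<in> N then 0 else f t)" for t
  have g: "g \<in> borel_measurable ?M"
  proof (rule borel_measurable_LIMSEQ_order)
    show "(\<lambda>k. if t \<in> N then 0 else F k t) \<longlonglongrightarrow> g t" if "t \<in> space ?M" for t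
      using N that by (auto simp: g_def)
    show "(\<lambda>t. if t \<in> N then 0 else F k t) \<in> borel_measurable ?M" for k
      using N(2) F [of k] by (intro measurable_If_set) (auto intro: sets.Int_space_eq2 [THEN ssubst])
  qed
  show ?thesis
  proof (rule measurableI)
    fix A :: "ennreal set" assume A: "A \<in> sets borel"
    have eq: "f -` A \<inter> space ?M = ((g -` A \<inter> space ?M) - N) \<union> (f -` A \<inter> space ?M \<inter> N)"
      by (auto simp: g_def)
    have "(g -` A \<inter> space ?M) - N \<in> sets ?M"
      using measurable_sets [OF g A] N(2) by auto
    moreover have "f -` A \<inter> space ?M \<inter> N \<in> sets ?M"
      by (rule lebesgue_on_null_subset [OF N(2)]) auto
    ultimately show "f -` A \<inter> space ?M \<in> sets ?M"
      by (subst eq) (rule sets.Un)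
  qed auto
qed

lemma ennreal_tendsto_squeeze:
  fixes f e :: "nat \<Rightarrow> ennreal"
  assumes "l \<noteq> \<infinity>" "e \<longlonglongrightarrow> 0" "\<And>k. f k \<le> l + e k" "\<And>k. l \<le> f k + e k"
  shows "f \<longlonglongrightarrow> l"
proof (rule tendsto_sandwich)
  show "(\<lambda>k. l - e k) \<longlonglongrightarrow> l"
    using tendsto_diff_ennreal [OF tendsto_const assms(2), of l] assms(1) by simp
  show "(\<lambda>k. l + e k) \<longlonglongrightarrow> l"
    using tendsto_add [OF tendsto_const assms(2), of l] by simp
  show "\<forall>\<^sub>F k in sequentially. l - e k \<le> f k"
    using assms(4) by (intro always_eventually allI) (use assms(1) in \<open>simp add: ennreal_minus_le_iff add.commute\<close>)
qed (use assms(3) in auto)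

lemma Cna_norm_tendsto:
  assumes "u \<in> C0_space n \<beta>" "v \<in> C0_space n \<beta>" "\<And>k. s k \<in> C0_space n \<beta>" "\<And>k. r k \<in> C0_space n \<beta>"
    and "(\<lambda>k. Cna_norm n \<beta> (\<lambda>x. u x - s k x)) \<longlonglongrightarrow> 0" "(\<lambda>k. Cna_norm n \<beta> (\<lambda>x. v x - r k x)) \<longlonglongrightarrow> 0"
  shows "(\<lambda>k. Cna_norm n \<beta> (\<lambda>x. s k x - r k x)) \<longlonglongrightarrow> Cna_norm n \<beta> (\<lambda>x. u x - v x)"
proof -
  let ?N = "\<lambda>f g. Cna_norm n \<beta> (\<lambda>x. f x - g x)"
  note C = assms(1-4) [THEN C0_space_Cn_map]
  show ?thesis
  proof (rule ennreal_tendsto_squeeze [where e = "\<lambda>k. ?N u (s k) + ?N v (r k)"])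
    show "?N u v \<noteq> \<infinity>"
      using C0_diff_finite [OF assms(1,2)] by simp
    show "(\<lambda>k. ?N u (s k) + ?N v (r k)) \<longlonglongrightarrow> 0"
      using tendsto_add [OF assms(5,6)] by simp
    fix k
    have "?N (s k) (r k) \<le> ?N (s k) u + ?N u (r k)"
      by (intro Cna_norm_triangle C)
    also have "?N u (r k) \<le> ?N u v + ?N v (r k)"
      by (intro Cna_norm_triangle C)
    finally show "?N (s k) (r k) \<le> ?N u v + (?N u (s k) + ?N v (r k))"
      by (simp add: Cna_norm_commute [OF C(3) C(1)] ac_simps add_left_mono)
    have "?N u v \<le> ?N u (s k) + ?N (s k) v"
      by (intro Cna_norm_triangle C)
    also have "?N (s k) v \<le> ?N (s k) (r k) + ?N (r k) v"
      by (intro Cna_norm_triangle C)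
    finally show "?N u v \<le> ?N (s k) (r k) + (?N u (s k) + ?N v (r k))"
      by (simp add: Cna_norm_commute [OF C(4) C(2)] ac_simps add_left_mono)
  qed
qed

lemma bochner_fun_C0: "u \<in> bochner_fun n \<beta> \<Longrightarrow> t \<in> {0..1} \<Longrightarrow> u t \<in> C0_space n \<beta>"
  by (auto simp: bochner_fun_def)

lemma simple_Cna_norm:
  assumes "simple_function M s" "simple_function M r"
  shows "simple_function M (\<lambda>t. Cna_norm n \<beta> (\<lambda>x. s t x - r t x))"
  using simple_function_compose2 [OF assms, of "\<lambda>f g. Cna_norm n \<beta> (\<lambda>x. f x - g x)"] .

lemma bochner_fun_measurable:
  assumes "u \<in> bochner_fun n \<beta>" "v \<in> bochner_fun n \<beta>"
  shows "(\<lambda>t. Cna_norm n \<beta> (\<lambda>x. u t x - v t x)) \<in> borel_measurable (lebesgue_on {0..1})"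
proof -
  let ?M = "lebesgue_on {0..1::real}"
  obtain s where s: "\<And>k. simple_function ?M (s k)" "\<And>k t. t \<in> {0..1} \<Longrightarrow> s k t \<in> C0_space n \<beta>"
      "AE t in ?M. (\<lambda>k. Cna_norm n \<beta> (\<lambda>x. u t x - s k t x)) \<longlonglongrightarrow> 0"
    using assms(1) unfolding bochner_fun_def by blast
  obtain r where r: "\<And>k. simple_function ?M (r k)" "\<And>k t. t \<in> {0..1} \<Longrightarrow> r k t \<in> C0_space n \<beta>"
      "AE t in ?M. (\<lambda>k. Cna_norm n \<beta> (\<lambda>x. v t x - r k t x)) \<longlonglongrightarrow> 0"
    using assms(2) unfolding bochner_fun_def by blast
  show ?thesis
  proof (rule borel_measurable_AE_LIMSEQ)
    show "(\<lambda>t. Cna_norm n \<beta> (\<lambda>x. s k t x - r k t x)) \<in> borel_measurable ?M" for k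
      using s(1) r(1) by (intro borel_measurable_simple_function simple_Cna_norm)
    show "AE t in ?M. (\<lambda>k. Cna_norm n \<beta> (\<lambda>x. s k t x - r k t x)) \<longlonglongrightarrow> Cna_norm n \<beta> (\<lambda>x. u t x - v t x)"
      using s(3) r(3) AE_space
    proof eventually_elim
      case (elim t)
      then have t: "t \<in> {0..1}" by simp
      show ?case
        using elim(1,2)
        by (intro Cna_norm_tendsto bochner_fun_C0 [OF assms(1) t] bochner_fun_C0 [OF assms(2) t] s(2) r(2) t)
    qed
  qed
qed

lemma nn_integral_Cna_triangle:
  assumes "\<And>t. t \<in> {0..1} \<Longrightarrow> u t \<in> C0_space n \<beta>" "\<And>t. t \<in> {0..1} \<Longrightarrow> v t \<in> C0_space n \<beta>"
      "\<And>t. t \<in> {0..1} \<Longrightarrow> w t \<in> C0_space n \<beta>"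
    and "(\<lambda>t. Cna_norm n \<beta> (\<lambda>x. u t x - v t x)) \<in> borel_measurable (lebesgue_on {0..1})"
      "(\<lambda>t. Cna_norm n \<beta> (\<lambda>x. v t x - w t x)) \<in> borel_measurable (lebesgue_on {0..1})"
  shows "(\<integral>\<^sup>+t. Cna_norm n \<beta> (\<lambda>x. u t x - w t x) \<partial>lebesgue_on {0..1}) \<le>
     (\<integral>\<^sup>+t. Cna_norm n \<beta> (\<lambda>x. u t x - v t x) \<partial>lebesgue_on {0..1}) +
     (\<integral>\<^sup>+t. Cna_norm n \<beta> (\<lambda>x. v t x - w t x) \<partial>lebesgue_on {0..1})"
  unfolding nn_integral_add [OF assms(4,5), symmetric]
  by (intro nn_integral_mono Cna_norm_triangle) (auto intro: assms(1-3) [THEN C0_space_Cn_map])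

lemma simple_bochner_fun:
  assumes "simple_function (lebesgue_on {0..1}) s" "\<And>t. t \<in> {0..1} \<Longrightarrow> s t \<in> C0_space n \<beta>"
  shows "s \<in> bochner_fun n \<beta>"
  unfolding bochner_fun_def using assms
  by (auto intro!: exI [of _ "\<lambda>_. s"] simp: Cna_norm_zero)

lemma nn_integral_Cna_commute:
  assumes "\<And>t. t \<in> {0..1} \<Longrightarrow> u t \<in> C0_space n \<beta>" "\<And>t. t \<in> {0..1} \<Longrightarrow> v t \<in> C0_space n \<beta>"
  shows "(\<integral>\<^sup>+t. Cna_norm n \<beta> (\<lambda>x. u t x - v t x) \<partial>lebesgue_on {0..1}) =
     (\<integral>\<^sup>+t. Cna_norm n \<beta> (\<lambda>x. v t x - u t x) \<partial>lebesgue_on {0..1})"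
  by (intro nn_integral_cong Cna_norm_commute) (auto intro: assms [THEN C0_space_Cn_map])

lemma nn_integral_simple_finite:
  fixes s r :: "real \<Rightarrow> 'a::euclidean_space \<Rightarrow> 'b::real_normed_vector"
  assumes "simple_function (lebesgue_on {0..1}) s" "\<And>t. t \<in> {0..1} \<Longrightarrow> s t \<in> C0_space n \<beta>"
    and "simple_function (lebesgue_on {0..1}) r" "\<And>t. t \<in> {0..1} \<Longrightarrow> r t \<in> C0_space n \<beta>"
  shows "(\<integral>\<^sup>+t. Cna_norm n \<beta> (\<lambda>x. s t x - r t x) \<partial>lebesgue_on {0..1}) < \<infinity>"
proof -
  let ?M = "lebesgue_on {0..1::real}" and ?g = "\<lambda>t. Cna_norm n \<beta> (\<lambda>x. s t x - r t x)"
  have "simple_function ?M ?g"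
    using assms by (intro simple_Cna_norm)
  then have fin: "finite (?g ` {0..1})"
    by (auto simp: simple_function_def)
  have "?g t < \<infinity>" if "t \<in> {0..1}" for t
    using that by (intro C0_diff_finite assms)
  then have top: "Max (?g ` {0..1}) < \<infinity>"
    using fin by (subst Max_less_iff) auto
  have "(\<integral>\<^sup>+t. ?g t \<partial>?M) \<le> (\<integral>\<^sup>+t. Max (?g ` {0..1}) \<partial>?M)"
    using fin by (intro nn_integral_mono) auto
  also have "\<dots> < \<infinity>"
    using top by (simp add: emeasure_restrict_space)
  finally show ?thesis .
qed

lemma bochner_fun_approx:
  assumes "u \<in> bochner_fun n \<beta>"
  obtains s where "simple_function (lebesgue_on {0..1}) s" "\<And>t. t \<in> {0..1} \<Longrightarrow> s t \<in> C0_space n \<beta>"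
    "(\<integral>\<^sup>+t. Cna_norm n \<beta> (\<lambda>x. u t x - s t x) \<partial>lebesgue_on {0..1}) < \<infinity>"
proof -
  obtain s where s: "\<And>k. simple_function (lebesgue_on {0..1}) (s k)" "\<And>k t. t \<in> {0..1} \<Longrightarrow> s k t \<in> C0_space n \<beta>"
      "(\<lambda>k. \<integral>\<^sup>+t. Cna_norm n \<beta> (\<lambda>x. u t x - s k t x) \<partial>lebesgue_on {0..1}) \<longlonglongrightarrow> 0"
    using assms unfolding bochner_fun_def by blast
  have "\<forall>\<^sub>F k in sequentially. (\<integral>\<^sup>+t. Cna_norm n \<beta> (\<lambda>x. u t x - s k t x) \<partial>lebesgue_on {0..1}) < 1"
    using s(3) by (rule order_tendstoD) simp
  then obtain k where "(\<integral>\<^sup>+t. Cna_norm n \<beta> (\<lambda>x. u t x - s k t x) \<partial>lebesgue_on {0..1}) < 1"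
    by (auto simp: eventually_sequentially)
  then have "(\<integral>\<^sup>+t. Cna_norm n \<beta> (\<lambda>x. u t x - s k t x) \<partial>lebesgue_on {0..1}) < \<infinity>"
    by (rule order.strict_trans) simp
  then show thesis
    using that [of "s k"] s(1,2) by blast
qed

lemma bochner_fun_triangle:
  assumes "u \<in> bochner_fun n \<beta>" "v \<in> bochner_fun n \<beta>" "w \<in> bochner_fun n \<beta>"
  shows "(\<integral>\<^sup>+t. Cna_norm n \<beta> (\<lambda>x. u t x - w t x) \<partial>lebesgue_on {0..1}) \<le>
     (\<integral>\<^sup>+t. Cna_norm n \<beta> (\<lambda>x. u t x - v t x) \<partial>lebesgue_on {0..1}) +
     (\<integral>\<^sup>+t. Cna_norm n \<beta> (\<lambda>x. v t x - w t x) \<partial>lebesgue_on {0..1})"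
  by (rule nn_integral_Cna_triangle [OF bochner_fun_C0 [OF assms(1)] bochner_fun_C0 [OF assms(2)]
        bochner_fun_C0 [OF assms(3)] bochner_fun_measurable [OF assms(1,2)]
        bochner_fun_measurable [OF assms(2,3)]])

lemma bochner_fun_dist_finite:
  assumes "u \<in> bochner_fun n \<beta>" "v \<in> bochner_fun n \<beta>"
  shows "(\<integral>\<^sup>+t. Cna_norm n \<beta> (\<lambda>x. u t x - v t x) \<partial>lebesgue_on {0..1}) < \<infinity>"
proof -
  let ?I = "\<lambda>u v. \<integral>\<^sup>+t. Cna_norm n \<beta> (\<lambda>x. u t x - v t x) \<partial>lebesgue_on {0..1}"
  obtain s where s: "simple_function (lebesgue_on {0..1}) s" "\<And>t. t \<in> {0..1} \<Longrightarrow> s t \<in> C0_space n \<beta>"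
    "?I u s < \<infinity>"
    using bochner_fun_approx [OF assms(1)] by blast
  obtain r where r: "simple_function (lebesgue_on {0..1}) r" "\<And>t. t \<in> {0..1} \<Longrightarrow> r t \<in> C0_space n \<beta>"
    "?I v r < \<infinity>"
    using bochner_fun_approx [OF assms(2)] by blast
  note B = simple_bochner_fun [OF s(1,2)] simple_bochner_fun [OF r(1,2)]
  have "?I u v \<le> ?I u s + ?I s v"
    by (rule bochner_fun_triangle [OF assms(1) B(1) assms(2)])
  also have "?I s v \<le> ?I s r + ?I r v"
    by (rule bochner_fun_triangle [OF B assms(2)])
  also have "?I r v = ?I v r"
    by (rule nn_integral_Cna_commute [OF r(2) bochner_fun_C0 [OF assms(2)]])
  finally have "?I u v \<le> ?I u s + (?I s r + ?I v r)"
    by (simp add: add_left_mono)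
  also have "\<dots> < \<infinity>"
    using s(3) r(3) nn_integral_simple_finite [OF s(1,2) r(1,2)] by simp
  finally show ?thesis .
qed

lemma fun_dist_triangle:
  assumes "u \<in> bochner_fun n \<beta>" "v \<in> bochner_fun n \<beta>" "w \<in> bochner_fun n \<beta>"
  shows "fun_dist n \<beta> u w \<le> fun_dist n \<beta> u v + fun_dist n \<beta> v w"
proof -
  let ?I = "\<lambda>u v. \<integral>\<^sup>+t. Cna_norm n \<beta> (\<lambda>x. u t x - v t x) \<partial>lebesgue_on {0..1}"
  have fin: "?I u v < top" "?I v w < top"
    using bochner_fun_dist_finite [OF assms(1,2)] bochner_fun_dist_finite [OF assms(2,3)] by simp_all
  have "?I u w \<le> ?I u v + ?I v w"
    by (rule bochner_fun_triangle [OF assms])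
  then have "enn2real (?I u w) \<le> enn2real (?I u v + ?I v w)"
    using fin by (intro enn2real_mono) simp_all
  also have "\<dots> = enn2real (?I u v) + enn2real (?I v w)"
    using fin by (rule enn2real_plus)
  finally show ?thesis
    by (simp only: fun_dist_def)
qed

lemma fun_dist_commute:
  assumes "u \<in> bochner_fun n \<beta>" "v \<in> bochner_fun n \<beta>"
  shows "fun_dist n \<beta> u v = fun_dist n \<beta> v u"
  unfolding fun_dist_def
  by (rule arg_cong [where f = enn2real],
      rule nn_integral_Cna_commute [OF bochner_fun_C0 [OF assms(1)] bochner_fun_C0 [OF assms(2)]])

lemma fun_dist_eq_0_iff:
  assumes "u \<in> bochner_fun n \<beta>" "v \<in> bochner_fun n \<beta>"
  shows "fun_dist n \<beta> u v = 0 \<longleftrightarrow> (AE t in lebesgue_on {0..1}. u t = v t)"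
  unfolding fun_dist_def
  using bochner_fun_dist_finite [OF assms]
  by (auto simp: enn2real_eq_0_iff nn_integral_0_iff_AE bochner_fun_measurable [OF assms]
      Cna_norm_diff_eq_0_iff)

lemma equiv_ae_rel: "equiv (bochner_fun n \<beta>) (ae_rel n \<beta>)"
proof (rule equivI)
  show "ae_rel n \<beta> \<subseteq> bochner_fun n \<beta> \<times> bochner_fun n \<beta>"
    by (auto simp: ae_rel_def)
  show "refl_on (bochner_fun n \<beta>) (ae_rel n \<beta>)"
    by (auto simp: refl_on_def ae_rel_def)
  show "sym (ae_rel n \<beta>)"
    by (auto simp: sym_def ae_rel_def elim: eventually_mono)
  show "trans (ae_rel n \<beta>)"
    by (auto simp: trans_def ae_rel_def elim: eventually_elim2)
qed

lemma L1_dist_eq: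
  assumes U: "U \<in> bochner_fun n \<beta> // ae_rel n \<beta>" and V: "V \<in> bochner_fun n \<beta> // ae_rel n \<beta>"
    and uv: "u \<in> U" "v \<in> V"
  shows "L1_dist n \<beta> U V = fun_dist n \<beta> u v"
proof -
  have sub: "u' \<in> bochner_fun n \<beta>" if "u' \<in> W" "W \<in> bochner_fun n \<beta> // ae_rel n \<beta>" for u' W
    using that by (auto simp: quotient_def ae_rel_def)
  have le: "fun_dist n \<beta> a b \<le> fun_dist n \<beta> a' b'"
    if "a \<in> U" "a' \<in> U" "b \<in> V" "b' \<in> V" for a a' b b'
  proof -
    note B = sub [OF that(1) U] sub [OF that(2) U] sub [OF that(3) V] sub [OF that(4) V]
    have "(a, a') \<in> ae_rel n \<beta>" "(b', b) \<in> ae_rel n \<beta>"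
      using quotient_eq_iff [OF equiv_ae_rel U U that(1,2)] quotient_eq_iff [OF equiv_ae_rel V V that(4,3)]
      by auto
    then have "fun_dist n \<beta> a a' = 0" "fun_dist n \<beta> b' b = 0"
      using B by (auto simp: fun_dist_eq_0_iff ae_rel_def)
    with fun_dist_triangle [OF B(1,2,3)] fun_dist_triangle [OF B(2,4,3)] show ?thesis
      by simp
  qed
  then have "fun_dist n \<beta> a b = fun_dist n \<beta> u v" if "a \<in> U" "b \<in> V" for a b
    using that uv by (meson order_antisym)
  then have "(\<lambda>(u, v). fun_dist n \<beta> u v) ` (U \<times> V) = (\<lambda>_. fun_dist n \<beta> u v) ` (U \<times> V)"
    by (intro image_cong) auto
  also have "\<dots> = {fun_dist n \<beta> u v}"
    using uv by (auto simp: image_constant_conv)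
  finally have "(\<lambda>(u, v). fun_dist n \<beta> u v) ` (U \<times> V) = {fun_dist n \<beta> u v}" .
  then show ?thesis
    using U V by (simp add: L1_dist_def)
qed

theorem Metric_space_L1: "Metric_space (bochner_fun n \<beta> // ae_rel n \<beta>) (L1_dist n \<beta>)"
proof -
  let ?Q = "bochner_fun n \<beta> // ae_rel n \<beta> :: (real \<Rightarrow> real^'a \<Rightarrow> real^'a) set set"
  have ex: "\<exists>u. u \<in> U \<and> u \<in> bochner_fun n \<beta>" if "U \<in> ?Q" for U
    using that equiv_class_self [OF equiv_ae_rel [of n \<beta>]] by (auto elim!: quotientE)
  have outside: "L1_dist n \<beta> U V = 0" if "\<not> (U \<in> ?Q \<and> V \<in> ?Q)" for U V
    unfolding L1_dist_def using that by auto
  show ?thesis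
  proof
    fix U V W :: "(real \<Rightarrow> real^'a \<Rightarrow> real^'a) set"
    show "0 \<le> L1_dist n \<beta> U V"
    proof (cases "U \<in> ?Q \<and> V \<in> ?Q")
      case True
      then obtain u v where "u \<in> U" "v \<in> V"
        using ex by blast
      with True L1_dist_eq [of U n \<beta> V u v] show ?thesis
        by (simp add: fun_dist_def)
    qed (simp add: outside)
    show "L1_dist n \<beta> U V = L1_dist n \<beta> V U"
    proof (cases "U \<in> ?Q \<and> V \<in> ?Q")
      case True
      then obtain u v where "u \<in> U" "v \<in> V" "u \<in> bochner_fun n \<beta>" "v \<in> bochner_fun n \<beta>"
        using ex by blast
      with True L1_dist_eq [of U n \<beta> V u v] L1_dist_eq [of V n \<beta> U v u] show ?thesis
        by (simp add: fun_dist_commute [of u n \<beta> v])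
    qed (use outside [of U V] outside [of V U] in auto)
    assume UV: "U \<in> ?Q" "V \<in> ?Q"
    obtain u v where uv: "u \<in> U" "v \<in> V" "u \<in> bochner_fun n \<beta>" "v \<in> bochner_fun n \<beta>"
      using ex UV by blast
    have "L1_dist n \<beta> U V = 0 \<longleftrightarrow> (u, v) \<in> ae_rel n \<beta>"
      using L1_dist_eq [OF UV uv(1,2)] uv(3,4) by (simp add: fun_dist_eq_0_iff ae_rel_def)
    then show "L1_dist n \<beta> U V = 0 \<longleftrightarrow> U = V"
      using quotient_eq_iff [OF equiv_ae_rel UV uv(1,2)] by simp
    assume W: "W \<in> ?Q"
    obtain w where w: "w \<in> W" "w \<in> bochner_fun n \<beta>"
      using ex W by blast
    show "L1_dist n \<beta> U W \<le> L1_dist n \<beta> U V + L1_dist n \<beta> V W"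
      using L1_dist_eq [OF UV uv(1,2)] L1_dist_eq [OF UV(2) W uv(2) w(1)]
        L1_dist_eq [OF UV(1) W uv(1) w(1)] fun_dist_triangle [OF uv(3,4) w(2)]
      by simp
  qed
qed

end

(* Flows are controlled through jets, i.e. families of all partial derivatives of order at most n.
   By the chain rule the jet of u o Phi is a universal polynomial in the jets of u and Phi in which
   the highest derivative of Phi enters linearly. Hence Picard iteration, measured with the weight
   exp (c * int_0^t |u|), bounds all derivatives of the iterates, converges in C^n, and the same
   argument bounds the Hoelder seminorm of D^n Phi. Since D^n u is only beta-Hoelder, the flows
   Phi of u and Psi of v satisfy only |Phi - Psi| = O(|u - v|^beta) in C^n, while Phi - Psi stays
   bounded in C^{n,beta}. Interpolation between these two bounds gives O(|u - v|^(beta - alpha)) in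
   C^{n,alpha}. Continuity in time follows in the same way, and det d Phi > 0 because d Phi is
   invertible along the path and equals the identity at time 0. *)

theory Submission
  imports Defs
begin

section \<open>Jets\<close>

text \<open>The equations for the derivatives form a triangular system: each order involves its own
  unknown linearly and otherwise only lower orders. Bounds are therefore gained order by order, with
  \<open>jet_bound\<close> recording the constants. Once all derivatives lie in a fixed ball, the
  chain-rule polynomials are Lipschitz there, and differences of all positive orders are treated at
  once. The one ingredient that is not Lipschitz is the dependence of the top derivative of u on its
  argument. So order zero is estimated first, where u is Lipschitz because n \<ge> 1, and its error
  enters the higher orders as a known inhomogeneity raised to the power \<beta>.

  The mass of u need not be small. The weight makes the integral operator contract by 1/2 for any
  mass, so the flow is constructed on all of I at once, and Gronwall arguments reduce to improving a
  bound S to A + S / 2.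

  All constants depend only on n, \<beta>, the dimension and a bound R for the mass, hence are
  uniform on balls.\<close>

definition blists :: "nat \<Rightarrow> 'a::euclidean_space list set" where
  "blists n = {J. set J \<subseteq> Basis \<and> length J \<le> n}"

lemma finite_blists [simp]: "finite (blists n)"
  unfolding blists_def by (intro finite_lists_length_le) simp

lemma blists_Nil [simp]: "[] \<in> blists n"
  by (simp add: blists_def)

lemma blists_mono: "J \<in> blists k \<Longrightarrow> k \<le> n \<Longrightarrow> J \<in> blists n"
  by (simp add: blists_def)

lemma blists_Cons: "j \<in> Basis \<Longrightarrow> J \<in> blists n \<Longrightarrow> length J < n \<Longrightarrow> j # J \<in> blists n"
  by (simp add: blists_def)

lemma blists_Cons_Suc: "j \<in> Basis \<Longrightarrow> J \<in> blists n \<Longrightarrow> j # J \<in> blists (Suc n)"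
  by (simp add: blists_def)

lemma blists_ConsD: "j # J \<in> blists n \<Longrightarrow> j \<in> Basis \<and> J \<in> blists n \<and> length J < n"
  by (simp add: blists_def)

text \<open>A jet lists the candidates for the iterated partial derivatives \<open>g [j\<^sub>1, \<dots>, j\<^sub>l]\<close> of \<open>g []\<close>.\<close>

definition jet :: "nat \<Rightarrow> ('a::euclidean_space list \<Rightarrow> 'a \<Rightarrow> 'b::real_normed_vector) \<Rightarrow> bool" where
  "jet n g \<longleftrightarrow> (\<forall>J\<in>blists n. continuous_on UNIV (g J)) \<and>
     (\<forall>J\<in>blists n. length J < n \<longrightarrow>
        (\<forall>x. (g J has_derivative (\<lambda>v. \<Sum>j\<in>Basis. (v \<bullet> j) *\<^sub>R g (j # J) x)) (at x)))"

lemma jet_continuous: "jet n g \<Longrightarrow> J \<in> blists n \<Longrightarrow> continuous_on A (g J)"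
  by (auto simp: jet_def intro: continuous_on_subset)

lemma jet_derivative:
  "jet n g \<Longrightarrow> J \<in> blists n \<Longrightarrow> length J < n \<Longrightarrow>
     (g J has_derivative (\<lambda>v. \<Sum>j\<in>Basis. (v \<bullet> j) *\<^sub>R g (j # J) x)) (at x)"
  by (auto simp: jet_def)

lemma jet_diff:
  assumes "jet n f" "jet n g"
  shows "jet n (\<lambda>J x. f J x - g J x)"
  unfolding jet_def
  by (auto intro!: continuous_on_diff jet_continuous [OF assms(1)] jet_continuous [OF assms(2)]
      has_derivative_eq_rhs [OF has_derivative_diff [OF jet_derivative [OF assms(1)] jet_derivative [OF assms(2)]]]
      simp: scaleR_diff_right sum_subtractf)

text \<open>In a basis direction the derivative sum collapses to a single term, so a jet is
  determined by its entry at \<open>[]\<close>. This rigidity later lifts the fixed-point equation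
  from order zero to all orders.\<close>

lemma nderiv_jet:
  assumes g: "jet n g" and "J \<in> blists n"
  shows "nderiv (g []) J = g J"
  using assms(2)
proof (induction J)
  case (Cons j J)
  then have j: "j \<in> Basis" and J: "J \<in> blists n" "length J < n"
    by (auto dest: blists_ConsD)
  have "(\<Sum>i\<in>Basis. (j \<bullet> i) *\<^sub>R g (i # J) x) = g (j # J) x" for x
    using j by (simp add: inner_Basis if_distrib [of "\<lambda>c. c *\<^sub>R _"] cong: if_cong)
  with Cons.IH [OF J(1)] frechet_derivative_at [OF jet_derivative [OF g J], symmetric] show ?case
    by simp
qed simp

lemma Cn_map_jet:
  assumes "Cn_map n f"
  shows "jet n (nderiv f)"
  unfolding jet_def
proof (intro conjI ballI impI allI)
  fix J :: "'a list" and x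
  assume J: "J \<in> blists n"
  then show "continuous_on UNIV (nderiv f J)"
    using assms by (auto simp: Cn_map_def blists_def)
  assume l: "length J < n"
  then have D: "(nderiv f J has_derivative frechet_derivative (nderiv f J) (at x)) (at x)"
    using assms by (auto simp: Cn_map_def frechet_derivative_works)
  then have lin: "linear (frechet_derivative (nderiv f J) (at x))"
    by (rule has_derivative_linear)
  have "frechet_derivative (nderiv f J) (at x) v = (\<Sum>j\<in>Basis. (v \<bullet> j) *\<^sub>R nderiv f (j # J) x)" for v
  proof -
    have "frechet_derivative (nderiv f J) (at x) (\<Sum>j\<in>Basis. (v \<bullet> j) *\<^sub>R j) =
        (\<Sum>j\<in>Basis. (v \<bullet> j) *\<^sub>R nderiv f (j # J) x)"
      by (simp add: linear_sum [OF lin] linear_scale [OF lin])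
    then show ?thesis by (simp add: euclidean_representation)
  qed
  then show "(nderiv f J has_derivative (\<lambda>v. \<Sum>j\<in>Basis. (v \<bullet> j) *\<^sub>R nderiv f (j # J) x)) (at x)"
    by (intro has_derivative_eq_rhs [OF D] ext)
qed

section \<open>Derivatives in arbitrary directions, expanded over basis tuples\<close>

definition blists_eq :: "nat \<Rightarrow> 'a::euclidean_space list set" where
  "blists_eq l = {J. set J \<subseteq> Basis \<and> length J = l}"

lemma finite_blists_eq [simp]: "finite (blists_eq l)"
  unfolding blists_eq_def by (intro finite_lists_length_eq) simp

lemma length_blists_eq: "J \<in> blists_eq l \<Longrightarrow> length J = l"
  by (simp add: blists_eq_def)

lemma blists_eq_subset: "l \<le> n \<Longrightarrow> blists_eq l \<subseteq> blists n"
  by (auto simp: blists_def blists_eq_def)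

lemma sum_blists_eq_Suc:
  "(\<Sum>J\<in>blists_eq (Suc l). h J) = (\<Sum>J\<in>blists_eq l. \<Sum>j\<in>Basis. h (j # J))"
proof -
  have "(\<Sum>J\<in>blists_eq (Suc l). h J) = (\<Sum>p\<in>blists_eq l \<times> Basis. h (snd p # fst p))"
    by (rule sum.reindex_bij_witness [where i = "\<lambda>p. snd p # fst p" and j = "\<lambda>J. (tl J, hd J)"])
      (auto simp: blists_eq_def length_Suc_conv)
  then show ?thesis
    by (simp add: sum.cartesian_product case_prod_unfold)
qed

text \<open>The coordinate of the tensor product of the vectors \<open>vs\<close> along the basis
  tuple \<open>J\<close>; meaningful only for lists of equal length.\<close>

primrec coef :: "'a::euclidean_space list \<Rightarrow> 'a list \<Rightarrow> real" where
  "coef [] J = 1"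
| "coef (v # vs) J = (v \<bullet> hd J) * coef vs (tl J)"

lemma abs_coef_le_1:
  assumes "\<And>v. v \<in> set vs \<Longrightarrow> norm v \<le> 1" "J \<in> blists_eq (length vs)"
  shows "\<bar>coef vs J\<bar> \<le> 1"
  using assms
proof (induction vs arbitrary: J)
  case (Cons v vs)
  then obtain j J' where J: "J = j # J'" "j \<in> Basis" "J' \<in> blists_eq (length vs)"
    by (cases J) (auto simp: blists_eq_def)
  have "\<bar>v \<bullet> j\<bar> \<le> norm v * norm j"
    by (rule Cauchy_Schwarz_ineq2)
  also have "\<dots> \<le> 1"
    using Cons.prems(1) [of v] J by simp
  finally have "\<bar>v \<bullet> j\<bar> * \<bar>coef vs J'\<bar> \<le> 1 * 1"
    using Cons J by (intro mult_mono) auto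
  then show ?case
    by (simp add: J abs_mult)
qed simp

text \<open>Multilinearity, one direction at a time. It reduces \<open>mlin_norm\<close>, a supremum
  over all directions, to finitely many jet entries.\<close>

lemma nderiv_expand:
  assumes g: "jet n g" and "length vs \<le> n"
  shows "nderiv (g []) vs = (\<lambda>x. \<Sum>J\<in>blists_eq (length vs). coef vs J *\<^sub>R g J x)"
  using assms(2)
proof (induction vs)
  case Nil
  have "blists_eq 0 = {[] :: 'a list}" by (auto simp: blists_eq_def)
  then show ?case by simp
next
  case (Cons v vs)
  let ?F = "\<lambda>x. \<Sum>J\<in>blists_eq (length vs). coef vs J *\<^sub>R g J x"
  have "(?F has_derivative (\<lambda>w. \<Sum>J\<in>blists_eq (length vs). coef vs J *\<^sub>R (\<Sum>j\<in>Basis. (w \<bullet> j) *\<^sub>R g (j # J) x))) (at x)" for x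
    using Cons.prems blists_eq_subset [of "length vs" n]
    by (intro has_derivative_sum has_derivative_scaleR_right jet_derivative [OF g]) (auto simp: length_blists_eq)
  note fd = frechet_derivative_at [OF this, symmetric]
  from Cons have "nderiv (g []) (v # vs) x = (\<Sum>J\<in>blists_eq (length vs). coef vs J *\<^sub>R (\<Sum>j\<in>Basis. (v \<bullet> j) *\<^sub>R g (j # J) x))" for x
    by (simp add: fd)
  then show ?case
    by (simp add: fun_eq_iff sum_blists_eq_Suc scaleR_sum_right ac_simps)
qed

lemma jet_Cn_map:
  assumes g: "jet n g"
  shows "Cn_map n (g [])"
  unfolding Cn_map_def
proof (intro conjI allI impI)
  fix vs :: "'a list" and x
  assume l: "length vs < n"
  show "nderiv (g []) vs differentiable at x"
    using l blists_eq_subset [of "length vs" n]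
    by (subst nderiv_expand [OF g])
      (auto intro!: differentiable_sum differentiable_scaleR differentiableI [OF jet_derivative [OF g]] simp: length_blists_eq)
next
  fix vs :: "'a list"
  assume l: "length vs \<le> n"
  show "continuous_on UNIV (nderiv (g []) vs)"
    using l blists_eq_subset [of "length vs" n]
    by (subst nderiv_expand [OF g]) (auto intro!: continuous_intros jet_continuous [OF g])
qed

lemma norm_sum_coef_le:
  fixes h :: "'a::euclidean_space list \<Rightarrow> 'b::real_normed_vector"
  assumes "\<And>v. v \<in> set vs \<Longrightarrow> norm v \<le> 1"
  shows "norm (\<Sum>J\<in>blists_eq (length vs). coef vs J *\<^sub>R h J) \<le> (\<Sum>J\<in>blists_eq (length vs). norm (h J))"
proof (rule order.trans [OF norm_sum sum_mono])
  fix J :: "'a list" assume "J \<in> blists_eq (length vs)"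
  then have "\<bar>coef vs J\<bar> * norm (h J) \<le> 1 * norm (h J)"
    by (intro mult_right_mono abs_coef_le_1 assms) auto
  then show "norm (coef vs J *\<^sub>R h J) \<le> norm (h J)" by simp
qed

lemma mlin_norm_jet_le:
  assumes g: "jet n g" and l: "l \<le> n"
  shows "mlin_norm l (\<lambda>vs. nderiv (g []) vs x) \<le> ennreal (\<Sum>J\<in>blists_eq l. norm (g J x))"
  unfolding mlin_norm_le_iff
  using norm_sum_coef_le [of _ "\<lambda>J. g J x"] l
  by (auto simp: nderiv_expand [OF g] intro!: ennreal_leI)

lemma mlin_norm_jet_diff_le:
  assumes g: "jet n g"
  shows "mlin_norm n (\<lambda>vs. nderiv (g []) vs x - nderiv (g []) vs y) \<le>
    ennreal (\<Sum>J\<in>blists_eq n. norm (g J x - g J y))"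
  unfolding mlin_norm_le_iff
  using norm_sum_coef_le [of _ "\<lambda>J. g J x - g J y"]
  by (auto simp: nderiv_expand [OF g] scaleR_diff_right sum_subtractf intro!: ennreal_leI)

text \<open>\<open>card (blists n)\<close> is at least the number of basis tuples of any single
  order l \<le> n, so one factor serves every order and the Hoelder quotient.\<close>

lemma Cna_norm_jet_le:
  fixes g :: "'a::euclidean_space list \<Rightarrow> 'a \<Rightarrow> 'b::real_normed_vector" and A :: real
  assumes g: "jet n g"
    and A: "\<And>J x. J \<in> blists n \<Longrightarrow> norm (g J x) \<le> A"
    and B: "\<And>J x y. J \<in> blists n \<Longrightarrow> norm (g J x - g J y) \<le> A * norm (x - y) powr \<alpha>"
  shows "Cna_norm n \<alpha> (g []) \<le> ennreal (card (blists n :: 'a list set) * A)"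
proof -
  have card: "(\<Sum>J\<in>blists_eq l. h J) \<le> card (blists n :: 'a list set) * c"
    if "l \<le> n" "\<And>J. J \<in> blists n \<Longrightarrow> h J \<le> c" "0 \<le> c" for l and c :: real and h :: "'a list \<Rightarrow> real"
  proof -
    have "(\<Sum>J\<in>blists_eq l. h J) \<le> card (blists_eq l :: 'a list set) * c"
      using sum_bounded_above [of "blists_eq l :: 'a list set" h c] that(2) blists_eq_subset [OF that(1)] by auto
    also have "\<dots> \<le> card (blists n :: 'a list set) * c"
      using card_mono [OF finite_blists blists_eq_subset [OF that(1)]] that(3) by (intro mult_right_mono) auto
    finally show ?thesis .
  qed
  have A0: "0 \<le> A"
    using A [of "[]" 0] norm_ge_zero [of "g [] 0"] by (simp del: norm_ge_zero)
  show ?thesis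
    unfolding Cna_norm_le_iff
  proof (intro conjI allI impI)
    fix x l assume l: "l \<le> n"
    show "mlin_norm l (\<lambda>vs. nderiv (g []) vs x) \<le> ennreal (card (blists n :: 'a list set) * A)"
      using card [OF l, of "\<lambda>J. norm (g J x)" A] A A0
      by (intro order.trans [OF mlin_norm_jet_le [OF g l]] ennreal_leI) auto
  next
    fix x y :: 'a assume xy: "x \<noteq> y"
    let ?p = "norm (x - y) powr \<alpha>"
    have p: "0 < ?p" using xy by simp
    have "mlin_norm n (\<lambda>vs. nderiv (g []) vs x - nderiv (g []) vs y) \<le>
        ennreal (\<Sum>J\<in>blists_eq n. norm (g J x - g J y))"
      by (rule mlin_norm_jet_diff_le [OF g])
    also have "\<dots> \<le> ennreal (card (blists n :: 'a list set) * (A * ?p))"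
      using card [of n "\<lambda>J. norm (g J x - g J y)" "A * ?p"] B A0 by (intro ennreal_leI) auto
    finally have "mlin_norm n (\<lambda>vs. nderiv (g []) vs x - nderiv (g []) vs y) / ennreal ?p \<le>
        ennreal (card (blists n :: 'a list set) * (A * ?p)) / ennreal ?p"
      by (rule divide_right_mono_ennreal)
    also have "\<dots> = ennreal (card (blists n :: 'a list set) * A)"
      using p A0 by (subst divide_ennreal) auto
    finally show "mlin_norm n (\<lambda>vs. nderiv (g []) vs x - nderiv (g []) vs y) / ennreal ?p \<le>
        ennreal (card (blists n :: 'a list set) * A)" .
  qed
qed

lemma norm_jet_le_Cna_norm:
  assumes "Cna_norm n \<alpha> f < \<infinity>" "J \<in> blists n"
  shows "norm (nderiv f J x) \<le> enn2real (Cna_norm n \<alpha> f)"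
proof -
  have "ennreal (norm (nderiv f J x)) \<le> mlin_norm (length J) (\<lambda>vs. nderiv f vs x)"
    using assms(2) by (intro mlin_norm_upper) (auto simp: blists_def)
  also have "\<dots> \<le> Cna_norm n \<alpha> f"
    using assms(2) by (intro Cna_norm_upper) (auto simp: blists_def)
  also have "\<dots> = ennreal (enn2real (Cna_norm n \<alpha> f))"
    using assms(1) by simp
  finally show ?thesis by simp
qed

section \<open>Lipschitz and Hoelder bounds for jet entries\<close>

lemma norm_sum_Basis_le:
  fixes h :: "'a::euclidean_space \<Rightarrow> 'b::real_normed_vector" and A :: real
  assumes "\<And>j. j \<in> Basis \<Longrightarrow> norm (h j) \<le> A"
  shows "norm (\<Sum>j\<in>Basis. (v \<bullet> j) *\<^sub>R h j) \<le> DIM('a) * A * norm v"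
proof -
  have "norm (\<Sum>j\<in>Basis. (v \<bullet> j) *\<^sub>R h j) \<le> (\<Sum>j\<in>(Basis::'a set). norm v * A)"
  proof (rule order.trans [OF norm_sum sum_mono])
    fix j :: 'a assume j: "j \<in> Basis"
    show "norm ((v \<bullet> j) *\<^sub>R h j) \<le> norm v * A"
      using assms [OF j] Basis_le_norm [OF j, of v] by (auto intro!: mult_mono)
  qed
  then show ?thesis by (simp add: ac_simps)
qed

lemma jet_lipschitz:
  fixes g :: "'a::euclidean_space list \<Rightarrow> 'a \<Rightarrow> 'b::real_normed_vector" and A :: real
  assumes g: "jet n g" and J: "J \<in> blists n" "length J < n"
    and A: "\<And>j x. j \<in> Basis \<Longrightarrow> norm (g (j # J) x) \<le> A"
  shows "norm (g J x - g J y) \<le> DIM('a) * A * norm (x - y)"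
proof (rule differentiable_bound [where S = UNIV and f' = "\<lambda>x v. \<Sum>j\<in>Basis. (v \<bullet> j) *\<^sub>R g (j # J) x"])
  fix x :: 'a
  show "(g J has_derivative (\<lambda>v. \<Sum>j\<in>Basis. (v \<bullet> j) *\<^sub>R g (j # J) x)) (at x within UNIV)"
    using jet_derivative [OF g J] .
  show "onorm (\<lambda>v. \<Sum>j\<in>Basis. (v \<bullet> j) *\<^sub>R g (j # J) x) \<le> DIM('a) * A"
    by (rule onorm_le) (rule norm_sum_Basis_le [OF A])
qed auto

lemma powr_le_of_le_1:
  fixes r :: real
  assumes "0 \<le> r" "r \<le> 1" "\<beta> \<le> 1"
  shows "r \<le> r powr \<beta>"
  using powr_mono' [of \<beta> 1 r] assms by (cases "r = 0") auto

text \<open>The norm contains a Hoelder quotient for the top order only. At lower orders the next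
  derivative gives a Lipschitz bound, which is stronger for |x - y| \<le> 1, and beyond that
  distance the trivial bound by twice the norm suffices. The factor 2 * DIM covers all
  cases.\<close>

lemma jet_holder:
  fixes f :: "'a::euclidean_space \<Rightarrow> 'b::real_normed_vector"
  assumes f: "Cn_map n f" and fin: "Cna_norm n \<beta> f < \<infinity>" and J: "J \<in> blists n" and \<beta>: "0 < \<beta>" "\<beta> \<le> 1"
  shows "norm (nderiv f J x - nderiv f J y) \<le> 2 * DIM('a) * enn2real (Cna_norm n \<beta> f) * norm (x - y) powr \<beta>"
proof -
  define N where "N = enn2real (Cna_norm n \<beta> f)"
  have N0: "0 \<le> N" by (simp add: N_def)
  have D: "1 \<le> real DIM('a)" using DIM_positive [where 'a='a] by linarith
  have b: "norm (nderiv f I z) \<le> N" if "I \<in> blists n" for I z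
    unfolding N_def by (rule norm_jet_le_Cna_norm [OF fin that])
  consider "x = y" | "x \<noteq> y" "length J = n" | "x \<noteq> y" "length J < n"
    using J by (force simp: blists_def)
  then have "norm (nderiv f J x - nderiv f J y) \<le> 2 * DIM('a) * N * norm (x - y) powr \<beta>"
  proof cases
    case 1
    then show ?thesis by simp
  next
    case 2
    let ?p = "norm (x - y) powr \<beta>"
    have p: "0 < ?p" using 2 by simp
    have "ennreal (norm (nderiv f J x - nderiv f J y) / ?p) = ennreal (norm (nderiv f J x - nderiv f J y)) / ennreal ?p"
      using p by (simp add: divide_ennreal)
    also have "\<dots> \<le> mlin_norm n (\<lambda>vs. nderiv f vs x - nderiv f vs y) / ennreal ?p"
      using J 2 by (intro divide_right_mono_ennreal mlin_norm_upper [of J n "\<lambda>vs. nderiv f vs x - nderiv f vs y"])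
        (auto simp: blists_def)
    also have "\<dots> \<le> Cna_norm n \<beta> f"
      by (rule Cna_norm_upper(2) [OF 2(1)])
    also have "\<dots> = ennreal N"
      using fin by (simp add: N_def)
    finally have "norm (nderiv f J x - nderiv f J y) \<le> N * ?p"
      using p N0 by (simp add: field_simps)
    also have "\<dots> = 1 * (N * ?p)" by simp
    also have "\<dots> \<le> (2 * DIM('a)) * (N * ?p)"
      using D N0 by (intro mult_right_mono) (linarith, simp)
    also have "\<dots> = 2 * DIM('a) * N * ?p" by simp
    finally show ?thesis .
  next
    case 3
    show ?thesis
    proof (cases "norm (x - y) \<le> 1")
      case True
      have "norm (nderiv f J x - nderiv f J y) \<le> DIM('a) * N * norm (x - y)"
        using jet_lipschitz [OF Cn_map_jet [OF f] J 3(2), of N x y] b blists_Cons [OF _ J 3(2)] by blast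
      also have "\<dots> \<le> (2 * DIM('a) * N) * norm (x - y) powr \<beta>"
        using N0 True \<beta> by (intro mult_mono powr_le_of_le_1) auto
      finally show ?thesis .
    next
      case False
      have "norm (nderiv f J x - nderiv f J y) \<le> N + N"
        by (intro order.trans [OF norm_triangle_ineq4] add_mono b J)
      also have "\<dots> \<le> 2 * DIM('a) * N * 1"
        using N0 D by (simp add: mult_le_cancel_right1)
      also have "\<dots> \<le> 2 * DIM('a) * N * norm (x - y) powr \<beta>"
        using N0 False \<beta> by (intro mult_left_mono ge_one_powr_ge_zero) auto
      finally show ?thesis .
    qed
  qed
  then show ?thesis by (simp add: N_def)
qed

section \<open>The chain rule for jets\<close>

text \<open>Symbolic partial derivatives of a composition \<open>f \<circ> \<phi>\<close>: \<open>Der I\<close> stands for \<open>(\<partial>\<^sup>I f) \<circ> \<phi>\<close>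
  and \<open>Mul K i e\<close> for \<open>(\<partial>\<^sup>K \<phi> \<bullet> i) e\<close>; the sum ranges over \<open>Basis\<close>.\<close>

datatype 'a cexp = Der "'a list" | Mul "'a list" 'a "'a cexp" | Zero
  | Add "'a cexp" "'a cexp" | Sum "'a \<Rightarrow> 'a cexp"

text \<open>The two families abstract the values at one point: \<open>a\<close> holds the
  derivatives of f at \<phi>(x), \<open>b\<close> those of \<phi> at x. Estimates for
  \<open>ev\<close> are then inequalities about polynomials, uniform in the point.\<close>

primrec ev :: "('a list \<Rightarrow> 'b::real_normed_vector) \<Rightarrow> ('a list \<Rightarrow> 'a) \<Rightarrow> 'a::euclidean_space cexp \<Rightarrow> 'b" where
  "ev a b (Der I) = a I"
| "ev a b (Mul K i e) = (b K \<bullet> i) *\<^sub>R ev a b e"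
| "ev a b Zero = 0"
| "ev a b (Add e f) = ev a b e + ev a b f"
| "ev a b (Sum h) = (\<Sum>i\<in>Basis. ev a b (h i))"

primrec pd :: "'a \<Rightarrow> 'a cexp \<Rightarrow> 'a cexp" where
  "pd j (Der I) = Sum (\<lambda>i. Mul [j] i (Der (i # I)))"
| "pd j (Mul K i e) = Add (Mul (j # K) i e) (Mul K i (pd j e))"
| "pd j Zero = Zero"
| "pd j (Add e f) = Add (pd j e) (pd j f)"
| "pd j (Sum h) = Sum (\<lambda>i. pd j (h i))"

text \<open>\<open>p\<close> limits the orders of f and \<open>q\<close> those of \<phi>. The
  condition \<open>K \<noteq> []\<close> records that \<phi> itself occurs only as the argument of
  f; this matters because a flow is unbounded while its derivatives are bounded.\<close>

primrec orders :: "nat \<Rightarrow> nat \<Rightarrow> 'a::euclidean_space cexp \<Rightarrow> bool" where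
  "orders p q (Der I) = (I \<in> blists p)"
| "orders p q (Mul K i e) = (K \<in> blists q \<and> K \<noteq> [] \<and> i \<in> Basis \<and> orders p q e)"
| "orders p q Zero = True"
| "orders p q (Add e f) = (orders p q e \<and> orders p q f)"
| "orders p q (Sum h) = (\<forall>i\<in>Basis. orders p q (h i))"

lemma orders_mono: "orders p q e \<Longrightarrow> p \<le> p' \<Longrightarrow> q \<le> q' \<Longrightarrow> orders p' q' e"
  by (induction e) (auto intro: blists_mono)

lemma orders_pd: "orders p q e \<Longrightarrow> j \<in> Basis \<Longrightarrow> orders (Suc p) (Suc q) (pd j e)"
  by (induction e) (auto intro: blists_Cons_Suc blists_mono orders_mono)

text \<open>The derivative along \<open>J\<close>, with the terms containing the highest derivative
  of \<open>\<phi>\<close> split off: these enter linearly.\<close>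

primrec low :: "'a list \<Rightarrow> 'a cexp" where
  "low [] = Zero"
| "low (j # J) = (if J = [] then Zero else Add (pd j (low J)) (Sum (\<lambda>i. Mul J i (pd j (Der [i])))))"

definition chain :: "'a list \<Rightarrow> 'a cexp" where
  "chain J = (if J = [] then Der [] else Add (Sum (\<lambda>i. Mul J i (Der [i]))) (low J))"

text \<open>The two expressions differ syntactically, since \<open>chain\<close> regroups the
  summands in order to isolate the highest derivative; they agree after evaluation.\<close>

lemma ev_chain_Cons: "ev a b (chain (j # J)) = ev a b (pd j (chain J))"
  by (simp add: chain_def sum.distrib ac_simps)

text \<open>Differentiating \<open>low J\<close> raises its orders by one, and the added sum
  contains \<phi> at most to order \<open>length J\<close>, one less than the order of
  \<open>j # J\<close>. The new highest derivative sits in the part that was split off.\<close>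

lemma orders_low: "J \<noteq> [] \<Longrightarrow> set J \<subseteq> Basis \<Longrightarrow> orders (length J) (length J - 1) (low J)"
proof (induction J)
  case (Cons j J)
  show ?case
  proof (cases "J = []")
    case False
    then have "orders (Suc (length J)) (Suc (length J - 1)) (pd j (low J))"
      using Cons by (intro orders_pd) auto
    moreover have "Suc (length J - 1) = length J"
      using False by (cases J) auto
    ultimately show ?thesis
      using False Cons.prems by (auto simp: blists_def Suc_le_eq)
  qed simp
qed simp

lemma orders_chain: "J \<in> blists n \<Longrightarrow> orders n n (chain J)"
  using orders_mono [OF orders_low, of J n n]
  by (cases J) (auto simp: chain_def blists_def)

text \<open>The strict inequalities keep one further derivative of f and of \<phi> in reserve for
  each factor that is differentiated.\<close>

lemma ev_pd_derivative:
  assumes f: "jet n f" and \<phi>: "jet n \<phi>" and "orders p q e" "p < n" "q < n"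
  shows "((\<lambda>x. ev (\<lambda>I. f I (\<phi> [] x)) (\<lambda>K. \<phi> K x) e) has_derivative
    (\<lambda>v. \<Sum>j\<in>Basis. (v \<bullet> j) *\<^sub>R ev (\<lambda>I. f I (\<phi> [] x)) (\<lambda>K. \<phi> K x) (pd j e))) (at x)"
  using assms(3)
proof (induction e)
  case (Der I)
  then have I: "I \<in> blists n" "length I < n"
    using assms(4) by (auto simp: blists_def)
  have "((\<lambda>x. f I (\<phi> [] x)) has_derivative
      (\<lambda>v. \<Sum>i\<in>Basis. ((\<Sum>j\<in>Basis. (v \<bullet> j) *\<^sub>R \<phi> [j] x) \<bullet> i) *\<^sub>R f (i # I) (\<phi> [] x))) (at x)"
    using assms(4)
    by (intro has_derivative_compose [OF jet_derivative [OF \<phi>] jet_derivative [OF f I]]) auto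
  moreover have "(\<Sum>i\<in>Basis. ((\<Sum>j\<in>Basis. (v \<bullet> j) *\<^sub>R \<phi> [j] x) \<bullet> i) *\<^sub>R f (i # I) (\<phi> [] x)) =
      (\<Sum>j\<in>Basis. (v \<bullet> j) *\<^sub>R (\<Sum>i\<in>Basis. (\<phi> [j] x \<bullet> i) *\<^sub>R f (i # I) (\<phi> [] x)))" for v
    unfolding inner_sum_left scaleR_sum_left scaleR_sum_right
    by (subst sum.swap) simp
  ultimately show ?case by simp
next
  case (Mul K i e)
  then have K: "K \<in> blists n" "length K < n"
    using assms(5) by (auto simp: blists_def)
  let ?a = "\<lambda>x I. f I (\<phi> [] x)" and ?b = "\<lambda>x K. \<phi> K x"
  have "((\<lambda>x. ev (?a x) (?b x) e) has_derivative
      (\<lambda>v. \<Sum>j\<in>Basis. (v \<bullet> j) *\<^sub>R ev (?a x) (?b x) (pd j e))) (at x)"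
    using Mul by simp
  from has_derivative_scaleR [OF has_derivative_inner_left [OF jet_derivative [OF \<phi> K], of i] this]
  have "((\<lambda>x. ev (?a x) (?b x) (Mul K i e)) has_derivative
      (\<lambda>v. (\<phi> K x \<bullet> i) *\<^sub>R (\<Sum>j\<in>Basis. (v \<bullet> j) *\<^sub>R ev (?a x) (?b x) (pd j e)) +
        ((\<Sum>j\<in>Basis. (v \<bullet> j) *\<^sub>R \<phi> (j # K) x) \<bullet> i) *\<^sub>R ev (?a x) (?b x) e)) (at x)"
    by simp
  then show ?case
    by (rule has_derivative_eq_rhs)
      (simp add: fun_eq_iff inner_sum_left scaleR_sum_left scaleR_sum_right
        sum.distrib scaleR_add_right ac_simps)
next
  case (Add e f)
  then show ?case
    by (auto intro!: has_derivative_eq_rhs [OF has_derivative_add]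
        simp: fun_eq_iff sum.distrib scaleR_add_right)
next
  case (Sum h)
  then have "((\<lambda>x. \<Sum>i\<in>Basis. ev (\<lambda>I. f I (\<phi> [] x)) (\<lambda>K. \<phi> K x) (h i)) has_derivative
     (\<lambda>v. \<Sum>i\<in>Basis. \<Sum>j\<in>Basis. (v \<bullet> j) *\<^sub>R ev (\<lambda>I. f I (\<phi> [] x)) (\<lambda>K. \<phi> K x) (pd j (h i)))) (at x)"
    by (intro has_derivative_sum) auto
  then show ?case
    by (simp add: scaleR_sum_right) (subst (asm) sum.swap, simp)
qed simp

lemma continuous_on_ev:
  assumes "orders p q e" "\<And>I. I \<in> blists p \<Longrightarrow> continuous_on S (\<lambda>x. a x I)"
    "\<And>K. K \<in> blists q \<Longrightarrow> K \<noteq> [] \<Longrightarrow> continuous_on S (\<lambda>x. b x K)"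
  shows "continuous_on S (\<lambda>x. ev (a x) (b x) e)"
  using assms(1) by (induction e) (auto intro!: continuous_intros assms(2,3))

lemma measurable_ev [measurable (raw)]:
  fixes a :: "'c \<Rightarrow> 'a::euclidean_space list \<Rightarrow> 'b::euclidean_space"
  assumes "orders p q e" "\<And>I. I \<in> blists p \<Longrightarrow> (\<lambda>x. a x I) \<in> borel_measurable M"
    "\<And>K. K \<in> blists q \<Longrightarrow> K \<noteq> [] \<Longrightarrow> (\<lambda>x. b x K) \<in> borel_measurable M"
  shows "(\<lambda>x. ev (a x) (b x) e) \<in> borel_measurable M"
  using assms(1)
  by (induction e) (auto intro!: borel_measurable_scaleR borel_measurable_inner borel_measurable_add
      borel_measurable_sum assms(2,3))

text \<open>The chain rule of order n (Faa di Bruno) without its combinatorics: since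
  \<open>chain (j # J)\<close> evaluates like the symbolic derivative of \<open>chain J\<close>,
  only single differentiations have to be justified.\<close>

lemma jet_compose:
  assumes f: "jet n f" and \<phi>: "jet n \<phi>"
  shows "jet n (\<lambda>J x. ev (\<lambda>I. f I (\<phi> [] x)) (\<lambda>K. \<phi> K x) (chain J))"
  unfolding jet_def
proof (intro conjI ballI impI allI)
  fix J :: "'a list" and x
  assume J: "J \<in> blists n"
  have "continuous_on UNIV (\<lambda>x. f I (\<phi> [] x))" if "I \<in> blists n" for I
    by (rule continuous_on_compose2 [OF jet_continuous [OF f that] jet_continuous [OF \<phi>]]) auto
  then show "continuous_on UNIV (\<lambda>x. ev (\<lambda>I. f I (\<phi> [] x)) (\<lambda>K. \<phi> K x) (chain J))"
    by (intro continuous_on_ev [OF orders_chain [OF J]] jet_continuous [OF \<phi>])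
  assume l: "length J < n"
  have "orders (length J) (length J) (chain J)"
    using J by (intro orders_chain) (auto simp: blists_def)
  from ev_pd_derivative [OF f \<phi> this l l]
  show "((\<lambda>x. ev (\<lambda>I. f I (\<phi> [] x)) (\<lambda>K. \<phi> K x) (chain J)) has_derivative
      (\<lambda>v. \<Sum>j\<in>Basis. (v \<bullet> j) *\<^sub>R ev (\<lambda>I. f I (\<phi> [] x)) (\<lambda>K. \<phi> K x) (chain (j # J)))) (at x)"
    by (simp only: ev_chain_Cons)
qed

text \<open>Each monomial contains exactly one \<open>Der\<close>, so the value is linear in the
  derivatives of f, with a factor depending only on the expression and on K. Linearity in m is
  essential: m will be a merely integrable function of time.\<close>

lemma ev_bound:
  fixes e :: "'a::euclidean_space cexp"
  assumes "orders p q e"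
  shows "\<exists>C\<ge>0. \<forall>(a :: 'a list \<Rightarrow> 'b::real_normed_vector) b m.
    (\<forall>I\<in>blists p. norm (a I) \<le> m) \<longrightarrow> (\<forall>k\<in>blists q. k \<noteq> [] \<longrightarrow> norm (b k) \<le> K) \<longrightarrow> norm (ev a b e) \<le> C * m"
  using assms
proof (induction e)
  case (Der I)
  then show ?case by (intro exI [of _ 1]) auto
next
  case (Mul k i e)
  then obtain C where C: "C \<ge> 0" "\<And>(a :: 'a list \<Rightarrow> 'b) b m. \<forall>I\<in>blists p. norm (a I) \<le> m \<Longrightarrow>
      \<forall>k\<in>blists q. k \<noteq> [] \<longrightarrow> norm (b k) \<le> K \<Longrightarrow> norm (ev a b e) \<le> C * m"
    by force
  show ?case
  proof (intro exI [of _ "\<bar>K\<bar> * C"] conjI allI impI)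
    fix a :: "'a list \<Rightarrow> 'b" and b :: "'a list \<Rightarrow> 'a" and m :: real
    assume a: "\<forall>I\<in>blists p. norm (a I) \<le> m" and b: "\<forall>k\<in>blists q. k \<noteq> [] \<longrightarrow> norm (b k) \<le> K"
    have "\<bar>b k \<bullet> i\<bar> \<le> \<bar>K\<bar>"
      using b Mul.prems Basis_le_norm [of i "b k"] by force
    then have "\<bar>b k \<bullet> i\<bar> * norm (ev a b e) \<le> \<bar>K\<bar> * (C * m)"
      using C(2) [OF a b] by (intro mult_mono) auto
    then show "norm (ev a b (Mul k i e)) \<le> \<bar>K\<bar> * C * m" by (simp add: ac_simps)
  qed (use C in auto)
next
  case Zero
  then show ?case by (intro exI [of _ 0]) auto
next
  case (Add e f)
  then obtain C D where C: "C \<ge> 0" "\<And>(a :: 'a list \<Rightarrow> 'b) b m. \<forall>I\<in>blists p. norm (a I) \<le> m \<Longrightarrow>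
      \<forall>k\<in>blists q. k \<noteq> [] \<longrightarrow> norm (b k) \<le> K \<Longrightarrow> norm (ev a b e) \<le> C * m"
    and D: "D \<ge> 0" "\<And>(a :: 'a list \<Rightarrow> 'b) b m. \<forall>I\<in>blists p. norm (a I) \<le> m \<Longrightarrow>
      \<forall>k\<in>blists q. k \<noteq> [] \<longrightarrow> norm (b k) \<le> K \<Longrightarrow> norm (ev a b f) \<le> D * m"
    by (metis orders.simps(4))
  show ?case
  proof (intro exI [of _ "C + D"] conjI allI impI)
    fix a :: "'a list \<Rightarrow> 'b" and b :: "'a list \<Rightarrow> 'a" and m :: real
    assume "\<forall>I\<in>blists p. norm (a I) \<le> m" "\<forall>k\<in>blists q. k \<noteq> [] \<longrightarrow> norm (b k) \<le> K"
    from C(2) [OF this] D(2) [OF this] norm_triangle_ineq [of "ev a b e" "ev a b f"]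
    show "norm (ev a b (Add e f)) \<le> (C + D) * m" by (simp add: distrib_right)
  qed (use C D in auto)
next
  case (Sum h)
  then have "\<forall>i\<in>Basis. \<exists>C\<ge>0. \<forall>(a :: 'a list \<Rightarrow> 'b) b m. (\<forall>I\<in>blists p. norm (a I) \<le> m) \<longrightarrow>
      (\<forall>k\<in>blists q. k \<noteq> [] \<longrightarrow> norm (b k) \<le> K) \<longrightarrow> norm (ev a b (h i)) \<le> C * m"
    by auto
  then obtain C where C: "\<And>i. i \<in> Basis \<Longrightarrow> C i \<ge> 0"
    "\<And>i (a :: 'a list \<Rightarrow> 'b) b m. i \<in> Basis \<Longrightarrow> \<forall>I\<in>blists p. norm (a I) \<le> m \<Longrightarrow>
      \<forall>k\<in>blists q. k \<noteq> [] \<longrightarrow> norm (b k) \<le> K \<Longrightarrow> norm (ev a b (h i)) \<le> C i * m"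
    by metis
  show ?case
  proof (intro exI [of _ "\<Sum>i\<in>Basis. C i"] conjI allI impI)
    fix a :: "'a list \<Rightarrow> 'b" and b :: "'a list \<Rightarrow> 'a" and m :: real
    assume *: "\<forall>I\<in>blists p. norm (a I) \<le> m" "\<forall>k\<in>blists q. k \<noteq> [] \<longrightarrow> norm (b k) \<le> K"
    show "norm (ev a b (Sum h)) \<le> (\<Sum>i\<in>Basis. C i) * m"
      by (simp add: sum_distrib_right) (intro sum_norm_le C(2) *)
  qed (auto intro: sum_nonneg C)
qed

text \<open>A change \<eta> of the derivatives of f enters directly, a change \<delta> of those of
  \<phi> is multiplied by the size m of f. As before the factor does not depend on m, so the
  estimate can be integrated in time.\<close>

lemma ev_lipschitz:
  fixes e :: "'a::euclidean_space cexp"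
  assumes "orders p q e"
  shows "\<exists>C\<ge>0. \<forall>(a :: 'a list \<Rightarrow> 'b::real_normed_vector) a' b b' m \<eta> \<delta>.
    (\<forall>I\<in>blists p. norm (a I) \<le> m \<and> norm (a I - a' I) \<le> \<eta>) \<longrightarrow>
    (\<forall>k\<in>blists q. k \<noteq> [] \<longrightarrow> norm (b k) \<le> K \<and> norm (b' k) \<le> K \<and> norm (b k - b' k) \<le> \<delta>) \<longrightarrow>
    0 \<le> \<delta> \<longrightarrow>
    norm (ev a b e - ev a' b' e) \<le> C * (\<eta> + m * \<delta>)"
  (is "\<exists>C\<ge>0. \<forall>a a' b b' m \<eta> \<delta>. ?A a a' m \<eta> \<longrightarrow> ?B b b' \<delta> \<longrightarrow> _ \<longrightarrow> _")
  using assms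
proof (induction e)
  case (Der I)
  show ?case
  proof (intro exI [of _ 1] conjI allI impI)
    fix a a' :: "'a list \<Rightarrow> 'b" and b b' :: "'a list \<Rightarrow> 'a" and m \<eta> \<delta> :: real
    assume *: "?A a a' m \<eta>" "0 \<le> \<delta>"
    then have "norm (a I - a' I) \<le> \<eta>" "norm (a I) \<le> m"
      using Der by auto
    moreover have "0 \<le> m" using \<open>norm (a I) \<le> m\<close> norm_ge_zero order.trans by blast
    ultimately show "norm (ev a b (Der I) - ev a' b' (Der I)) \<le> 1 * (\<eta> + m * \<delta>)"
      using *(2) by (simp add: add_increasing2)
  qed simp
next
  case (Mul k i e)
  then have e: "orders p q e" by simp
  from Mul obtain C where C: "C \<ge> 0" "\<And>(a :: 'a list \<Rightarrow> 'b) a' b b' m \<eta> \<delta>. ?A a a' m \<eta> \<Longrightarrow> ?B b b' \<delta> \<Longrightarrow> 0 \<le> \<delta> \<Longrightarrow>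
      norm (ev a b e - ev a' b' e) \<le> C * (\<eta> + m * \<delta>)"
    by (metis orders.simps(2))
  obtain B where B: "B \<ge> 0" "\<And>(a :: 'a list \<Rightarrow> 'b) b m. \<forall>I\<in>blists p. norm (a I) \<le> m \<Longrightarrow>
      \<forall>k\<in>blists q. k \<noteq> [] \<longrightarrow> norm (b k) \<le> K \<Longrightarrow> norm (ev a b e) \<le> B * m"
    using ev_bound [OF e, where ?'b = 'b, of K] by metis
  show ?case
  proof (intro exI [of _ "B + \<bar>K\<bar> * C"] conjI allI impI)
    fix a a' :: "'a list \<Rightarrow> 'b" and b b' :: "'a list \<Rightarrow> 'a" and m \<eta> \<delta> :: real
    assume *: "?A a a' m \<eta>" "?B b b' \<delta>" "0 \<le> \<delta>"
    have \<eta>: "0 \<le> \<eta>" "0 \<le> m"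
      using *(1) norm_ge_zero order.trans blists_Nil by blast+
    have "\<bar>(b k - b' k) \<bullet> i\<bar> \<le> norm (b k - b' k)"
      using Mul.prems Basis_le_norm [of i "b k - b' k"] by auto
    also have "\<dots> \<le> \<delta>"
      using *(2) Mul.prems by auto
    finally have 1: "\<bar>(b k - b' k) \<bullet> i\<bar> * norm (ev a b e) \<le> \<delta> * (B * m)"
      using * by (intro mult_mono B) auto
    have "\<bar>b' k \<bullet> i\<bar> \<le> \<bar>K\<bar>"
      using *(2) Mul.prems Basis_le_norm [of i "b' k"] by force
    then have 2: "\<bar>b' k \<bullet> i\<bar> * norm (ev a b e - ev a' b' e) \<le> \<bar>K\<bar> * (C * (\<eta> + m * \<delta>))"
      by (intro mult_mono C *) auto
    have "norm (ev a b (Mul k i e) - ev a' b' (Mul k i e)) =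
        norm (((b k - b' k) \<bullet> i) *\<^sub>R ev a b e + (b' k \<bullet> i) *\<^sub>R (ev a b e - ev a' b' e))"
      by (simp add: algebra_simps)
    also have "\<dots> \<le> \<delta> * (B * m) + \<bar>K\<bar> * (C * (\<eta> + m * \<delta>))"
      using 1 2 by (intro norm_triangle_le add_mono) auto
    also have "\<delta> * (B * m) \<le> B * (\<eta> + m * \<delta>)"
      using B(1) \<eta> by (simp add: algebra_simps)
    finally show "norm (ev a b (Mul k i e) - ev a' b' (Mul k i e)) \<le> (B + \<bar>K\<bar> * C) * (\<eta> + m * \<delta>)"
      by (simp add: algebra_simps)
  qed (use B C in auto)
next
  case Zero
  then show ?case by (intro exI [of _ 0]) auto
next
  case (Add e f)
  then have o: "orders p q e" "orders p q f" by auto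
  obtain C where C: "C \<ge> 0" "\<And>(a :: 'a list \<Rightarrow> 'b) a' b b' m \<eta> \<delta>. ?A a a' m \<eta> \<Longrightarrow> ?B b b' \<delta> \<Longrightarrow> 0 \<le> \<delta> \<Longrightarrow>
      norm (ev a b e - ev a' b' e) \<le> C * (\<eta> + m * \<delta>)"
    using Add.IH(1) [OF o(1)] by (elim exE conjE) blast
  obtain D where D: "D \<ge> 0" "\<And>(a :: 'a list \<Rightarrow> 'b) a' b b' m \<eta> \<delta>. ?A a a' m \<eta> \<Longrightarrow> ?B b b' \<delta> \<Longrightarrow> 0 \<le> \<delta> \<Longrightarrow>
      norm (ev a b f - ev a' b' f) \<le> D * (\<eta> + m * \<delta>)"
    using Add.IH(2) [OF o(2)] by (elim exE conjE) blast
  show ?case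
  proof (intro exI [of _ "C + D"] conjI allI impI)
    fix a a' :: "'a list \<Rightarrow> 'b" and b b' :: "'a list \<Rightarrow> 'a" and m \<eta> \<delta> :: real
    assume "?A a a' m \<eta>" "?B b b' \<delta>" "0 \<le> \<delta>"
    from C(2) [OF this] D(2) [OF this] norm_diff_triangle_ineq [of "ev a b e" "ev a b f" "ev a' b' e" "ev a' b' f"]
    show "norm (ev a b (Add e f) - ev a' b' (Add e f)) \<le> (C + D) * (\<eta> + m * \<delta>)" by (simp add: distrib_right)
  qed (use C D in auto)
next
  case (Sum h)
  then have "\<forall>i\<in>Basis. \<exists>C\<ge>0. \<forall>(a :: 'a list \<Rightarrow> 'b) a' b b' m \<eta> \<delta>. ?A a a' m \<eta> \<longrightarrow> ?B b b' \<delta> \<longrightarrow> 0 \<le> \<delta> \<longrightarrow>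
      norm (ev a b (h i) - ev a' b' (h i)) \<le> C * (\<eta> + m * \<delta>)"
    by auto
  then obtain C where C: "\<And>i. i \<in> Basis \<Longrightarrow> C i \<ge> 0"
    "\<And>i (a :: 'a list \<Rightarrow> 'b) a' b b' m \<eta> \<delta>. i \<in> Basis \<Longrightarrow> ?A a a' m \<eta> \<Longrightarrow> ?B b b' \<delta> \<Longrightarrow> 0 \<le> \<delta> \<Longrightarrow>
      norm (ev a b (h i) - ev a' b' (h i)) \<le> C i * (\<eta> + m * \<delta>)"
    by metis
  show ?case
  proof (intro exI [of _ "\<Sum>i\<in>Basis. C i"] conjI allI impI)
    fix a a' :: "'a list \<Rightarrow> 'b" and b b' :: "'a list \<Rightarrow> 'a" and m \<eta> \<delta> :: real
    assume *: "?A a a' m \<eta>" "?B b b' \<delta>" "0 \<le> \<delta>"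
    show "norm (ev a b (Sum h) - ev a' b' (Sum h)) \<le> (\<Sum>i\<in>Basis. C i) * (\<eta> + m * \<delta>)"
      unfolding ev.simps sum_subtractf [symmetric] sum_distrib_right
      by (intro sum_norm_le C(2) *)
  qed (auto intro: sum_nonneg C)
qed

section \<open>Integrals and limits of jets\<close>

lemma jet_scaleR: "jet n g \<Longrightarrow> jet n (\<lambda>J x. c *\<^sub>R g J x)"
  unfolding jet_def
  by (auto intro!: continuous_intros has_derivative_eq_rhs [OF has_derivative_scaleR_right]
      simp: scaleR_sum_right ac_simps)

lemma jet_add: "jet n f \<Longrightarrow> jet n g \<Longrightarrow> jet n (\<lambda>J x. f J x + g J x)"
  unfolding jet_def
  by (auto intro!: continuous_on_add has_derivative_eq_rhs [OF has_derivative_add]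
      simp: fun_eq_iff scaleR_add_right sum.distrib)

text \<open>Differentiation under the integral for all orders below n. The bound \<open>w\<close>
  for the next derivative dominates the difference quotients by the mean value inequality.\<close>

lemma jet_LINT:
  fixes h :: "'a::euclidean_space list \<Rightarrow> 'c \<Rightarrow> 'a \<Rightarrow> 'b::euclidean_space"
  assumes jet: "\<And>s. jet n (\<lambda>J. h J s)"
    and meas: "\<And>J x. J \<in> blists n \<Longrightarrow> (\<lambda>s. h J s x) \<in> borel_measurable M"
    and bound: "\<And>J s x. J \<in> blists n \<Longrightarrow> norm (h J s x) \<le> w s"
    and w: "integrable M w"
  shows "jet n (\<lambda>J x. LINT s|M. h J s x)"
  unfolding jet_def
proof (intro conjI ballI impI allI)
  fix J :: "'a list" and x
  assume J: "J \<in> blists n"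
  show "continuous_on UNIV (\<lambda>x. LINT s|M. h J s x)"
  proof (rule continuous_on_sequentiallyI)
    fix X y assume "X \<longlonglongrightarrow> (y :: 'a)"
    then have "(\<lambda>k. h J s (X k)) \<longlonglongrightarrow> h J s y" for s
      using continuous_on_tendsto_compose [OF jet_continuous [OF jet J, of UNIV]] by auto
    then show "(\<lambda>k. LINT s|M. h J s (X k)) \<longlonglongrightarrow> (LINT s|M. h J s y)"
      using meas [OF J] bound [OF J] by (intro integral_dominated_convergence [OF _ _ w]) auto
  qed
  assume l: "length J < n"
  have int: "integrable M (\<lambda>s. h I s z)" if "I \<in> blists n" for I z
    by (rule Bochner_Integration.integrable_bound [OF w meas [OF that]])
      (use bound [OF that, of _ z] in \<open>auto intro: order.trans [OF _ abs_ge_self]\<close>)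
  let ?D = "\<lambda>s v. \<Sum>j\<in>Basis. (v \<bullet> j) *\<^sub>R h (j # J) s x"
  have jJ: "j # J \<in> blists n" if "j \<in> Basis" for j
    by (rule blists_Cons [OF that J l])
  have intD: "integrable M (\<lambda>s. ?D s v)" for v
    by (intro Bochner_Integration.integrable_sum integrable_scaleR_right int jJ)
  have LD: "(LINT s|M. ?D s v) = (\<Sum>j\<in>Basis. (v \<bullet> j) *\<^sub>R (LINT s|M. h (j # J) s x))" for v
    by (subst Bochner_Integration.integral_sum) (auto intro!: int jJ)
  show "((\<lambda>x. LINT s|M. h J s x) has_derivative
      (\<lambda>v. \<Sum>j\<in>Basis. (v \<bullet> j) *\<^sub>R (LINT s|M. h (j # J) s x))) (at x)"
    unfolding has_derivative_at tendsto_at_iff_sequentially comp_def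
  proof (intro conjI allI impI)
    show "bounded_linear (\<lambda>v. \<Sum>j\<in>Basis. (v \<bullet> j) *\<^sub>R (LINT s|M. h (j # J) s x))"
      by (intro bounded_linear_intros)
    fix X assume X: "\<forall>k. X k \<in> UNIV - {0 :: 'a}" "X \<longlonglongrightarrow> 0"
    define q where "q k s = (1 / norm (X k)) *\<^sub>R (h J s (x + X k) - h J s x - ?D s (X k))" for k s
    have lim: "(\<lambda>k. q k s) \<longlonglongrightarrow> 0" for s
    proof -
      have "((\<lambda>v. norm (h J s (x + v) - h J s x - ?D s v) / norm v) \<longlongrightarrow> 0) (at 0)"
        using jet_derivative [OF jet J l, of s x] by (simp add: has_derivative_at)
      then have "(\<lambda>k. norm (h J s (x + X k) - h J s x - ?D s (X k)) / norm (X k)) \<longlonglongrightarrow> 0"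
        using X unfolding tendsto_at_iff_sequentially comp_def by blast
      then have "(\<lambda>k. norm (q k s)) \<longlonglongrightarrow> 0"
        by (simp add: q_def divide_inverse mult.commute)
      then show ?thesis
        by (rule tendsto_norm_zero_cancel)
    qed
    \<comment> \<open>One share DIM * w comes from the increment, the other from its linear
      part.\<close>
    have "norm (q k s) \<le> 2 * DIM('a) * w s" for k s
    proof -
      have X0: "0 < norm (X k)" using X(1) by auto
      have "norm (h J s (x + X k) - h J s x - ?D s (X k)) \<le>
          DIM('a) * w s * norm (x + X k - x) + DIM('a) * w s * norm (X k)"
        by (intro order.trans [OF norm_triangle_ineq4] add_mono jet_lipschitz [OF jet J l]
            norm_sum_Basis_le bound jJ)
      also have "\<dots> = 2 * DIM('a) * w s * norm (X k)" by simp
      finally have "norm (h J s (x + X k) - h J s x - ?D s (X k)) / norm (X k) \<le> 2 * DIM('a) * w s"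
        by (subst pos_divide_le_eq [OF X0])
      then show ?thesis
        by (simp add: q_def)
    qed
    moreover have "q k \<in> borel_measurable M" for k
      unfolding q_def
      by (intro borel_measurable_integrable integrable_scaleR_right Bochner_Integration.integrable_diff int J intD)
    ultimately have "(\<lambda>k. LINT s|M. q k s) \<longlonglongrightarrow> (LINT s|M. 0)"
      using w lim by (intro integral_dominated_convergence [where w = "\<lambda>s. 2 * DIM('a) * w s"]) auto
    then have "(\<lambda>k. norm (LINT s|M. q k s)) \<longlonglongrightarrow> 0"
      by (intro tendsto_norm_zero) simp
    moreover have "(LINT s|M. q k s) = (1 / norm (X k)) *\<^sub>R ((LINT s|M. h J s (x + X k)) - (LINT s|M. h J s x) -
        (\<Sum>j\<in>Basis. (X k \<bullet> j) *\<^sub>R (LINT s|M. h (j # J) s x)))" for k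
      unfolding q_def LD [symmetric]
      by (simp add: Bochner_Integration.integral_diff int J intD)
    ultimately show "(\<lambda>k. norm ((LINT s|M. h J s (x + X k)) - (LINT s|M. h J s x) -
        (\<Sum>j\<in>Basis. (X k \<bullet> j) *\<^sub>R (LINT s|M. h (j # J) s x))) / norm (X k)) \<longlonglongrightarrow> 0"
      by simp
  qed
qed

text \<open>Uniform convergence of the derivatives yields some differentiable limit; pointwise
  convergence identifies it with \<open>g J\<close>.\<close>

lemma jet_uniform_limit:
  fixes g :: "'a::euclidean_space list \<Rightarrow> 'a \<Rightarrow> 'b::banach"
  assumes jet: "\<And>k. jet n (f k)"
    and lim: "\<And>J. J \<in> blists n \<Longrightarrow> uniform_limit UNIV (\<lambda>k. f k J) (g J) sequentially"
  shows "jet n g"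
  unfolding jet_def
proof (intro conjI ballI impI allI)
  fix J :: "'a list" and x
  assume J: "J \<in> blists n"
  show "continuous_on UNIV (g J)"
    by (rule uniform_limit_theorem [OF _ lim [OF J]]) (auto intro!: always_eventually jet_continuous [OF jet J])
  assume l: "length J < n"
  have pt: "(\<lambda>k. f k J z) \<longlonglongrightarrow> g J z" for z
    by (rule tendsto_uniform_limitI [OF lim [OF J]]) simp
  have "\<exists>g'. \<forall>x\<in>UNIV. (\<lambda>k. f k J x) \<longlonglongrightarrow> g' x \<and>
      (g' has_derivative (\<lambda>v. \<Sum>j\<in>Basis. (v \<bullet> j) *\<^sub>R g (j # J) x)) (at x within UNIV)"
  proof (rule has_derivative_sequence [where f' = "\<lambda>k x v. \<Sum>j\<in>Basis. (v \<bullet> j) *\<^sub>R f k (j # J) x"])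
    show "(f k J has_derivative (\<lambda>v. \<Sum>j\<in>Basis. (v \<bullet> j) *\<^sub>R f k (j # J) x)) (at x within UNIV)" for k x
      using jet_derivative [OF jet J l] by simp
    show "(\<lambda>k. f k J 0) \<longlonglongrightarrow> g J 0" by (rule pt)
    fix e :: real assume e: "0 < e"
    have "\<forall>\<^sub>F k in sequentially. \<forall>j\<in>Basis. \<forall>x\<in>UNIV. dist (f k (j # J) x) (g (j # J) x) < e / DIM('a)"
      using e uniform_limitD [OF lim [OF blists_Cons [OF _ J l]]] by (intro eventually_ball_finite) auto
    then show "\<forall>\<^sub>F k in sequentially. \<forall>x\<in>UNIV. \<forall>h. norm ((\<Sum>j\<in>Basis. (h \<bullet> j) *\<^sub>R f k (j # J) x) -
        (\<Sum>j\<in>Basis. (h \<bullet> j) *\<^sub>R g (j # J) x)) \<le> e * norm h"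
    proof eventually_elim
      case (elim k)
      have "norm (\<Sum>j\<in>Basis. (h \<bullet> j) *\<^sub>R (f k (j # J) x - g (j # J) x)) \<le> DIM('a) * (e / DIM('a)) * norm h" for x h
        using elim by (intro norm_sum_Basis_le) (auto simp: dist_norm less_imp_le)
      then show ?case
        by (simp add: scaleR_diff_right sum_subtractf)
    qed
  qed auto
  then obtain g' where g': "\<And>x. (\<lambda>k. f k J x) \<longlonglongrightarrow> g' x"
    "\<And>x. (g' has_derivative (\<lambda>v. \<Sum>j\<in>Basis. (v \<bullet> j) *\<^sub>R g (j # J) x)) (at x)"
    by auto
  have "g' = g J"
    using LIMSEQ_unique [OF g'(1) pt] by blast
  with g'(2) show "(g J has_derivative (\<lambda>v. \<Sum>j\<in>Basis. (v \<bullet> j) *\<^sub>R g (j # J) x)) (at x)"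
    by simp
qed

section \<open>A Gronwall argument\<close>

lemma norm_set_LINT_le:
  fixes f :: "real \<Rightarrow> 'b::{banach, second_countable_topology}"
  assumes "integrable lebesgue g" "\<And>s. norm (f s) \<le> g s"
  shows "norm (LINT s:{..t}|lebesgue. f s) \<le> (LINT s:{..t}|lebesgue. g s)"
proof (cases "set_integrable lebesgue {..t} f")
  case True
  have "set_integrable lebesgue {..t} g"
    unfolding set_integrable_def by (rule integrable_mult_indicator [OF _ assms(1)]) simp
  with True assms(2) show ?thesis
    unfolding set_integrable_def set_lebesgue_integral_def
    by (intro Bochner_Integration.integral_norm_bound_integral) (auto simp: indicator_def)
next
  case False
  \<comment> \<open>A non-integrable integrand has integral 0 by convention, which the nonnegative
    right-hand side dominates.\<close>
  have "0 \<le> (LINT s:{..t}|lebesgue. g s)"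
    unfolding set_lebesgue_integral_def
    using order.trans [OF norm_ge_zero assms(2)] by (intro integral_nonneg_AE) auto
  with False show ?thesis
    by (simp add: set_lebesgue_integral_def set_integrable_def not_integrable_integral_eq)
qed

lemma set_integrable_lebesgueI:
  fixes f :: "real \<Rightarrow> 'b::{banach, second_countable_topology}"
  shows "integrable lebesgue f \<Longrightarrow> A \<in> sets lebesgue \<Longrightarrow> set_integrable lebesgue A f"
  unfolding set_integrable_def by (rule integrable_mult_indicator)

lemma set_integrable_atMost:
  fixes f :: "real \<Rightarrow> 'b::{banach, second_countable_topology}"
  shows "integrable lebesgue f \<Longrightarrow> set_integrable lebesgue {..t} f"
  by (rule set_integrable_lebesgueI) simp_all

lemma borel_measurable_lebesgue_continuous:
  fixes f :: "real \<Rightarrow> 'b::topological_space"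
  assumes "continuous_on UNIV f"
  shows "f \<in> borel_measurable lebesgue"
proof -
  have "f \<in> borel_measurable borel"
    by (rule borel_measurable_continuous_onI [OF assms])
  then have "f \<in> borel_measurable lborel" by simp
  then show ?thesis by (rule measurable_completion)
qed

text \<open>For s different from t the indicators of \<open>{..X k}\<close> at s are eventually
  constant, and a single point is null, so dominated convergence applies.\<close>

lemma continuous_on_set_LINT:
  fixes f :: "real \<Rightarrow> 'b::{banach, second_countable_topology}"
  assumes f: "integrable lebesgue f"
  shows "continuous_on UNIV (\<lambda>t. LINT s:{..t}|lebesgue. f s)"
proof (rule continuous_on_sequentiallyI)
  fix X :: "nat \<Rightarrow> real" and t assume X: "X \<longlonglongrightarrow> t"
  show "(\<lambda>k. LINT s:{..X k}|lebesgue. f s) \<longlonglongrightarrow> (LINT s:{..t}|lebesgue. f s)"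
    unfolding set_lebesgue_integral_def
  proof (rule integral_dominated_convergence [where w = "\<lambda>s. norm (f s)"])
    have "AE s in lebesgue. s \<noteq> t"
      by (intro AE_I' [of "{t}"]) auto
    then show "AE s in lebesgue. (\<lambda>k. indicator {..X k} s *\<^sub>R f s) \<longlonglongrightarrow> indicator {..t} s *\<^sub>R f s"
    proof eventually_elim
      case (elim s)
      have "\<forall>\<^sub>F k in sequentially. indicator {..X k} s *\<^sub>R f s = indicator {..t} s *\<^sub>R f s"
      proof (cases "s < t")
        case True
        from order_tendstoD(1) [OF X this] show ?thesis
          by eventually_elim (use True in auto)
      next
        case False
        with elim have "t < s" by simp
        from order_tendstoD(2) [OF X this] show ?thesis
          by eventually_elim (use \<open>t < s\<close> in auto)
      qed
      then show ?case by (rule tendsto_eventually)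
    qed
  qed (use f in \<open>auto intro!: borel_measurable_scaleR borel_measurable_indicator simp: indicator_simps split: split_indicator\<close>)
qed

section \<open>Accumulated mass and the exponential weight\<close>

locale mass =
  fixes m :: "real \<Rightarrow> real"
  assumes integrable_m: "integrable lebesgue m"
    and m_nonneg: "0 \<le> m s"
    and m_eq_0: "s \<le> 0 \<Longrightarrow> m s = 0"
begin

text \<open>The clock of all time estimates: flows are Lipschitz with respect to accumulated mass,
  though not with respect to time. It stays at 0 up to time 0 because \<open>m\<close> vanishes
  there.\<close>

definition cmass :: "real \<Rightarrow> real" where
  "cmass t = (LINT s:{..t}|lebesgue. m s)"

definition total :: real where
  "total = (LINT s|lebesgue. m s)"

lemma cmass_diff: "s \<le> t \<Longrightarrow> cmass t - cmass s = (LINT r:{s<..t}|lebesgue. m r)"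
  using set_integral_Un [of "{..s}" "{s<..t}" lebesgue m] set_integrable_lebesgueI [OF integrable_m]
  by (simp add: cmass_def ivl_disj_un ivl_disj_int)

lemma cmass_mono: "s \<le> t \<Longrightarrow> cmass s \<le> cmass t"
proof -
  assume "s \<le> t"
  have "0 \<le> (LINT r:{s<..t}|lebesgue. m r)"
    by (auto simp: set_lebesgue_integral_def m_nonneg intro!: integral_nonneg_AE)
  then show ?thesis
    using cmass_diff [OF \<open>s \<le> t\<close>] by simp
qed

lemma cmass_0: "t \<le> 0 \<Longrightarrow> cmass t = 0"
  by (auto simp: cmass_def set_lebesgue_integral_def indicator_def m_eq_0 intro!: integral_eq_zero_AE)

lemma cmass_nonneg: "0 \<le> cmass t"
  by (auto simp: cmass_def set_lebesgue_integral_def m_nonneg intro!: integral_nonneg_AE)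

lemma cmass_le_total: "cmass t \<le> total"
  unfolding cmass_def set_lebesgue_integral_def total_def
  using integrable_m by (intro integral_mono integrable_mult_indicator) (auto simp: m_nonneg indicator_def)

lemma total_nonneg: "0 \<le> total"
  unfolding total_def by (intro integral_nonneg_AE) (simp add: m_nonneg)

lemma continuous_cmass: "continuous_on A cmass"
  using continuous_on_subset [OF continuous_on_set_LINT [OF integrable_m]] by (auto simp: cmass_def [abs_def])

lemma integrable_m_exp:
  assumes "0 < l"
  shows "integrable lebesgue (\<lambda>s. m s * exp (l * cmass s))"
proof (rule Bochner_Integration.integrable_bound [where f = "\<lambda>s. m s * exp (l * total)"])
  show "integrable lebesgue (\<lambda>s. m s * exp (l * total))"
    using integrable_m by (rule integrable_mult_left)
  have "(\<lambda>s. exp (l * cmass s)) \<in> borel_measurable lebesgue"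
    by (intro borel_measurable_lebesgue_continuous continuous_intros continuous_cmass)
  then show "(\<lambda>s. m s * exp (l * cmass s)) \<in> borel_measurable lebesgue"
    using integrable_m by measurable
  show "AE s in lebesgue. norm (m s * exp (l * cmass s)) \<le> norm (m s * exp (l * total))"
    using assms by (intro AE_I2) (auto simp: abs_mult m_nonneg cmass_le_total intro!: mult_left_mono)
qed

text \<open>The exact bound (without the factor 2) is the substitution rule for \<open>cmass\<close>;
  comparing increments on a grid so fine that the exponential at most doubles is more elementary.\<close>

lemma LINT_m_exp_le:
  assumes l: "0 < l"
  shows "l * (LINT s:{..t}|lebesgue. m s * exp (l * cmass s)) \<le> 2 * exp (l * cmass t)"
proof -
  define W where "W s = exp (l * cmass s)" for s
  define G where "G t = (LINT s:{..t}|lebesgue. m s * W s)" for t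
  have int: "integrable lebesgue (\<lambda>s. m s * W s)"
    unfolding W_def by (rule integrable_m_exp [OF l])
  have G0: "G t = 0" if "t \<le> 0" for t
    using that by (auto simp: G_def set_lebesgue_integral_def indicator_def m_eq_0 intro!: integral_eq_zero_AE)
  have Wmono: "W s \<le> W t" if "s \<le> t" for s t
    using that l by (simp add: W_def cmass_mono)
  have W1: "1 \<le> W s" for s
    using l by (simp add: W_def cmass_nonneg)
  have G_diff: "G t - G s \<le> W t * (cmass t - cmass s)" if "s \<le> t" for s t
  proof -
    have "G t = G s + (LINT r:{s<..t}|lebesgue. m r * W r)"
      using set_integral_Un [of "{..s}" "{s<..t}" lebesgue "\<lambda>r. m r * W r"] that
      by (simp add: G_def ivl_disj_un ivl_disj_int set_integrable_lebesgueI int)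
    also have "(LINT r:{s<..t}|lebesgue. m r * W r) \<le> (LINT r:{s<..t}|lebesgue. m r * W t)"
      by (intro set_integral_mono set_integrable_lebesgueI int integrable_mult_left integrable_m mult_left_mono Wmono m_nonneg) auto
    also have "\<dots> = W t * (cmass t - cmass s)"
      using that by (simp add: cmass_diff mult.commute)
    finally show ?thesis by simp
  qed
  have small: "l * (G t - G s) \<le> 2 * (W t - W s)" if "s \<le> t" "l * (cmass t - cmass s) \<le> ln 2" for s t
  proof -
    define d where "d = l * (cmass t - cmass s)"
    have d: "0 \<le> d" "d \<le> ln 2" using that l cmass_mono [of s t] by (auto simp: d_def)
    have Wt: "W t = W s * exp d"
      by (simp add: W_def d_def algebra_simps flip: exp_add)
    have "exp d \<le> 2" using d(2) exp_le_cancel_iff [of d "ln 2"] by simp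
    have "l * (G t - G s) \<le> l * (W t * (cmass t - cmass s))"
      using G_diff [OF that(1)] l by (intro mult_left_mono) auto
    also have "\<dots> = W s * (exp d * d)"
      by (simp add: Wt d_def)
    also have "\<dots> \<le> W s * (2 * (exp d - 1))"
    proof (intro mult_left_mono)
      have "exp d * d \<le> 2 * d"
        using d \<open>exp d \<le> 2\<close> by (intro mult_right_mono) auto
      also have "d \<le> exp d - 1"
        unfolding le_diff_eq add.commute [of d] by (rule exp_ge_add_one_self)
      finally show "exp d * d \<le> 2 * (exp d - 1)" by simp
    qed (use W1 [of s] in auto)
    finally show ?thesis by (simp add: Wt algebra_simps)
  qed
  have "l * G t \<le> 2 * (W t - 1)"
  proof (cases "t \<le> 0")
    case True
    then show ?thesis using W1 [of t] by (simp add: G0)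
  next
    case False
    have "uniformly_continuous_on {0..t} cmass"
      by (intro compact_uniformly_continuous continuous_cmass) auto
    then obtain \<delta> where \<delta>: "0 < \<delta>" "\<And>r s. r \<in> {0..t} \<Longrightarrow> s \<in> {0..t} \<Longrightarrow> dist s r < \<delta> \<Longrightarrow> dist (cmass s) (cmass r) < ln 2 / l"
      using l unfolding uniformly_continuous_on_def
      by (metis divide_pos_pos ln_gt_zero one_less_numeral_iff semiring_norm(76))
    \<comment> \<open>The grid step \<delta> / 2 keeps neighbouring points strictly closer than
      \<delta>; the induction starts at 0, where G vanishes.\<close>
    have "l * G r \<le> 2 * (W r - 1)" if "0 \<le> r" "r \<le> t" "r \<le> real i * (\<delta> / 2)" for i r
      using that
    proof (induction i arbitrary: r)
      case 0
      then show ?case using G0 [of r] W1 [of r] by simp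
    next
      case (Suc i)
      define s where "s = max 0 (r - \<delta> / 2)"
      have s: "0 \<le> s" "s \<le> r" "s \<le> t" "r - s < \<delta>" "s \<le> real i * (\<delta> / 2)"
        using Suc.prems \<delta>(1) mult_nonneg_nonneg [of "real i" \<delta>] by (auto simp: s_def max_def algebra_simps)
      have "dist (cmass r) (cmass s) < ln 2 / l"
        using s Suc.prems by (intro \<delta>(2)) (auto simp: dist_real_def)
      then have "cmass r - cmass s < ln 2 / l"
        by (simp add: dist_real_def abs_less_iff)
      then have "l * (cmass r - cmass s) \<le> ln 2"
        using l by (simp add: dist_real_def pos_less_divide_eq abs_less_iff mult.commute)
      from small [OF s(2) this] Suc.IH [OF s(1,3,5)]
      show ?case by (simp add: algebra_simps)
    qed
    moreover obtain i where "t / (\<delta> / 2) \<le> real i" using real_arch_simple by blast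
    ultimately show ?thesis
      using False \<delta>(1) by (simp add: field_simps)
  qed
  then show ?thesis
    by (simp add: G_def W_def)
qed

text \<open>Integrating c * m * weight yields at most 2 * c / (4 * |c| + 1) \<le> 1/2 times the
  weight for c \<ge> 0, the 2 being that of \<open>LINT_m_exp_le\<close>. The summand 1 keeps the
  exponent positive for c = 0.\<close>

definition weight :: "real \<Rightarrow> real \<Rightarrow> real" where
  "weight c t = exp ((4 * \<bar>c\<bar> + 1) * cmass t)"

lemma weight_ge_1: "1 \<le> weight c t"
  by (simp add: weight_def cmass_nonneg)

lemma weight_le: "weight c t \<le> exp ((4 * \<bar>c\<bar> + 1) * total)"
  by (simp add: weight_def cmass_le_total mult_left_mono)

lemma integrable_m_weight: "integrable lebesgue (\<lambda>s. m s * weight c s)"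
  unfolding weight_def by (rule integrable_m_exp) auto

text \<open>The contraction estimate: an unknown of weighted size S contributes S / 2 whatever the
  total mass is, and only the inhomogeneity A is multiplied by the mass.\<close>

lemma LINT_weight_le:
  assumes "0 \<le> c" "0 \<le> S" "0 \<le> A"
  shows "(LINT s:{..t}|lebesgue. c * (A + S * weight c s) * m s) \<le> c * A * total + S / 2 * weight c t"
proof -
  let ?l = "4 * \<bar>c\<bar> + 1" and ?I = "LINT s:{..t}|lebesgue. m s * weight c s"
  have "0 \<le> ?I"
    unfolding set_lebesgue_integral_def
    using weight_ge_1 [of c] m_nonneg
    by (intro integral_nonneg_AE AE_I2) (auto intro!: mult_nonneg_nonneg order.trans [OF zero_le_one weight_ge_1])
  then have "4 * c * ?I \<le> ?l * ?I"
    using assms by (intro mult_right_mono) auto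
  also have "\<dots> \<le> 2 * weight c t"
    unfolding weight_def by (rule LINT_m_exp_le) auto
  finally have "4 * c * ?I \<le> 2 * weight c t" .
  from mult_left_mono [OF this \<open>0 \<le> S\<close>] have "c * S * ?I \<le> S / 2 * weight c t"
    by (simp add: algebra_simps)
  moreover have "(LINT s:{..t}|lebesgue. c * (A + S * weight c s) * m s) = c * A * cmass t + c * S * ?I"
  proof -
    have "(LINT s:{..t}|lebesgue. c * (A + S * weight c s) * m s) =
        (LINT s:{..t}|lebesgue. c * A * m s + c * S * (m s * weight c s))"
      by (simp add: algebra_simps)
    also have "\<dots> = c * A * cmass t + c * S * ?I"
      using integrable_m integrable_m_weight
      by (subst set_integral_add) (auto simp: cmass_def intro!: set_integrable_atMost integrable_mult_right)
    finally show ?thesis .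
  qed
  moreover have "c * A * cmass t \<le> c * A * total"
    using assms by (intro mult_left_mono cmass_le_total) auto
  ultimately show ?thesis by simp
qed

lemma integrable_weight_combination: "integrable lebesgue (\<lambda>s. c * (A + S * weight c s) * m s)"
proof -
  have "integrable lebesgue (\<lambda>s. c * A * m s + c * S * (m s * weight c s))"
    by (intro Bochner_Integration.integrable_add integrable_mult_right integrable_m integrable_m_weight)
  then show ?thesis by (simp add: algebra_simps)
qed

end

text \<open>Gronwall by self-improvement. Starting from any finite bound B, iterating the map from S
  to A + S / 2 gives 2 * A + B / 2^k after k steps, which tends to its fixed point 2 * A.\<close>

lemma halving_bound:
  fixes f w :: "'i \<Rightarrow> real"
  assumes w: "\<And>i. i \<in> I \<Longrightarrow> 0 \<le> w i" and B: "\<And>i. i \<in> I \<Longrightarrow> f i \<le> B * w i" "0 \<le> B" and A: "0 \<le> A"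
    and step: "\<And>S i. 0 \<le> S \<Longrightarrow> (\<And>i. i \<in> I \<Longrightarrow> f i \<le> S * w i) \<Longrightarrow> i \<in> I \<Longrightarrow> f i \<le> (A + S / 2) * w i"
    and i: "i \<in> I"
  shows "f i \<le> 2 * A * w i"
proof (rule LIMSEQ_le_const)
  have "\<And>i. i \<in> I \<Longrightarrow> f i \<le> (2 * A + B / 2 ^ k) * w i" for k
  proof (induction k)
    case 0
    fix i assume "i \<in> I"
    then have "f i \<le> B * w i" "0 \<le> 2 * A * w i" using B w A by auto
    then show "f i \<le> (2 * A + B / 2 ^ 0) * w i" by (simp add: algebra_simps)
  next
    case (Suc k)
    have "f i \<le> (A + (2 * A + B / 2 ^ k) / 2) * w i" if "i \<in> I" for i
      using A B(2) Suc that by (intro step) auto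
    then show "\<And>i. i \<in> I \<Longrightarrow> f i \<le> (2 * A + B / 2 ^ Suc k) * w i" by (simp add: field_simps)
  qed
  with i show "\<exists>N. \<forall>k\<ge>N. f i \<le> (2 * A + B / 2 ^ k) * w i" by blast
  have "(\<lambda>k. (2 * A + B * (1 / 2) ^ k) * w i) \<longlonglongrightarrow> (2 * A + B * 0) * w i"
    by (intro tendsto_intros LIMSEQ_realpow_zero) auto
  then show "(\<lambda>k. (2 * A + B / 2 ^ k) * w i) \<longlonglongrightarrow> 2 * A * w i"
    by (simp add: power_one_over field_simps)
qed

section \<open>Constants of the chain rule\<close>

lemma uniform_const:
  fixes P :: "'e \<Rightarrow> real \<Rightarrow> bool"
  assumes "finite E" "\<And>e. e \<in> E \<Longrightarrow> \<exists>C\<ge>0. P e C" "\<And>e C D. P e C \<Longrightarrow> C \<le> D \<Longrightarrow> P e D"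
  shows "\<exists>C\<ge>0. \<forall>e\<in>E. P e C"
  using assms(1,2)
proof (induction E rule: finite_induct)
  case (insert e E)
  obtain C where "C \<ge> 0" "\<forall>e\<in>E. P e C" using insert.IH insert.prems by auto
  moreover obtain D where "D \<ge> 0" "P e D" using insert.prems by auto
  ultimately show ?case
    using assms(3) by (intro exI [of _ "max C D"]) (auto simp: le_max_iff_disj intro: assms(3))
qed auto

text \<open>One constant for three estimates: the Lipschitz bound, the size of \<open>chain\<close>
  and the size of \<open>low\<close>. In the last one K limits only orders below that of J, which is
  what permits induction on the order.\<close>

definition chain_bound :: "'a::euclidean_space itself \<Rightarrow> nat \<Rightarrow> real \<Rightarrow> real \<Rightarrow> bool" where
  "chain_bound _ n K C \<longleftrightarrow> 0 \<le> C \<and>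
    (\<forall>(a :: 'a list \<Rightarrow> 'a) a' b b' m \<eta> \<delta>. \<forall>J\<in>blists n. 0 \<le> m \<longrightarrow> 0 \<le> \<eta> \<longrightarrow> 0 \<le> \<delta> \<longrightarrow>
      (\<forall>I\<in>blists n. norm (a I) \<le> m \<and> norm (a I - a' I) \<le> \<eta>) \<longrightarrow>
      (\<forall>k\<in>blists n. k \<noteq> [] \<longrightarrow> norm (b k) \<le> K \<and> norm (b' k) \<le> K \<and> norm (b k - b' k) \<le> \<delta>) \<longrightarrow>
      norm (ev a b (chain J) - ev a' b' (chain J)) \<le> C * (\<eta> + m * \<delta>)) \<and>
    (\<forall>(a :: 'a list \<Rightarrow> 'a) b m. \<forall>J\<in>blists n. 0 \<le> m \<longrightarrow>
      (\<forall>I\<in>blists n. norm (a I) \<le> m) \<longrightarrow>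
      (\<forall>k\<in>blists n. k \<noteq> [] \<longrightarrow> norm (b k) \<le> K) \<longrightarrow>
      norm (ev a b (chain J)) \<le> C * m) \<and>
    (\<forall>(a :: 'a list \<Rightarrow> 'a) b m. \<forall>J\<in>blists n. J \<noteq> [] \<longrightarrow> 0 \<le> m \<longrightarrow>
      (\<forall>I\<in>blists n. norm (a I) \<le> m) \<longrightarrow>
      (\<forall>k\<in>blists (length J - 1). k \<noteq> [] \<longrightarrow> norm (b k) \<le> K) \<longrightarrow>
      norm (ev a b (low J)) \<le> C * m)"

lemma chain_bound_ex: "\<exists>C. chain_bound TYPE('a::euclidean_space) n K C"
proof -
  have "\<exists>C\<ge>0. \<forall>J\<in>blists n. \<forall>(a :: 'a list \<Rightarrow> 'a) a' b b' m \<eta> \<delta>. 0 \<le> m \<longrightarrow> 0 \<le> \<eta> \<longrightarrow> 0 \<le> \<delta> \<longrightarrow>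
      (\<forall>I\<in>blists n. norm (a I) \<le> m \<and> norm (a I - a' I) \<le> \<eta>) \<longrightarrow>
      (\<forall>k\<in>blists n. k \<noteq> [] \<longrightarrow> norm (b k) \<le> K \<and> norm (b' k) \<le> K \<and> norm (b k - b' k) \<le> \<delta>) \<longrightarrow>
      norm (ev a b (chain J) - ev a' b' (chain J)) \<le> C * (\<eta> + m * \<delta>)"
  proof (rule uniform_const, goal_cases)
    case (2 J)
    from ev_lipschitz [OF orders_chain [OF this], where ?'b = 'a and K = K]
    obtain C where C: "0 \<le> C" "\<And>(a :: 'a list \<Rightarrow> 'a) a' b b' m \<eta> \<delta>.
        \<forall>I\<in>blists n. norm (a I) \<le> m \<and> norm (a I - a' I) \<le> \<eta> \<Longrightarrow>
        \<forall>k\<in>blists n. k \<noteq> [] \<longrightarrow> norm (b k) \<le> K \<and> norm (b' k) \<le> K \<and> norm (b k - b' k) \<le> \<delta> \<Longrightarrow>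
        0 \<le> \<delta> \<Longrightarrow> norm (ev a b (chain J) - ev a' b' (chain J)) \<le> C * (\<eta> + m * \<delta>)"
      by (elim exE conjE) blast
    show ?case
      by (intro exI [of _ C] conjI allI impI C; assumption)
  next
    case (3 J C D)
    show ?case
    proof (intro allI impI)
      fix a a' :: "'a list \<Rightarrow> 'a" and b b' :: "'a list \<Rightarrow> 'a" and m \<eta> \<delta> :: real
      assume *: "0 \<le> m" "0 \<le> \<eta>" "0 \<le> \<delta>"
        "\<forall>I\<in>blists n. norm (a I) \<le> m \<and> norm (a I - a' I) \<le> \<eta>"
        "\<forall>k\<in>blists n. k \<noteq> [] \<longrightarrow> norm (b k) \<le> K \<and> norm (b' k) \<le> K \<and> norm (b k - b' k) \<le> \<delta>"
      have "norm (ev a b (chain J) - ev a' b' (chain J)) \<le> C * (\<eta> + m * \<delta>)"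
        by (rule 3(1) [THEN spec, THEN spec, THEN spec, THEN spec, THEN spec, THEN spec, THEN spec,
              THEN mp, THEN mp, THEN mp, THEN mp, THEN mp, OF *])
      also have "\<dots> \<le> D * (\<eta> + m * \<delta>)"
        using * 3(2) by (intro mult_right_mono) auto
      finally show "norm (ev a b (chain J) - ev a' b' (chain J)) \<le> D * (\<eta> + m * \<delta>)" .
    qed
  qed simp
  then obtain C1 where C1: "C1 \<ge> 0" "\<forall>J\<in>blists n. \<forall>(a :: 'a list \<Rightarrow> 'a) a' b b' m \<eta> \<delta>. 0 \<le> m \<longrightarrow> 0 \<le> \<eta> \<longrightarrow> 0 \<le> \<delta> \<longrightarrow>
      (\<forall>I\<in>blists n. norm (a I) \<le> m \<and> norm (a I - a' I) \<le> \<eta>) \<longrightarrow>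
      (\<forall>k\<in>blists n. k \<noteq> [] \<longrightarrow> norm (b k) \<le> K \<and> norm (b' k) \<le> K \<and> norm (b k - b' k) \<le> \<delta>) \<longrightarrow>
      norm (ev a b (chain J) - ev a' b' (chain J)) \<le> C1 * (\<eta> + m * \<delta>)"
    by (elim exE conjE)
  have "\<exists>C\<ge>0. \<forall>J\<in>blists n. \<forall>(a :: 'a list \<Rightarrow> 'a) b m. 0 \<le> m \<longrightarrow> (\<forall>I\<in>blists n. norm (a I) \<le> m) \<longrightarrow>
      (\<forall>k\<in>blists n. k \<noteq> [] \<longrightarrow> norm (b k) \<le> K) \<longrightarrow> norm (ev a b (chain J)) \<le> C * m"
  proof (rule uniform_const, goal_cases)
    case (2 J)
    from ev_bound [OF orders_chain [OF this], where ?'b = 'a and K = K] show ?case by blast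
  next
    case (3 J C D)
    then show ?case by (meson mult_right_mono order.trans)
  qed simp
  then obtain C2 where C2: "C2 \<ge> 0" "\<forall>J\<in>blists n. \<forall>(a :: 'a list \<Rightarrow> 'a) b m. 0 \<le> m \<longrightarrow> (\<forall>I\<in>blists n. norm (a I) \<le> m) \<longrightarrow>
      (\<forall>k\<in>blists n. k \<noteq> [] \<longrightarrow> norm (b k) \<le> K) \<longrightarrow> norm (ev a b (chain J)) \<le> C2 * m"
    by (elim exE conjE)
  have "\<exists>C\<ge>0. \<forall>J\<in>blists n - {[]}. \<forall>(a :: 'a list \<Rightarrow> 'a) b m. 0 \<le> m \<longrightarrow> (\<forall>I\<in>blists n. norm (a I) \<le> m) \<longrightarrow>
      (\<forall>k\<in>blists (length J - 1). k \<noteq> [] \<longrightarrow> norm (b k) \<le> K) \<longrightarrow> norm (ev a b (low J)) \<le> C * m"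
  proof (rule uniform_const, goal_cases)
    case (2 J)
    then have "orders n (length J - 1) (low J)"
      using orders_mono [OF orders_low, of J n "length J - 1"] by (auto simp: blists_def)
    from ev_bound [OF this, where ?'b = 'a and K = K] show ?case by blast
  next
    case (3 J C D)
    then show ?case by (meson mult_right_mono order.trans)
  qed simp
  then obtain C3 where C3: "C3 \<ge> 0" "\<forall>J\<in>blists n - {[]}. \<forall>(a :: 'a list \<Rightarrow> 'a) b m. 0 \<le> m \<longrightarrow> (\<forall>I\<in>blists n. norm (a I) \<le> m) \<longrightarrow>
      (\<forall>k\<in>blists (length J - 1). k \<noteq> [] \<longrightarrow> norm (b k) \<le> K) \<longrightarrow> norm (ev a b (low J)) \<le> C3 * m"
    by (elim exE conjE)
  define C where "C = C1 + C2 + C3"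
  have le: "C1 * x \<le> C * x" "C2 * x \<le> C * x" "C3 * x \<le> C * x" if "0 \<le> x" for x
    using that C1(1) C2(1) C3(1) by (auto simp: C_def intro!: mult_right_mono)
  have "chain_bound TYPE('a) n K C"
    unfolding chain_bound_def
  proof (intro conjI allI ballI impI, goal_cases)
    case 1
    then show ?case using C1(1) C2(1) C3(1) by (simp add: C_def)
  next
    case (2 a a' b b' m \<eta> \<delta> J)
    then have "norm (ev a b (chain J) - ev a' b' (chain J)) \<le> C1 * (\<eta> + m * \<delta>)"
      using C1(2) by blast
    also have "\<dots> \<le> C * (\<eta> + m * \<delta>)"
      using 2 by (intro le) auto
    finally show ?case .
  next
    case (3 a b m J)
    then show ?case using C2(2) le(2) [of m] order.trans by blast
  next
    case (4 a b m J)
    then have "norm (ev a b (low J)) \<le> C3 * m"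
      using C3(2) by blast
    then show ?case using le(3) [of m] 4 by simp
  qed
  then show ?thesis by blast
qed

text \<open>Choosing the constant as a function of n and K alone makes all flow bounds common to
  every field of mass at most R, as local Hoelder continuity requires.\<close>

definition chain_const :: "'a::euclidean_space itself \<Rightarrow> nat \<Rightarrow> real \<Rightarrow> real" where
  "chain_const T n K = (SOME C. chain_bound T n K C)"

lemma chain_bound_const: "chain_bound TYPE('a::euclidean_space) n K (chain_const TYPE('a) n K)"
  unfolding chain_const_def using chain_bound_ex by (rule someI_ex)

lemma chain_const_nonneg: "0 \<le> chain_const TYPE('a::euclidean_space) n K"
  using chain_bound_const [where 'a = 'a, of n K] unfolding chain_bound_def by blast

lemma ev_chain_lipschitz:
  fixes a a' :: "'a::euclidean_space list \<Rightarrow> 'a"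
  assumes "J \<in> blists n" "0 \<le> m" "0 \<le> \<eta>" "0 \<le> \<delta>"
    "\<And>I. I \<in> blists n \<Longrightarrow> norm (a I) \<le> m" "\<And>I. I \<in> blists n \<Longrightarrow> norm (a I - a' I) \<le> \<eta>"
    "\<And>k. k \<in> blists n \<Longrightarrow> k \<noteq> [] \<Longrightarrow> norm (b k) \<le> K" "\<And>k. k \<in> blists n \<Longrightarrow> k \<noteq> [] \<Longrightarrow> norm (b' k) \<le> K"
    "\<And>k. k \<in> blists n \<Longrightarrow> k \<noteq> [] \<Longrightarrow> norm (b k - b' k) \<le> \<delta>"
  shows "norm (ev a b (chain J) - ev a' b' (chain J)) \<le> chain_const TYPE('a) n K * (\<eta> + m * \<delta>)"
  by (rule chain_bound_const [where 'a = 'a, of n K, unfolded chain_bound_def,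
        THEN conjunct2, THEN conjunct1,
        THEN spec, THEN spec, THEN spec, THEN spec, THEN spec, THEN spec, THEN spec,
        THEN bspec [OF _ assms(1)], THEN mp, THEN mp, THEN mp, THEN mp, THEN mp])
    (use assms in auto)

lemma ev_chain_bound:
  fixes a :: "'a::euclidean_space list \<Rightarrow> 'a"
  assumes "J \<in> blists n" "0 \<le> m" "\<And>I. I \<in> blists n \<Longrightarrow> norm (a I) \<le> m"
    "\<And>k. k \<in> blists n \<Longrightarrow> k \<noteq> [] \<Longrightarrow> norm (b k) \<le> K"
  shows "norm (ev a b (chain J)) \<le> chain_const TYPE('a) n K * m"
  by (rule chain_bound_const [where 'a = 'a, of n K, unfolded chain_bound_def,
        THEN conjunct2, THEN conjunct2, THEN conjunct1,
        THEN spec, THEN spec, THEN spec,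
        THEN bspec [OF _ assms(1)], THEN mp, THEN mp, THEN mp])
    (use assms in auto)

lemma ev_low_bound:
  fixes a :: "'a::euclidean_space list \<Rightarrow> 'a"
  assumes "J \<in> blists n" "J \<noteq> []" "0 \<le> m" "\<And>I. I \<in> blists n \<Longrightarrow> norm (a I) \<le> m"
    "\<And>k. k \<in> blists (length J - 1) \<Longrightarrow> k \<noteq> [] \<Longrightarrow> norm (b k) \<le> K"
  shows "norm (ev a b (low J)) \<le> chain_const TYPE('a) n K * m"
  by (rule chain_bound_const [where 'a = 'a, of n K, unfolded chain_bound_def,
        THEN conjunct2, THEN conjunct2, THEN conjunct2,
        THEN spec, THEN spec, THEN spec,
        THEN bspec [OF _ assms(1)], THEN mp, THEN mp, THEN mp, THEN mp])
    (use assms in auto)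

text \<open>Bounds for the derivatives of order \<open>1, \<dots>, l\<close> of the flow of a vector field of mass at most \<open>R\<close>.\<close>

primrec jet_bound :: "'a::euclidean_space itself \<Rightarrow> nat \<Rightarrow> real \<Rightarrow> nat \<Rightarrow> real" where
  "jet_bound T n R 0 = 1"
| "jet_bound T n R (Suc l) = max (jet_bound T n R l)
     (2 * (1 + real DIM('a) * chain_const T n (jet_bound T n R l) * R) * exp ((4 * real DIM('a) + 1) * R))"

abbreviation flow_bound :: "'a::euclidean_space itself \<Rightarrow> nat \<Rightarrow> real \<Rightarrow> real" where
  "flow_bound T n R \<equiv> jet_bound T n R n"

abbreviation rhs_const :: "'a::euclidean_space itself \<Rightarrow> nat \<Rightarrow> real \<Rightarrow> real" where
  "rhs_const T n R \<equiv> chain_const T n (flow_bound T n R)"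

definition idjet :: "'a::euclidean_space list \<Rightarrow> 'a \<Rightarrow> 'a" where
  "idjet J x = (case J of [] \<Rightarrow> x | [j] \<Rightarrow> j | _ \<Rightarrow> 0)"

lemma idjet_simps [simp]: "idjet [] x = x" "idjet [j] x = j" "idjet (i # j # J) x = 0"
  by (simp_all add: idjet_def)

lemma idjet_cong: "J \<noteq> [] \<Longrightarrow> idjet J x = idjet J y"
  by (auto simp: idjet_def split: list.splits)

lemma norm_idjet_le: "J \<in> blists n \<Longrightarrow> J \<noteq> [] \<Longrightarrow> norm (idjet J x) \<le> 1"
  by (auto simp: idjet_def blists_def split: list.splits)

lemma jet_idjet: "jet n idjet"
  unfolding jet_def
proof (intro conjI ballI impI allI)
  fix J :: "'a list" and x
  show "continuous_on UNIV (idjet J)"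
    by (cases J; cases "tl J") (auto simp: idjet_def [abs_def])
  show "(idjet J has_derivative (\<lambda>v. \<Sum>j\<in>Basis. (v \<bullet> j) *\<^sub>R idjet (j # J) x)) (at x)"
    by (cases J) (auto simp: idjet_def [abs_def] euclidean_representation split: list.splits)
qed

section \<open>Flows of vector fields of finite mass\<close>

text \<open>A single density \<open>m\<close> dominates all derivatives and their Hoelder constants.
  \<open>meas_U\<close> asks for measurability along every measurable path, which is what an
  integral equation along an unknown flow needs.\<close>

locale vfield = mass m for m :: "real \<Rightarrow> real" +
  fixes n :: nat and \<beta> R :: real and U :: "'a::euclidean_space list \<Rightarrow> real \<Rightarrow> 'a \<Rightarrow> 'a"
  assumes jet_U: "\<And>s. jet n (\<lambda>J. U J s)"
    and bound_U: "\<And>J s x. J \<in> blists n \<Longrightarrow> norm (U J s x) \<le> m s"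
    and holder_U: "\<And>J s x y. J \<in> blists n \<Longrightarrow> norm (U J s x - U J s y) \<le> m s * norm (x - y) powr \<beta>"
    and meas_U: "\<And>J y. J \<in> blists n \<Longrightarrow> y \<in> borel_measurable lebesgue \<Longrightarrow> (\<lambda>s. U J s (y s)) \<in> borel_measurable lebesgue"
    and decay_U: "\<And>J s. J \<in> blists n \<Longrightarrow> (U J s \<longlongrightarrow> 0) at_infinity"
    and total_le: "total \<le> R"
    and n_pos: "1 \<le> n"
    and \<beta>: "0 < \<beta>" "\<beta> \<le> 1"
begin

lemma R_nonneg: "0 \<le> R"
  using total_nonneg total_le by simp

definition rhs :: "('a list \<Rightarrow> real \<Rightarrow> 'a \<Rightarrow> 'a) \<Rightarrow> 'a list \<Rightarrow> real \<Rightarrow> 'a \<Rightarrow> 'a" where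
  "rhs \<phi> J s x = ev (\<lambda>I. U I s (\<phi> [] s x)) (\<lambda>I. \<phi> I s x) (chain J)"

text \<open>Picard's operator acts on whole jets: the derivatives are iterated together with the
  map, and by the chain rule the result is again a jet (\<open>jet_picard\<close>).\<close>

definition picard :: "('a list \<Rightarrow> real \<Rightarrow> 'a \<Rightarrow> 'a) \<Rightarrow> 'a list \<Rightarrow> real \<Rightarrow> 'a \<Rightarrow> 'a" where
  "picard \<phi> J t x = idjet J x + (LINT s:{..t}|lebesgue. rhs \<phi> J s x)"

lemma rhs_Nil: "rhs \<phi> [] s x = U [] s (\<phi> [] s x)"
  by (simp add: rhs_def chain_def)

text \<open>The bound describes the fixed ball on which the chain-rule polynomials are Lipschitz.
  The entry at \<open>[]\<close> is exempt, being a perturbation of the unbounded identity.\<close>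

definition admissible :: "('a list \<Rightarrow> real \<Rightarrow> 'a \<Rightarrow> 'a) \<Rightarrow> bool" where
  "admissible \<phi> \<longleftrightarrow> (\<forall>t. jet n (\<lambda>J. \<phi> J t)) \<and>
     (\<forall>J\<in>blists n. \<forall>x. (\<lambda>t. \<phi> J t x) \<in> borel_measurable lebesgue) \<and>
     (\<forall>J\<in>blists n. J \<noteq> [] \<longrightarrow> (\<forall>t x. norm (\<phi> J t x) \<le> flow_bound TYPE('a) n R))"

lemma admissibleD:
  assumes "admissible \<phi>"
  shows "jet n (\<lambda>J. \<phi> J t)" "J \<in> blists n \<Longrightarrow> (\<lambda>t. \<phi> J t x) \<in> borel_measurable lebesgue"
    "J \<in> blists n \<Longrightarrow> J \<noteq> [] \<Longrightarrow> norm (\<phi> J t x) \<le> flow_bound TYPE('a) n R"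
  using assms by (auto simp: admissible_def)

lemma jet_rhs: "admissible \<phi> \<Longrightarrow> jet n (\<lambda>J. rhs \<phi> J s)"
  unfolding rhs_def by (intro jet_compose jet_U admissibleD)

lemma measurable_rhs: "admissible \<phi> \<Longrightarrow> J \<in> blists n \<Longrightarrow> (\<lambda>s. rhs \<phi> J s x) \<in> borel_measurable lebesgue"
  unfolding rhs_def by (intro measurable_ev [OF orders_chain] meas_U admissibleD) auto

lemma norm_rhs_le: "admissible \<phi> \<Longrightarrow> J \<in> blists n \<Longrightarrow> norm (rhs \<phi> J s x) \<le> rhs_const TYPE('a) n R * m s"
  unfolding rhs_def by (intro ev_chain_bound m_nonneg bound_U admissibleD)

lemma integrable_rhs: "admissible \<phi> \<Longrightarrow> J \<in> blists n \<Longrightarrow> integrable lebesgue (\<lambda>s. rhs \<phi> J s x)"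
  by (rule Bochner_Integration.integrable_bound [OF integrable_mult_right [OF integrable_m, of "rhs_const TYPE('a) n R"]])
    (auto simp: measurable_rhs intro: order.trans [OF norm_rhs_le abs_ge_self])

lemma jet_picard:
  assumes "admissible \<phi>"
  shows "jet n (\<lambda>J. picard \<phi> J t)"
  unfolding picard_def set_lebesgue_integral_def
proof (intro jet_add jet_idjet jet_LINT [where w = "\<lambda>s. rhs_const TYPE('a) n R * m s"] jet_scaleR jet_rhs assms)
  fix J :: "'a list" and x s
  assume J: "J \<in> blists n"
  show "norm (indicat_real {..t} s *\<^sub>R rhs \<phi> J s x) \<le> rhs_const TYPE('a) n R * m s"
    using norm_rhs_le [OF assms J, of s x] by (auto simp: indicator_def chain_const_nonneg m_nonneg)
  show "(\<lambda>s. indicat_real {..t} s *\<^sub>R rhs \<phi> J s x) \<in> borel_measurable lebesgue"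
    using measurable_rhs [OF assms J] by (intro borel_measurable_scaleR borel_measurable_indicator) auto
qed (intro integrable_mult_right integrable_m)

lemma continuous_picard: "admissible \<phi> \<Longrightarrow> J \<in> blists n \<Longrightarrow> continuous_on UNIV (\<lambda>t. picard \<phi> J t x)"
  unfolding picard_def by (intro continuous_intros continuous_on_set_LINT integrable_rhs)

primrec iter :: "nat \<Rightarrow> 'a list \<Rightarrow> real \<Rightarrow> 'a \<Rightarrow> 'a" where
  "iter 0 = (\<lambda>J t. idjet J)"
| "iter (Suc k) = picard (iter k)"

lemma jet_bound_mono: "l \<le> l' \<Longrightarrow> jet_bound TYPE('a) n R l \<le> jet_bound TYPE('a) n R l'"
  by (rule lift_Suc_mono_le [of "jet_bound TYPE('a) n R"]) auto

lemma jet_bound_ge_1: "1 \<le> jet_bound TYPE('a) n R l"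
  using jet_bound_mono [of 0 l] by simp

text \<open>The part of \<open>chain J\<close> linear in the highest derivative has coefficients of
  size m, and the weight halves its contribution. The part \<open>low J\<close> involves only orders
  already bounded. The summand 1 is the identity jet.\<close>

lemma picard_bound:
  assumes l: "J \<in> blists n" "length J = Suc l" and "0 \<le> S"
    and lower: "\<And>I s. I \<in> blists l \<Longrightarrow> I \<noteq> [] \<Longrightarrow> norm (\<phi> I s x) \<le> jet_bound TYPE('a) n R l"
    and S: "\<And>s. norm (\<phi> J s x) \<le> S * weight DIM('a) s"
  shows "norm (picard \<phi> J t x) \<le>
    (1 + DIM('a) * chain_const TYPE('a) n (jet_bound TYPE('a) n R l) * R + S / 2) * weight DIM('a) t"
proof -
  let ?D = "real DIM('a)" and ?c = "chain_const TYPE('a) n (jet_bound TYPE('a) n R l)"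
  let ?w = "weight DIM('a)"
  have D1: "1 \<le> ?D" using DIM_positive [where 'a = 'a] by linarith
  have J: "J \<noteq> []" using l by auto
  have "norm (rhs \<phi> J s x) \<le> ?D * (?c + S * ?w s) * m s" for s
  proof -
    let ?a = "\<lambda>I. U I s (\<phi> [] s x)" and ?b = "\<lambda>I. \<phi> I s x"
    have "norm (\<Sum>i\<in>Basis. (?b J \<bullet> i) *\<^sub>R ?a [i]) \<le> ?D * m s * norm (?b J)"
      using n_pos by (intro norm_sum_Basis_le bound_U) (auto simp: blists_def)
    also have "\<dots> \<le> ?D * m s * (S * ?w s)"
      by (intro mult_left_mono S) (auto simp: m_nonneg)
    finally have 1: "norm (\<Sum>i\<in>Basis. (?b J \<bullet> i) *\<^sub>R ?a [i]) \<le> ?D * m s * (S * ?w s)" .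
    have "norm (ev ?a ?b (low J)) \<le> ?c * m s"
      using l by (intro ev_low_bound J m_nonneg bound_U lower) auto
    \<comment> \<open>The extra factor D gives both parts the common shape required by
      \<open>LINT_weight_le\<close>.\<close>
    also have "\<dots> \<le> ?D * (?c * m s)"
      using mult_right_mono [OF D1, of "?c * m s"] chain_const_nonneg [where 'a = 'a] m_nonneg by simp
    finally have "norm (rhs \<phi> J s x) \<le> ?D * m s * (S * ?w s) + ?D * (?c * m s)"
      using 1 J by (auto simp: rhs_def chain_def intro!: norm_triangle_le add_mono)
    then show ?thesis by (simp add: algebra_simps)
  qed
  then have "norm (LINT s:{..t}|lebesgue. rhs \<phi> J s x) \<le> (LINT s:{..t}|lebesgue. ?D * (?c + S * ?w s) * m s)"
    by (intro norm_set_LINT_le integrable_weight_combination)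
  also have "\<dots> \<le> ?D * ?c * total + S / 2 * ?w t"
    using assms by (intro LINT_weight_le chain_const_nonneg) auto
  also have "\<dots> \<le> ?D * ?c * R + S / 2 * ?w t"
    by (intro add_right_mono mult_left_mono total_le) (auto simp: chain_const_nonneg)
  finally have "norm (picard \<phi> J t x) \<le> 1 + (?D * ?c * R + S / 2 * ?w t)"
    unfolding picard_def using norm_idjet_le [OF l(1) J, of x]
    by (intro norm_triangle_le add_mono)
  also have "\<dots> \<le> (1 + ?D * ?c * R) * ?w t + S / 2 * ?w t"
    using mult_left_mono [OF weight_ge_1, of "1 + ?D * ?c * R"] R_nonneg chain_const_nonneg [where 'a = 'a]
    by (simp add: add_nonneg_nonneg)
  finally show ?thesis by (simp add: algebra_simps)
qed

text \<open>Induction on the order, for all iterates and times at once; within one order, induction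
  on the iteration.\<close>

lemma iter_bound:
  assumes "J \<in> blists l" "J \<noteq> []" "l \<le> n"
  shows "norm (iter k J t x) \<le> jet_bound TYPE('a) n R l"
  using assms
proof (induction l arbitrary: J k t)
  case (Suc l)
  let ?c = "chain_const TYPE('a) n (jet_bound TYPE('a) n R l)"
  \<comment> \<open>The fixed point of the improvement in \<open>picard_bound\<close>, so that the
    weighted bound survives every Picard step. Multiplied by the largest weight it is the entry of
    \<open>jet_bound\<close>.\<close>
  let ?S = "2 * (1 + DIM('a) * ?c * R)"
  show ?case
  proof (cases "length J \<le> l")
    case True
    then have "norm (iter k J t x) \<le> jet_bound TYPE('a) n R l"
      using Suc by (intro Suc.IH) (auto simp: blists_def)
    then show ?thesis using jet_bound_mono [of l "Suc l"] by simp
  next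
    case False
    then have J: "J \<in> blists n" "length J = Suc l"
      using Suc.prems by (auto simp: blists_def)
    have S: "2 \<le> ?S" using R_nonneg chain_const_nonneg [where 'a = 'a] by simp
    have lower: "norm (iter k I s x) \<le> jet_bound TYPE('a) n R l" if "I \<in> blists l" "I \<noteq> []" for I k s
      using that Suc.prems by (intro Suc.IH) auto
    have "norm (iter k J t x) \<le> ?S * weight DIM('a) t" for t
    proof (induction k arbitrary: t)
      case 0
      have "norm (idjet J x) \<le> 1 * 1" using norm_idjet_le [OF J(1)] Suc.prems by simp
      also have "\<dots> \<le> ?S * weight DIM('a) t"
        using S by (intro mult_mono weight_ge_1) auto
      finally show ?case by simp
    next
      case (Suc k)
      have "norm (picard (iter k) J t x) \<le> (1 + DIM('a) * ?c * R + ?S / 2) * weight DIM('a) t"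
        using S Suc Suc.prems \<open>Suc l \<le> n\<close> by (intro picard_bound J lower) auto
      also have "1 + DIM('a) * ?c * R + ?S / 2 = ?S" by simp
      finally show ?case by (simp only: iter.simps)
    qed
    also have "?S * weight DIM('a) t \<le> ?S * exp ((4 * real DIM('a) + 1) * R)"
      using S total_le by (intro mult_left_mono order.trans [OF weight_le]) (auto intro!: mult_left_mono)
    finally show ?thesis by simp
  qed
qed (auto simp: blists_def)

lemma admissible_iter: "admissible (iter k)"
proof (induction k)
  case 0
  show ?case
    using iter_bound [of _ n 0] by (auto simp: admissible_def jet_idjet)
next
  case (Suc k)
  show ?case
    unfolding admissible_def
    using iter_bound [of _ n "Suc k"] jet_picard [OF Suc]
      borel_measurable_lebesgue_continuous [OF continuous_picard [OF Suc]]
    by auto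
qed

end

section \<open>Convergence of the Picard iteration\<close>

lemma norm_set_LINT_diff_le:
  fixes f g :: "real \<Rightarrow> 'b::{banach, second_countable_topology}"
  assumes "integrable lebesgue f" "integrable lebesgue g" "integrable lebesgue h"
    and "\<And>s. norm (f s - g s) \<le> h s"
  shows "norm ((LINT s:{..t}|lebesgue. f s) - (LINT s:{..t}|lebesgue. g s)) \<le> (LINT s:{..t}|lebesgue. h s)"
proof -
  have "(LINT s:{..t}|lebesgue. f s) - (LINT s:{..t}|lebesgue. g s) = (LINT s:{..t}|lebesgue. f s - g s)"
    using assms by (intro set_integral_diff(2) [symmetric] set_integrable_atMost)
  then show ?thesis
    using norm_set_LINT_le [OF assms(3,4)] by simp
qed

context vfield
begin

text \<open>At order zero the field is Lipschitz, not just Hoelder. Hence errors of order zero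
  contract linearly, and solutions are unique.\<close>

lemma U_lipschitz: "norm (U [] s x - U [] s y) \<le> DIM('a) * m s * norm (x - y)"
  by (rule jet_lipschitz [OF jet_U]) (use n_pos in \<open>auto intro!: bound_U simp: blists_def\<close>)

lemma norm_picard_diff_le:
  assumes "admissible \<phi>" "admissible \<psi>" "J \<in> blists n" "integrable lebesgue g"
    and "\<And>s. norm (rhs \<phi> J s x - rhs \<psi> J s y) \<le> g s"
  shows "norm (picard \<phi> J t x - picard \<psi> J t y) \<le> norm (idjet J x - idjet J y) + (LINT s:{..t}|lebesgue. g s)"
proof -
  have "picard \<phi> J t x - picard \<psi> J t y = (idjet J x - idjet J y) +
      ((LINT s:{..t}|lebesgue. rhs \<phi> J s x) - (LINT s:{..t}|lebesgue. rhs \<psi> J s y))"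
    by (simp add: picard_def)
  also have "norm \<dots> \<le> norm (idjet J x - idjet J y) + (LINT s:{..t}|lebesgue. g s)"
    using assms by (intro norm_triangle_le add_left_mono norm_set_LINT_diff_le integrable_rhs)
  finally show ?thesis .
qed

lemma iter_diff_Nil:
  "norm (iter (Suc k) [] t x - iter k [] t x) \<le> R * (1 / 2) ^ k * weight DIM('a) t"
proof (induction k arbitrary: t)
  case 0
  have "norm (LINT s:{..t}|lebesgue. rhs (iter 0) [] s x) \<le> (LINT s:{..t}|lebesgue. m s)"
    by (intro norm_set_LINT_le integrable_m) (auto simp: rhs_Nil bound_U)
  also have "\<dots> \<le> R"
    using cmass_le_total [of t] total_le by (simp add: cmass_def)
  also have "\<dots> \<le> R * weight DIM('a) t"
    using mult_left_mono [OF weight_ge_1 R_nonneg] by simp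
  finally show ?case by (simp add: picard_def)
next
  case (Suc k)
  let ?S = "R * (1 / 2) ^ k" and ?D = "real DIM('a)"
  have "norm (rhs (iter (Suc k)) [] s x - rhs (iter k) [] s x) \<le> ?D * (0 + ?S * weight DIM('a) s) * m s" for s
  proof -
    have "norm (rhs (iter (Suc k)) [] s x - rhs (iter k) [] s x) \<le>
        ?D * m s * norm (iter (Suc k) [] s x - iter k [] s x)"
      unfolding rhs_Nil by (rule U_lipschitz)
    also have "\<dots> \<le> ?D * m s * (?S * weight DIM('a) s)"
      by (intro mult_left_mono Suc.IH) (auto simp: m_nonneg)
    finally show ?thesis by (simp only: ac_simps add_0)
  qed
  then have "norm (picard (iter (Suc k)) [] t x - picard (iter k) [] t x) \<le>
      norm (idjet [] x - idjet [] x) + (LINT s:{..t}|lebesgue. ?D * (0 + ?S * weight DIM('a) s) * m s)"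
    by (intro norm_picard_diff_le admissible_iter integrable_weight_combination) auto
  also have "(LINT s:{..t}|lebesgue. ?D * (0 + ?S * weight DIM('a) s) * m s) \<le> ?D * 0 * total + ?S / 2 * weight DIM('a) t"
    using R_nonneg by (intro LINT_weight_le) auto
  finally show ?case by simp
qed

text \<open>At positive orders the derivatives of the field are compared by their \<beta>-Hoelder
  bound, so the order-zero error (1/2)^k comes back as its power \<beta>. Convergence remains
  geometric, at a slower rate.\<close>

lemma iter_diff:
  "\<exists>q M. 0 < q \<and> q < 1 \<and>
    (\<forall>J\<in>blists n. \<forall>k t x. norm (iter (Suc k) J t x - iter k J t x) \<le> M * q ^ k)"
proof -
  let ?D = "real DIM('a)" and ?C = "rhs_const TYPE('a) n R" and ?K = "flow_bound TYPE('a) n R"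
  define c1 where "c1 = R * exp ((4 * ?D + 1) * R)"
  \<comment> \<open>q is at least (1/2)^\<beta>, the rate of the inhomogeneity. The 3/4 closes the
    induction: the unknown contributes B / 2 and the inhomogeneity at most B / 4. In B, the part 2 *
    K covers the first difference and 4 * (C * A * R) ensures the B / 4.\<close>
  define q where "q = max ((1 / 2) powr \<beta>) (3 / 4)"
  define A where "A = c1 powr \<beta>"
  define B where "B = 2 * ?K + 4 * (?C * A * R)"
  have C0: "0 \<le> ?C" by (rule chain_const_nonneg)
  have K1: "1 \<le> ?K" by (rule jet_bound_ge_1)
  have c1: "0 \<le> c1" using R_nonneg by (simp add: c1_def)
  have A0: "0 \<le> A" by (simp add: A_def)
  have B0: "0 \<le> B" "2 * ?K \<le> B" "?C * A * R \<le> B / 4"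
    using C0 K1 A0 R_nonneg by (auto simp: B_def)
  have q: "3 / 4 \<le> q" "(1 / 2) powr \<beta> \<le> q" "q < 1"
    using \<beta> powr_less_mono2 [of \<beta> "1 / 2" 1] by (auto simp: q_def)
  have qk: "((1 / 2) ^ k) powr \<beta> \<le> q ^ k" for k
  proof -
    have "((1 / 2) ^ k) powr \<beta> = ((1 / 2 :: real) powr \<beta>) ^ k"
      by (simp add: powr_powr powr_realpow [symmetric] mult.commute del: powr_realpow powr_half_sqrt)
    also have "\<dots> \<le> q ^ k" using q by (intro power_mono) auto
    finally show ?thesis .
  qed
  have E1: "norm (iter (Suc k) [] t x - iter k [] t x) \<le> c1 * (1 / 2) ^ k" for k t x
  proof -
    have "weight ?D t \<le> exp ((4 * ?D + 1) * R)"
      using total_le by (intro order.trans [OF weight_le]) (auto intro!: mult_left_mono)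
    then have "R * (1 / 2) ^ k * weight ?D t \<le> R * (1 / 2) ^ k * exp ((4 * ?D + 1) * R)"
      using R_nonneg by (intro mult_left_mono) auto
    then show ?thesis
      using iter_diff_Nil [of k t x] by (simp add: c1_def ac_simps)
  qed
  have E2: "norm (iter (Suc k) J t x - iter k J t x) \<le> B * q ^ k * weight ?C t"
    if J: "J \<in> blists n" "J \<noteq> []" for J k t x
    using J
  proof (induction k arbitrary: J t)
    case 0
    have "norm (iter (Suc 0) J t x - iter 0 J t x) \<le> ?K + ?K"
      using 0 by (intro order.trans [OF norm_triangle_ineq4] add_mono iter_bound) auto
    also have "\<dots> \<le> B * 1" using B0 by simp
    also have "\<dots> \<le> B * weight ?C t" by (intro mult_left_mono weight_ge_1 B0)
    finally show ?case by simp
  next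
    case (Suc k)
    let ?S = "B * q ^ k" and ?A = "A * q ^ k"
    have S0: "0 \<le> ?S" "0 \<le> ?A" using B0 A0 q by auto
    have "norm (rhs (iter (Suc k)) J s x - rhs (iter k) J s x) \<le> ?C * (?A + ?S * weight ?C s) * m s" for s
    proof -
      have "norm (rhs (iter (Suc k)) J s x - rhs (iter k) J s x) \<le>
          ?C * (m s * ?A + m s * (?S * weight ?C s))"
        unfolding rhs_def
      proof (rule ev_chain_lipschitz [OF Suc.prems(1) m_nonneg])
        show "0 \<le> m s * ?A" using S0 m_nonneg by simp
        show "0 \<le> ?S * weight ?C s"
          by (rule mult_nonneg_nonneg [OF S0(1) order.trans [OF zero_le_one weight_ge_1]])
        fix I :: "'a list" assume I: "I \<in> blists n"
        show "norm (U I s (iter (Suc k) [] s x)) \<le> m s" by (rule bound_U [OF I])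
        have "norm (U I s (iter (Suc k) [] s x) - U I s (iter k [] s x)) \<le>
            m s * norm (iter (Suc k) [] s x - iter k [] s x) powr \<beta>"
          by (rule holder_U [OF I])
        also have "\<dots> \<le> m s * (c1 * (1 / 2) ^ k) powr \<beta>"
          using \<beta> by (intro mult_left_mono powr_mono2 E1 m_nonneg) auto
        also have "\<dots> = m s * (A * ((1 / 2) ^ k) powr \<beta>)"
          using c1 by (simp add: A_def powr_mult)
        also have "\<dots> \<le> m s * ?A"
          by (intro mult_left_mono qk A0 m_nonneg)
        finally show "norm (U I s (iter (Suc k) [] s x) - U I s (iter k [] s x)) \<le> m s * ?A" .
        assume I': "I \<noteq> []"
        show "norm (iter (Suc k) I s x) \<le> ?K" "norm (iter k I s x) \<le> ?K"
          using I I' by (intro iter_bound; simp)+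
        show "norm (iter (Suc k) I s x - iter k I s x) \<le> ?S * weight ?C s"
          by (rule Suc.IH [OF I I'])
      qed
      then show ?thesis by (simp only: algebra_simps)
    qed
    then have "norm (picard (iter (Suc k)) J t x - picard (iter k) J t x) \<le>
        norm (idjet J x - idjet J x) + (LINT s:{..t}|lebesgue. ?C * (?A + ?S * weight ?C s) * m s)"
      using Suc.prems by (intro norm_picard_diff_le admissible_iter integrable_weight_combination) auto
    also have "\<dots> \<le> ?C * ?A * total + ?S / 2 * weight ?C t"
      using LINT_weight_le [OF C0 S0, of t] by simp
    also have "?C * ?A * total \<le> ?C * ?A * R * weight ?C t"
      using C0 S0 total_le R_nonneg weight_ge_1 [of ?C t] mult_mono [of "?C * ?A * total" "?C * ?A * R" 1 "weight ?C t"]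
        mult_left_mono [OF total_le, of "?C * ?A"] by simp
    also have "?C * ?A * R * weight ?C t + ?S / 2 * weight ?C t = (?C * A * R + B / 2) * (q ^ k * weight ?C t)"
      by (simp add: algebra_simps)
    also have "\<dots> \<le> (B * q) * (q ^ k * weight ?C t)"
    proof (intro mult_right_mono)
      have "B * (3 / 4) \<le> B * q" using q B0 by (intro mult_left_mono)
      then show "?C * A * R + B / 2 \<le> B * q" using B0 by simp
      show "0 \<le> q ^ k * weight ?C t"
        using q order.trans [OF zero_le_one weight_ge_1] by (intro mult_nonneg_nonneg) auto
    qed
    finally show ?case by (simp add: ac_simps)
  qed
  define M where "M = c1 + B * exp ((4 * ?C + 1) * R)"
  have Be: "0 \<le> B * exp ((4 * ?C + 1) * R)" using B0 by simp
  have "norm (iter (Suc k) J t x - iter k J t x) \<le> M * q ^ k" if J: "J \<in> blists n" for J k t x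
  proof (cases "J = []")
    case True
    have "norm (iter (Suc k) [] t x - iter k [] t x) \<le> c1 * (1 / 2) ^ k" by (rule E1)
    also have "\<dots> \<le> M * q ^ k"
      using c1 q Be by (intro mult_mono power_mono) (auto simp: M_def)
    finally show ?thesis using True by simp
  next
    case False
    have "weight ?C t \<le> exp ((4 * ?C + 1) * R)"
      using total_le C0 by (intro order.trans [OF weight_le]) (auto intro!: mult_left_mono)
    then have "B * q ^ k * weight ?C t \<le> B * q ^ k * exp ((4 * ?C + 1) * R)"
      using B0 q by (intro mult_left_mono) auto
    also have "\<dots> \<le> M * q ^ k"
      using c1 q by (simp add: M_def algebra_simps)
    finally show ?thesis using E2 [OF J False, of k t x] by simp
  qed
  with q show ?thesis
    by (intro exI [of _ q] exI [of _ M]) auto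
qed

theorem picard_fixpoint_exists:
  "\<exists>\<Phi>. admissible \<Phi> \<and> (\<forall>J\<in>blists n. \<forall>t x. \<Phi> J t x = picard \<Phi> J t x)"
proof -
  obtain q M where q: "0 < q" "q < 1"
    and M: "\<forall>J\<in>blists n. \<forall>k t x. norm (iter (Suc k) J t x - iter k J t x) \<le> M * q ^ k"
    using iter_diff by (elim exE conjE)
  \<comment> \<open>The limit is written as a telescoping series started at the identity jet, so
    that the Weierstrass test gives convergence uniform in t and x together.\<close>
  define \<Phi> where "\<Phi> J t x = (\<Sum>i. iter (Suc i) J t x - iter i J t x) + idjet J x" for J t x
  have lim: "uniform_limit UNIV (\<lambda>k p. iter k J (fst p) (snd p)) (\<lambda>p. \<Phi> J (fst p) (snd p)) sequentially"
    if J: "J \<in> blists n" for J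
  proof -
    have "uniform_limit UNIV (\<lambda>k p. \<Sum>i<k. iter (Suc i) J (fst p) (snd p) - iter i J (fst p) (snd p))
        (\<lambda>p. \<Sum>i. iter (Suc i) J (fst p) (snd p) - iter i J (fst p) (snd p)) sequentially"
      using q by (intro Weierstrass_m_test [where M = "\<lambda>k. M * q ^ k"] M [rule_format] J summable_mult summable_geometric) auto
    moreover have "(\<Sum>i<k. iter (Suc i) J t x - iter i J t x) = iter k J t x - idjet J x" for k t x
      using sum_lessThan_telescope [of "\<lambda>i. iter i J t x" k] by (simp del: iter.simps(2))
    ultimately have "uniform_limit UNIV (\<lambda>k p. iter k J (fst p) (snd p) - idjet J (snd p))
        (\<lambda>p. \<Sum>i. iter (Suc i) J (fst p) (snd p) - iter i J (fst p) (snd p)) sequentially"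
      by (simp only:)
    from uniform_limit_add [OF this uniform_limit_const, of "\<lambda>p. idjet J (snd p)"]
    show ?thesis
      by (simp add: \<Phi>_def [abs_def] del: iter.simps(2))
  qed
  have pt: "(\<lambda>k. iter k J t x) \<longlonglongrightarrow> \<Phi> J t x" if "J \<in> blists n" for J t x
    using tendsto_uniform_limitI [OF lim [OF that], of "(t, x)"] by simp
  have adm: "admissible \<Phi>"
    unfolding admissible_def
  proof (intro conjI allI ballI impI)
    fix t show "jet n (\<lambda>J. \<Phi> J t)"
    proof (rule jet_uniform_limit [where f = "\<lambda>k J. iter k J t"])
      show "jet n (\<lambda>J. iter k J t)" for k by (rule admissibleD [OF admissible_iter])
      fix J :: "'a list" assume "J \<in> blists n"
      from uniform_limit_compose' [OF lim [OF this], of "\<lambda>x. (t, x)" UNIV]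
      show "uniform_limit UNIV (\<lambda>k. iter k J t) (\<Phi> J t) sequentially" by simp
    qed
  next
    fix J :: "'a list" and x assume J: "J \<in> blists n"
    show "(\<lambda>t. \<Phi> J t x) \<in> borel_measurable lebesgue"
      by (rule borel_measurable_LIMSEQ_metric [where f = "\<lambda>k t. iter k J t x"])
        (auto intro: pt J admissibleD [OF admissible_iter])
    fix t assume "J \<noteq> []"
    then show "norm (\<Phi> J t x) \<le> flow_bound TYPE('a) n R"
      by (intro LIMSEQ_le_const2 [OF tendsto_norm [OF pt [OF J]]]) (auto intro: iter_bound J)
  qed
  \<comment> \<open>Only order zero needs a passage to the limit in the integral equation; there the
    integrand is dominated by \<open>m\<close>.\<close>
  have Nil: "\<Phi> [] t x = picard \<Phi> [] t x" for t x
  proof (rule LIMSEQ_unique)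
    show "(\<lambda>k. iter (Suc k) [] t x) \<longlonglongrightarrow> \<Phi> [] t x"
      by (rule LIMSEQ_Suc [OF pt]) simp
    show "(\<lambda>k. iter (Suc k) [] t x) \<longlonglongrightarrow> picard \<Phi> [] t x"
      unfolding iter.simps picard_def set_lebesgue_integral_def
    proof (intro tendsto_intros integral_dominated_convergence [where w = m])
      show "AE s in lebesgue. (\<lambda>k. indicat_real {..t} s *\<^sub>R rhs (iter k) [] s x) \<longlonglongrightarrow> indicat_real {..t} s *\<^sub>R rhs \<Phi> [] s x"
        unfolding rhs_Nil
      proof (intro AE_I2 tendsto_intros)
        fix s show "(\<lambda>k. U [] s (iter k [] s x)) \<longlonglongrightarrow> U [] s (\<Phi> [] s x)"
          by (rule continuous_on_tendsto_compose [where s = UNIV]) (auto intro: jet_continuous [OF jet_U] pt)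
      qed
      show "(\<lambda>s. indicat_real {..t} s *\<^sub>R rhs \<Phi> [] s x) \<in> borel_measurable lebesgue"
        by (intro borel_measurable_scaleR borel_measurable_indicator measurable_rhs adm) auto
      show "(\<lambda>s. indicat_real {..t} s *\<^sub>R rhs (iter k) [] s x) \<in> borel_measurable lebesgue" for k
        by (intro borel_measurable_scaleR borel_measurable_indicator measurable_rhs admissible_iter) auto
      show "AE s in lebesgue. norm (indicat_real {..t} s *\<^sub>R rhs (iter k) [] s x) \<le> m s" for k
        unfolding rhs_Nil by (auto simp: indicator_def bound_U m_nonneg)
    qed (rule integrable_m)
  qed
  \<comment> \<open>Both sides are jets with the same entry at \<open>[]\<close>, hence agree at
    every order.\<close>
  have "\<Phi> J t x = picard \<Phi> J t x" if J: "J \<in> blists n" for J t x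
  proof -
    have "\<Phi> J t = nderiv (\<Phi> [] t) J"
      using nderiv_jet [OF admissibleD(1) [OF adm] J] by simp
    also have "\<Phi> [] t = picard \<Phi> [] t" using Nil by blast
    also have "nderiv (picard \<Phi> [] t) J = picard \<Phi> J t"
      using nderiv_jet [OF jet_picard [OF adm] J] by simp
    finally show ?thesis by simp
  qed
  with adm show ?thesis by blast
qed

end

section \<open>Estimates for flows\<close>

lemma LINT_atMost_le:
  assumes "integrable lebesgue \<mu>" "\<And>s. 0 \<le> \<mu> s"
  shows "(LINT s:{..t::real}|lebesgue. \<mu> s) \<le> (LINT s|lebesgue. (\<mu> s :: real))"
  unfolding set_lebesgue_integral_def
  using assms by (intro integral_mono integrable_mult_indicator) (auto simp: indicator_def)

text \<open>Decay at infinity is tested along sequences, for which dominated convergence is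
  available.\<close>

lemma tendsto_at_infinityI_sequentially:
  fixes f :: "'a::real_normed_vector \<Rightarrow> 'b::metric_space"
  assumes "\<And>X. (\<And>k. real k \<le> norm (X k)) \<Longrightarrow> (\<lambda>k. f (X k)) \<longlonglongrightarrow> l"
  shows "(f \<longlongrightarrow> l) at_infinity"
proof (rule ccontr)
  assume "\<not> (f \<longlongrightarrow> l) at_infinity"
  then obtain e where e: "0 < e" "\<not> (\<forall>\<^sub>F x in at_infinity. dist (f x) l < e)"
    by (auto simp: tendsto_iff)
  then have "\<forall>k. \<exists>x. real k \<le> norm x \<and> \<not> dist (f x) l < e"
    by (auto simp: eventually_at_infinity)
  then obtain X where X: "\<And>k. real k \<le> norm (X k)" "\<And>k. \<not> dist (f (X k)) l < e"
    by metis
  have "\<forall>\<^sub>F k in sequentially. dist (f (X k)) l < e"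
    using tendstoD [OF assms [OF X(1)] e(1)] .
  with X(2) show False by simp
qed

text \<open>Time belongs to the index set because the improvement at time t uses the bound at all
  earlier times. As weights are at least 1, an unweighted bound B can start the process.\<close>

lemma (in mass) uniform_halving_bound:
  assumes "\<And>i t. i \<in> I \<Longrightarrow> f i t \<le> B" "0 \<le> B" "0 \<le> A"
    and step: "\<And>S i t. 0 \<le> S \<Longrightarrow> (\<And>i t. i \<in> I \<Longrightarrow> f i t \<le> S * weight c t) \<Longrightarrow> i \<in> I \<Longrightarrow>
      f i t \<le> (A + S / 2) * weight c t"
    and i: "i \<in> I"
  shows "f i t \<le> 2 * A * weight c t"
proof -
  have "case_prod f (i, t) \<le> 2 * A * weight c (snd (i, t))"
  proof (rule halving_bound [where I = "I \<times> UNIV" and B = B])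
    fix p :: "'a \<times> real" assume p: "p \<in> I \<times> UNIV"
    show "0 \<le> weight c (snd p)"
      by (rule order.trans [OF zero_le_one weight_ge_1])
    have "case_prod f p \<le> B * 1" using p assms(1) by auto
    also have "\<dots> \<le> B * weight c (snd p)"
      by (intro mult_left_mono weight_ge_1 assms)
    finally show "case_prod f p \<le> B * weight c (snd p)" .
    fix S :: real assume S: "0 \<le> S" "\<And>p. p \<in> I \<times> UNIV \<Longrightarrow> case_prod f p \<le> S * weight c (snd p)"
    have "f i t \<le> S * weight c t" if "i \<in> I" for i t
      using S(2) [of "(i, t)"] that by simp
    from step [OF S(1) this, of "fst p" "snd p"] p show "case_prod f p \<le> (A + S / 2) * weight c (snd p)"
      by auto
  qed (use assms in auto)
  then show ?thesis by simp
qed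

text \<open>Twice the inhomogeneity (the limit in \<open>halving_bound\<close>) times the largest
  weight. DIM * \<open>flow_bound\<close> is the spatial Lipschitz constant of the flow, raised to
  \<beta> by the Hoelder bound of the field.\<close>

definition holder_const :: "'a::euclidean_space itself \<Rightarrow> nat \<Rightarrow> real \<Rightarrow> real \<Rightarrow> real" where
  "holder_const T n \<beta> R = 2 * (rhs_const T n R * (real DIM('a) * flow_bound T n R) powr \<beta> * R) *
     exp ((4 * rhs_const T n R + 1) * R)"

text \<open>Built like \<open>holder_const\<close>. Here 2 * exp (...) is the order-zero Lipschitz
  constant of the flow in the field, and the inner 1 accounts for the direct difference of the two
  fields.\<close>

definition diff_const :: "'a::euclidean_space itself \<Rightarrow> nat \<Rightarrow> real \<Rightarrow> real \<Rightarrow> real" where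
  "diff_const T n \<beta> R = 2 * (rhs_const T n R * (1 + (2 * exp ((4 * real DIM('a) + 1) * R)) powr \<beta> * R)) *
     exp ((4 * rhs_const T n R + 1) * R)"

section \<open>Regularity of a single flow\<close>

locale flow_jet = vfield m n \<beta> R U
  for m :: "real \<Rightarrow> real" and n :: nat and \<beta> R :: real and U :: "'a::euclidean_space list \<Rightarrow> real \<Rightarrow> 'a \<Rightarrow> 'a" +
  fixes \<Phi> :: "'a list \<Rightarrow> real \<Rightarrow> 'a \<Rightarrow> 'a"
  assumes adm: "admissible \<Phi>"
    and fixpoint: "\<And>J t x. J \<in> blists n \<Longrightarrow> \<Phi> J t x = picard \<Phi> J t x"
begin

lemma weight_nonneg: "0 \<le> weight c t"
  using order.trans [OF zero_le_one weight_ge_1] .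

lemma weight_le_R: "weight c t \<le> exp ((4 * \<bar>c\<bar> + 1) * R)"
  using total_le by (intro order.trans [OF weight_le]) (auto intro!: mult_left_mono)

lemma rhs_const_nonneg: "0 \<le> rhs_const TYPE('a) n R"
  by (rule chain_const_nonneg)

lemma jet_flow: "jet n (\<lambda>J. \<Phi> J t)"
  by (rule admissibleD [OF adm])

lemma flow_le: "J \<in> blists n \<Longrightarrow> J \<noteq> [] \<Longrightarrow> norm (\<Phi> J t x) \<le> flow_bound TYPE('a) n R"
  by (rule admissibleD [OF adm])

lemma continuous_flow: "J \<in> blists n \<Longrightarrow> continuous_on UNIV (\<lambda>t. \<Phi> J t x)"
proof -
  assume J: "J \<in> blists n"
  have "(\<lambda>t. \<Phi> J t x) = (\<lambda>t. picard \<Phi> J t x)"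
    using fixpoint [OF J] by (intro ext)
  with continuous_picard [OF adm J] show ?thesis by metis
qed

lemma flow_minus_id: "J \<in> blists n \<Longrightarrow> \<Phi> J t x - idjet J x = (LINT s:{..t}|lebesgue. rhs \<Phi> J s x)"
  using fixpoint [of J t x] by (simp only: picard_def add_diff_cancel_left')

lemma flow_time_diff:
  assumes J: "J \<in> blists n" and st: "s \<le> t"
  shows "\<Phi> J t x - \<Phi> J s x = (LINT r:{s<..t}|lebesgue. rhs \<Phi> J r x)"
proof -
  have "(LINT r:{..s} \<union> {s<..t}|lebesgue. rhs \<Phi> J r x) =
      (LINT r:{..s}|lebesgue. rhs \<Phi> J r x) + (LINT r:{s<..t}|lebesgue. rhs \<Phi> J r x)"
    by (rule set_integral_Un) (auto intro!: set_integrable_lebesgueI integrable_rhs adm J)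
  moreover have "{..s} \<union> {s<..t} = {..t}"
    using st by auto
  moreover have "\<Phi> J t x - \<Phi> J s x = (\<Phi> J t x - idjet J x) - (\<Phi> J s x - idjet J x)"
    by simp
  ultimately show ?thesis
    unfolding flow_minus_id [OF J] by simp
qed

lemma flow_0: "J \<in> blists n \<Longrightarrow> t \<le> 0 \<Longrightarrow> \<Phi> J t x = idjet J x"
proof -
  assume J: "J \<in> blists n" and t: "t \<le> 0"
  have "norm (\<Phi> J t x - idjet J x) \<le> (LINT s:{..t}|lebesgue. rhs_const TYPE('a) n R * m s)"
    unfolding flow_minus_id [OF J]
    by (intro norm_set_LINT_le norm_rhs_le adm J integrable_mult_right integrable_m)
  also have "\<dots> = rhs_const TYPE('a) n R * cmass t"
    by (simp add: cmass_def)
  finally show ?thesis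
    using cmass_0 [OF t] by simp
qed

lemma flow_minus_id_le: "J \<in> blists n \<Longrightarrow> norm (\<Phi> J t x - idjet J x) \<le> rhs_const TYPE('a) n R * R"
proof -
  assume J: "J \<in> blists n"
  have "norm (\<Phi> J t x - idjet J x) \<le> (LINT s:{..t}|lebesgue. rhs_const TYPE('a) n R * m s)"
    unfolding flow_minus_id [OF J]
    by (intro norm_set_LINT_le norm_rhs_le adm J integrable_mult_right integrable_m)
  also have "\<dots> = rhs_const TYPE('a) n R * cmass t"
    by (simp add: cmass_def)
  also have "\<dots> \<le> rhs_const TYPE('a) n R * R"
    using order.trans [OF cmass_le_total total_le] by (intro mult_left_mono rhs_const_nonneg)
  finally show ?thesis .
qed

lemma flow_time_diff_le:
  assumes J: "J \<in> blists n" and st: "s \<le> t"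
  shows "norm (\<Phi> J t x - \<Phi> J s x) \<le> rhs_const TYPE('a) n R * (cmass t - cmass s)"
proof -
  let ?C = "rhs_const TYPE('a) n R"
  have "norm (LINT r:{s<..t}|lebesgue. rhs \<Phi> J r x) \<le> (LINT r:{s<..t}|lebesgue. ?C * m r)"
    unfolding set_lebesgue_integral_def
    using norm_rhs_le [OF adm J] order.trans [OF norm_ge_zero norm_rhs_le [OF adm J]]
    by (intro Bochner_Integration.integral_norm_bound_integral integrable_mult_indicator integrable_rhs
        integrable_mult_right integrable_m adm J) (auto simp: indicator_def)
  then show ?thesis
    unfolding flow_time_diff [OF J st] cmass_diff [OF st] by simp
qed

lemma flow_lipschitz: "norm (\<Phi> [] t x - \<Phi> [] t y) \<le> DIM('a) * flow_bound TYPE('a) n R * norm (x - y)"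
  by (rule jet_lipschitz [OF jet_flow]) (use n_pos in \<open>auto intro!: flow_le simp: blists_def\<close>)

text \<open>For fixed x and y, the derivatives of the field at the two flow points differ by at most
  m times the power \<beta> of the Lipschitz bound for the flow; differences of derivatives of the
  flow enter linearly and are absorbed by halving. Subtracting the identity only matters at order
  zero, since its higher jet entries are constant.\<close>

lemma flow_holder:
  assumes J: "J \<in> blists n"
  shows "norm ((\<Phi> J t x - idjet J x) - (\<Phi> J t y - idjet J y)) \<le>
    holder_const TYPE('a) n \<beta> R * norm (x - y) powr \<beta>"
proof -
  let ?C = "rhs_const TYPE('a) n R" and ?K = "flow_bound TYPE('a) n R"
  define L where "L = real DIM('a) * ?K"
  define A where "A = L powr \<beta> * norm (x - y) powr \<beta>"
  define E where "E = ?C * A * R"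
  have K1: "1 \<le> ?K" by (rule jet_bound_ge_1)
  have L0: "0 \<le> L" using K1 by (simp add: L_def)
  have A0: "0 \<le> A" by (simp add: A_def)
  have E0: "0 \<le> E" using A0 rhs_const_nonneg R_nonneg by (simp add: E_def)
  have step: "norm ((\<Phi> J t x - idjet J x) - (\<Phi> J t y - idjet J y)) \<le> (E + S / 2) * weight ?C t"
    if S: "0 \<le> S" "\<And>J t. J \<in> blists n \<Longrightarrow> J \<noteq> [] \<Longrightarrow> norm (\<Phi> J t x - \<Phi> J t y) \<le> S * weight ?C t"
      and J: "J \<in> blists n" for S J t
  proof -
    have "norm (rhs \<Phi> J s x - rhs \<Phi> J s y) \<le> ?C * (A + S * weight ?C s) * m s" for s
    proof -
      have "norm (rhs \<Phi> J s x - rhs \<Phi> J s y) \<le> ?C * (m s * A + m s * (S * weight ?C s))"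
        unfolding rhs_def
      proof (rule ev_chain_lipschitz [OF J m_nonneg])
        show "0 \<le> m s * A" using A0 m_nonneg by simp
        show "0 \<le> S * weight ?C s" using S(1) weight_nonneg by simp
        fix I :: "'a list" assume I: "I \<in> blists n"
        show "norm (U I s (\<Phi> [] s x)) \<le> m s" by (rule bound_U [OF I])
        have "norm (U I s (\<Phi> [] s x) - U I s (\<Phi> [] s y)) \<le> m s * norm (\<Phi> [] s x - \<Phi> [] s y) powr \<beta>"
          by (rule holder_U [OF I])
        also have "\<dots> \<le> m s * (L * norm (x - y)) powr \<beta>"
          using \<beta> flow_lipschitz by (intro mult_left_mono powr_mono2 m_nonneg) (auto simp: L_def)
        also have "\<dots> = m s * A"
          using L0 by (simp add: A_def powr_mult)
        finally show "norm (U I s (\<Phi> [] s x) - U I s (\<Phi> [] s y)) \<le> m s * A" .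
        assume I': "I \<noteq> []"
        show "norm (\<Phi> I s x) \<le> ?K" "norm (\<Phi> I s y) \<le> ?K"
          by (rule flow_le [OF I I'])+
        show "norm (\<Phi> I s x - \<Phi> I s y) \<le> S * weight ?C s"
          by (rule S(2) [OF I I'])
      qed
      then show ?thesis by (simp only: algebra_simps)
    qed
    then have "norm ((\<Phi> J t x - idjet J x) - (\<Phi> J t y - idjet J y)) \<le>
        (LINT s:{..t}|lebesgue. ?C * (A + S * weight ?C s) * m s)"
      unfolding flow_minus_id [OF J]
      by (intro norm_set_LINT_diff_le integrable_rhs adm J integrable_weight_combination)
    also have "\<dots> \<le> ?C * A * total + S / 2 * weight ?C t"
      by (rule LINT_weight_le [OF rhs_const_nonneg S(1) A0])
    also have "?C * A * total \<le> E * 1"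
      using A0 rhs_const_nonneg total_le by (simp add: E_def mult_left_mono)
    also have "E * 1 \<le> E * weight ?C t"
      by (intro mult_left_mono weight_ge_1 E0)
    finally show ?thesis by (simp add: algebra_simps)
  qed
  have bnd: "norm (\<Phi> J t x - \<Phi> J t y) \<le> 2 * E * weight ?C t" if "J \<in> blists n" "J \<noteq> []" for J t
  proof -
    show ?thesis
    proof (rule uniform_halving_bound [where I = "blists n - {[]}" and B = "2 * ?K"])
      fix I :: "'a list" and s :: real assume I: "I \<in> blists n - {[]}"
      then have "norm (\<Phi> I s x - \<Phi> I s y) \<le> ?K + ?K"
        by (intro order.trans [OF norm_triangle_ineq4] add_mono flow_le) auto
      then show "norm (\<Phi> I s x - \<Phi> I s y) \<le> 2 * ?K" by simp
      fix S :: real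
      assume "0 \<le> S" "\<And>I s. I \<in> blists n - {[]} \<Longrightarrow> norm (\<Phi> I s x - \<Phi> I s y) \<le> S * weight ?C s"
      then show "norm (\<Phi> I s x - \<Phi> I s y) \<le> (E + S / 2) * weight ?C s"
        using step [of S I s] I idjet_cong [of I x y] by simp
    qed (use K1 E0 that in auto)
  qed
  \<comment> \<open>One more application of \<open>step\<close>, with S = 2 * E, reproduces 2 * E
    and now also includes \<open>J = []\<close>, which took no part in the halving.\<close>
  have "norm ((\<Phi> J t x - idjet J x) - (\<Phi> J t y - idjet J y)) \<le> (E + 2 * E / 2) * weight ?C t"
    by (rule step) (use bnd E0 J in auto)
  also have "\<dots> \<le> 2 * E * exp ((4 * ?C + 1) * R)"
    using E0 weight_le_R [of ?C t] rhs_const_nonneg by (auto intro!: mult_left_mono)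
  also have "\<dots> = holder_const TYPE('a) n \<beta> R * norm (x - y) powr \<beta>"
    by (simp add: holder_const_def E_def A_def L_def)
  finally show ?thesis .
qed

text \<open>Displacements are uniformly bounded, so flow points tend to infinity with their starting
  points, where all derivatives of the field vanish. The right-hand side is linear in these with
  bounded coefficients and is dominated in time by a multiple of \<open>m\<close>.\<close>

lemma flow_decay:
  assumes J: "J \<in> blists n"
  shows "((\<lambda>x. \<Phi> J t x - idjet J x) \<longlongrightarrow> 0) at_infinity"
proof (rule tendsto_at_infinityI_sequentially)
  fix X :: "nat \<Rightarrow> 'a" assume X: "\<And>k. real k \<le> norm (X k)"
  let ?C = "rhs_const TYPE('a) n R"
  have lim: "(\<lambda>k. rhs \<Phi> J s (X k)) \<longlonglongrightarrow> 0" for s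
  proof (rule Lim_null_comparison)
    \<comment> \<open>The sum over all derivatives serves as the common bound m in
      \<open>ev_chain_bound\<close>.\<close>
    define a where "a k = (\<Sum>I\<in>blists n. norm (U I s (\<Phi> [] s (X k))))" for k
    have "norm (rhs \<Phi> J s (X k)) \<le> ?C * a k" for k
      unfolding rhs_def
      by (intro ev_chain_bound J flow_le) (auto simp: a_def intro!: sum_nonneg member_le_sum)
    then show "\<forall>\<^sub>F k in sequentially. norm (rhs \<Phi> J s (X k)) \<le> ?C * a k" by simp
    have "filterlim (\<lambda>k. norm (\<Phi> [] s (X k))) at_top sequentially"
    proof (rule filterlim_at_top_mono)
      show "filterlim (\<lambda>k. - (?C * R) + real k) at_top sequentially"
        by (intro filterlim_tendsto_add_at_top [OF tendsto_const] filterlim_real_sequentially)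
      have "- (?C * R) + real k \<le> norm (\<Phi> [] s (X k))" for k
        using flow_minus_id_le [of "[]" s "X k"] X [of k] norm_triangle_ineq2 [of "X k" "X k - \<Phi> [] s (X k)"]
        by (simp add: norm_minus_commute)
      then show "\<forall>\<^sub>F k in sequentially. - (?C * R) + real k \<le> norm (\<Phi> [] s (X k))" by simp
    qed
    then have "filterlim (\<lambda>k. \<Phi> [] s (X k)) at_infinity sequentially"
      by (rule filterlim_norm_at_top_imp_at_infinity)
    then have "(\<lambda>k. U I s (\<Phi> [] s (X k))) \<longlonglongrightarrow> 0" if "I \<in> blists n" for I
      by (rule filterlim_compose [OF decay_U [OF that]])
    then have "(\<lambda>k. ?C * a k) \<longlonglongrightarrow> ?C * (\<Sum>I\<in>(blists n :: 'a list set). 0)"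
      unfolding a_def by (intro tendsto_intros tendsto_norm_zero)
    then show "(\<lambda>k. ?C * a k) \<longlonglongrightarrow> 0" by simp
  qed
  have "(\<lambda>k. LINT s:{..t}|lebesgue. rhs \<Phi> J s (X k)) \<longlonglongrightarrow> (LINT s|(lebesgue :: real measure). (0 :: 'a))"
    unfolding set_lebesgue_integral_def
  proof (rule integral_dominated_convergence [where w = "\<lambda>s. ?C * m s"])
    show "integrable lebesgue (\<lambda>s. ?C * m s)" by (intro integrable_mult_right integrable_m)
    show "(\<lambda>s. indicat_real {..t} s *\<^sub>R rhs \<Phi> J s (X k)) \<in> borel_measurable lebesgue" for k
      by (intro borel_measurable_scaleR borel_measurable_indicator measurable_rhs adm J) auto
    show "AE s in lebesgue. (\<lambda>k. indicat_real {..t} s *\<^sub>R rhs \<Phi> J s (X k)) \<longlonglongrightarrow> 0"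
      using tendsto_scaleR [OF tendsto_const lim] by (intro AE_I2) simp
    show "AE s in lebesgue. norm (indicat_real {..t} s *\<^sub>R rhs \<Phi> J s (X k)) \<le> ?C * m s" for k
      using norm_rhs_le [OF adm J] order.trans [OF norm_ge_zero norm_rhs_le [OF adm J]]
      by (intro AE_I2) (auto simp: indicator_def)
  qed auto
  then show "(\<lambda>k. \<Phi> J t (X k) - idjet J (X k)) \<longlonglongrightarrow> 0"
    by (simp add: flow_minus_id [OF J])
qed

text \<open>w t, the derivative of the flow applied to v, solves a linear integral equation with w =
  v at time 0. Let t0 be its first zero. Going back from t0 over an interval of small mass, w would
  vanish on that whole interval, contradicting the choice of t0.\<close>

lemma flow_derivative_nonzero:
  assumes v: "v \<noteq> 0"
  shows "(\<Sum>j\<in>Basis. (v \<bullet> j) *\<^sub>R \<Phi> [j] t x) \<noteq> 0"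
proof
  define w where "w t = (\<Sum>j\<in>Basis. (v \<bullet> j) *\<^sub>R \<Phi> [j] t x)" for t
  let ?D = "real DIM('a)"
  assume "(\<Sum>j\<in>Basis. (v \<bullet> j) *\<^sub>R \<Phi> [j] t x) = 0"
  then have t: "w t = 0" by (simp add: w_def)
  have j: "[j] \<in> blists n" if "j \<in> Basis" for j :: 'a
    using that n_pos by (simp add: blists_def)
  have cont: "continuous_on A w" for A
  proof (rule continuous_on_subset)
    show "continuous_on UNIV w"
      unfolding w_def by (intro continuous_on_sum continuous_on_scaleR continuous_on_const continuous_flow j)
  qed simp
  have w0: "w s = v" if "s \<le> 0" for s
    using that by (simp add: w_def flow_0 j euclidean_representation)
  have diff: "norm (w b - w a) \<le> ?D * S * (cmass b - cmass a)"
    if "a \<le> b" "\<And>r. r \<in> {a..b} \<Longrightarrow> norm (w r) \<le> S" "0 \<le> S" for a b S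
  proof -
    define h where "h r = (\<Sum>j\<in>Basis. (v \<bullet> j) *\<^sub>R rhs \<Phi> [j] r x)" for r
    have h: "integrable lebesgue h"
      unfolding h_def by (intro Bochner_Integration.integrable_sum integrable_scaleR_right integrable_rhs adm j)
    \<comment> \<open>\<open>low [j]\<close> is \<open>Zero\<close>, so order one is purely linear;
      exchanging the sums exhibits h as the derivative of U at the flow point, applied to w.\<close>
    have "h r = (\<Sum>j\<in>Basis. \<Sum>i\<in>Basis. (v \<bullet> j) *\<^sub>R (\<Phi> [j] r x \<bullet> i) *\<^sub>R U [i] r (\<Phi> [] r x))" for r
      by (simp add: h_def rhs_def chain_def scaleR_sum_right)
    also have "\<dots> r = (\<Sum>i\<in>Basis. (w r \<bullet> i) *\<^sub>R U [i] r (\<Phi> [] r x))" for r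
      unfolding w_def inner_sum_left scaleR_sum_left by (subst sum.swap) simp
    finally have h_eq: "h r = (\<Sum>i\<in>Basis. (w r \<bullet> i) *\<^sub>R U [i] r (\<Phi> [] r x))" for r .
    have h_le: "norm (h r) \<le> ?D * S * m r" if "r \<in> {a..b}" for r
    proof -
      have "norm (h r) \<le> ?D * m r * norm (w r)"
        unfolding h_eq by (intro norm_sum_Basis_le bound_U j)
      also have "\<dots> \<le> ?D * m r * S"
        using \<open>\<And>r. r \<in> {a..b} \<Longrightarrow> norm (w r) \<le> S\<close> [OF that] by (intro mult_left_mono) (auto simp: m_nonneg)
      finally show ?thesis by (simp add: ac_simps)
    qed
    have "w b - w a = (\<Sum>j\<in>Basis. (v \<bullet> j) *\<^sub>R (\<Phi> [j] b x - \<Phi> [j] a x))"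
      by (simp add: w_def scaleR_diff_right sum_subtractf)
    also have "\<dots> = (\<Sum>j\<in>Basis. (v \<bullet> j) *\<^sub>R (LINT r:{a<..b}|lebesgue. rhs \<Phi> [j] r x))"
      by (intro sum.cong refl) (simp add: flow_time_diff [OF j that(1)])
    also have "\<dots> = (LINT r|lebesgue. (\<Sum>j\<in>Basis. (v \<bullet> j) *\<^sub>R indicat_real {a<..b} r *\<^sub>R rhs \<Phi> [j] r x))"
    proof -
      have "integrable lebesgue (\<lambda>r. indicat_real {a<..b} r *\<^sub>R rhs \<Phi> [j] r x)" if "j \<in> Basis" for j
        using that by (intro integrable_mult_indicator integrable_rhs adm j) auto
      then show ?thesis
        unfolding set_lebesgue_integral_def
        by (simp only: Bochner_Integration.integral_sum integrable_scaleR_right integral_scaleR_right)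
    qed
    also have "\<dots> = (LINT r:{a<..b}|lebesgue. h r)"
      by (simp add: set_lebesgue_integral_def h_def scaleR_sum_right ac_simps)
    also have "norm \<dots> \<le> (LINT r:{a<..b}|lebesgue. ?D * S * m r)"
      unfolding set_lebesgue_integral_def using h_le
      by (intro Bochner_Integration.integral_norm_bound_integral integrable_mult_indicator h
          integrable_mult_right integrable_m) (auto simp: indicator_def)
    also have "\<dots> = ?D * S * (cmass b - cmass a)"
      by (simp add: cmass_diff [OF that(1)])
    finally show ?thesis .
  qed
  define Z where "Z = {s \<in> {0..t}. w s = 0}"
  have "closed Z"
    unfolding Z_def by (rule continuous_closed_preimage_constant [OF cont]) simp
  moreover have "t \<in> Z" using t w0 [of t] v by (cases "t \<le> 0") (auto simp: Z_def)
  moreover have bdd: "bdd_below Z" by (auto simp: Z_def intro: bdd_belowI [of _ 0])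
  ultimately have Inf: "Inf Z \<in> Z"
    using closed_contains_Inf [of Z] by auto
  define t0 where "t0 = Inf Z"
  have t0: "w t0 = 0" "0 < t0"
    using Inf w0 [of t0] v by (auto simp: Z_def t0_def less_le)
  have "(cmass \<longlongrightarrow> cmass t0) (at_left t0)"
    using continuous_cmass [of UNIV] by (auto simp: continuous_on_eq_continuous_at isCont_def intro: filterlim_mono at_le)
  then have "\<forall>\<^sub>F s in at_left t0. dist (cmass s) (cmass t0) < 1 / (2 * ?D)"
    by (rule tendstoD) simp
  moreover have "\<forall>\<^sub>F s in at_left t0. s \<in> {0<..<t0}"
    by (rule eventually_at_leftI [of 0]) (auto simp: t0)
  ultimately have "\<forall>\<^sub>F s in at_left t0. dist (cmass s) (cmass t0) < 1 / (2 * ?D) \<and> s \<in> {0<..<t0}"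
    by eventually_elim auto
  then obtain s where s: "dist (cmass s) (cmass t0) < 1 / (2 * ?D)" "0 < s" "s < t0"
    using eventually_happens [of _ "at_left t0"] by auto
  \<comment> \<open>The mass of the interval is below 1 / (2 * DIM). As w t0 = 0, comparing t0 with
    a maximum point r of |w| bounds |w r| by half of itself.\<close>
  have "\<exists>r\<in>{s..t0}. \<forall>q\<in>{s..t0}. norm (w q) \<le> norm (w r)"
    using s by (intro continuous_attains_sup continuous_on_norm cont) auto
  then obtain r where r: "s \<le> r" "r \<le> t0" "\<And>q. q \<in> {s..t0} \<Longrightarrow> norm (w q) \<le> norm (w r)"
    by auto
  have "norm (w r) = norm (w t0 - w r)" by (simp add: t0)
  also have "\<dots> \<le> ?D * norm (w r) * (cmass t0 - cmass r)"
    using r by (intro diff) auto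
  also have "\<dots> \<le> ?D * norm (w r) * (1 / (2 * ?D))"
    using s(1) cmass_mono [OF r(1)] by (intro mult_left_mono) (auto simp: dist_real_def abs_less_iff)
  also have "\<dots> = norm (w r) / 2" by simp
  finally have "w r = 0" by simp
  then have "w s = 0" using r(3) [of s] s by simp
  moreover have "t0 \<le> t" using Inf by (simp add: t0_def Z_def)
  ultimately have "s \<in> Z" using s by (simp add: Z_def)
  then have "t0 \<le> s" unfolding t0_def using bdd by (rule cInf_lower)
  with s show False by simp
qed

end

lemma (in vfield) flow_jet_exists: "\<exists>\<Phi>. flow_jet m n \<beta> R U \<Phi>"
  using picard_fixpoint_exists by (auto intro!: flow_jet.intro flow_jet_axioms.intro vfield_axioms)

text \<open>U along \<Phi> is compared with V along \<Psi> through U along \<Psi>. The change of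
  field costs \<mu>. The change of point costs a multiple of d at order zero, but the power \<beta>
  of that multiple in the derivatives, and this is where the exponent arises. Both flows share one
  density, so the weights of U serve for V as well.\<close>

lemma flow_diff:
  fixes U V \<Phi> \<Psi> :: "'a::euclidean_space list \<Rightarrow> real \<Rightarrow> 'a \<Rightarrow> 'a"
  assumes "flow_jet m n \<beta> R U \<Phi>" "flow_jet m n \<beta> R V \<Psi>"
    and \<mu>: "integrable lebesgue \<mu>" "\<And>s. 0 \<le> \<mu> s"
    and UV: "\<And>I s x. I \<in> blists n \<Longrightarrow> norm (U I s x - V I s x) \<le> \<mu> s"
    and d: "(LINT s|lebesgue. \<mu> s) = d" "d \<le> 1"
    and J: "J \<in> blists n"
  shows "norm (\<Phi> J t x - \<Psi> J t x) \<le> diff_const TYPE('a) n \<beta> R * d powr \<beta>"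
proof -
  interpret U: flow_jet m n \<beta> R U \<Phi> by fact
  interpret V: flow_jet m n \<beta> R V \<Psi> by fact
  let ?C = "rhs_const TYPE('a) n R" and ?K = "flow_bound TYPE('a) n R" and ?D = "real DIM('a)"
  note R0 = U.R_nonneg and C0 = U.rhs_const_nonneg and w0 = U.weight_nonneg and w1 = U.weight_ge_1
  have d0: "0 \<le> d" unfolding d(1) [symmetric] using \<mu>(2) by (intro integral_nonneg_AE) auto
  have D1: "1 \<le> ?D" using DIM_positive [where 'a = 'a] by linarith
  have I_\<mu>: "(LINT s:{..t}|lebesgue. \<mu> s) \<le> d" for t
    using LINT_atMost_le [OF \<mu>, of t] d(1) by simp
  have split: "(LINT s:{..t}|lebesgue. c * \<mu> s + f s) = c * (LINT s:{..t}|lebesgue. \<mu> s) + (LINT s:{..t}|lebesgue. f s)"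
    if "integrable lebesgue f" for c t and f :: "real \<Rightarrow> real"
    using that \<mu> by (subst set_integral_add) (auto intro!: set_integrable_atMost integrable_mult_right)
  define c1 where "c1 = 2 * exp ((4 * ?D + 1) * R)"
  have zero: "norm (\<Phi> [] t x - \<Psi> [] t x) \<le> c1 * d" for t
  proof -
    have "norm (\<Phi> [] t x - \<Psi> [] t x) \<le> 2 * d * U.weight ?D t"
    proof (rule U.uniform_halving_bound [where I = "{()}" and B = "2 * (?C * R)" and f = "\<lambda>_ t. norm (\<Phi> [] t x - \<Psi> [] t x)"])
      fix t
      have "norm (\<Phi> [] t x - \<Psi> [] t x) \<le> ?C * R + ?C * R"
        using norm_triangle_ineq4 [of "\<Phi> [] t x - x" "\<Psi> [] t x - x"]
          add_mono [OF U.flow_minus_id_le [of "[]" t x] V.flow_minus_id_le [of "[]" t x]]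
        by (auto intro: order.trans)
      then show "norm (\<Phi> [] t x - \<Psi> [] t x) \<le> 2 * (?C * R)" by linarith
      fix S :: real assume S: "0 \<le> S" "\<And>i t. i \<in> {()} \<Longrightarrow> norm (\<Phi> [] t x - \<Psi> [] t x) \<le> S * U.weight ?D t"
      let ?g = "\<lambda>s. ?D * (0 + S * U.weight ?D s) * m s"
      have "norm (U.rhs \<Phi> [] s x - V.rhs \<Psi> [] s x) \<le> 1 * \<mu> s + ?g s" for s
      proof -
        have "norm (U [] s (\<Phi> [] s x) - U [] s (\<Psi> [] s x)) \<le> ?D * m s * norm (\<Phi> [] s x - \<Psi> [] s x)"
          by (rule U.U_lipschitz)
        also have "\<dots> \<le> ?D * m s * (S * U.weight ?D s)"
          using S(2) U.m_nonneg by (intro mult_left_mono) auto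
        finally have "norm ((U [] s (\<Psi> [] s x) - V [] s (\<Psi> [] s x)) + (U [] s (\<Phi> [] s x) - U [] s (\<Psi> [] s x))) \<le>
            \<mu> s + ?D * m s * (S * U.weight ?D s)"
          by (intro norm_triangle_le add_mono UV) auto
        then show ?thesis
          unfolding U.rhs_Nil V.rhs_Nil by (simp add: ac_simps)
      qed
      then have "norm ((\<Phi> [] t x - idjet [] x) - (\<Psi> [] t x - idjet [] x)) \<le> (LINT s:{..t}|lebesgue. 1 * \<mu> s + ?g s)"
        unfolding U.flow_minus_id [OF blists_Nil] V.flow_minus_id [OF blists_Nil]
        by (intro norm_set_LINT_diff_le U.integrable_rhs V.integrable_rhs U.adm V.adm
            Bochner_Integration.integrable_add integrable_mult_right \<mu> U.integrable_weight_combination) auto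
      also have "\<dots> = 1 * (LINT s:{..t}|lebesgue. \<mu> s) + (LINT s:{..t}|lebesgue. ?g s)"
        by (rule split [OF U.integrable_weight_combination])
      also have "\<dots> \<le> d + (?D * 0 * U.total + S / 2 * U.weight ?D t)"
        using I_\<mu> [of t] S(1) by (intro add_mono U.LINT_weight_le) auto
      also have "d \<le> d * U.weight ?D t"
        using mult_left_mono [OF w1 d0] by simp
      finally show "norm (\<Phi> [] t x - \<Psi> [] t x) \<le> (d + S / 2) * U.weight ?D t"
        by (simp add: algebra_simps)
    qed (use R0 C0 d0 in auto)
    also have "\<dots> \<le> 2 * d * exp ((4 * ?D + 1) * R)"
      using U.weight_le_R [of ?D t] d0 by (intro mult_left_mono) auto
    finally show ?thesis by (simp add: c1_def ac_simps)
  qed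
  define A where "A = (c1 * d) powr \<beta>"
  \<comment> \<open>The inhomogeneity at positive orders: d from the change of field, A * R from the
    change of point.\<close>
  define E where "E = ?C * (d + A * R)"
  have A0: "0 \<le> A" by (simp add: A_def)
  have E0: "0 \<le> E" using A0 C0 R0 d0 by (simp add: E_def)
  have step: "norm (\<Phi> J t x - \<Psi> J t x) \<le> (E + S / 2) * U.weight ?C t"
    if S: "0 \<le> S" "\<And>J t. J \<in> blists n \<Longrightarrow> J \<noteq> [] \<Longrightarrow> norm (\<Phi> J t x - \<Psi> J t x) \<le> S * U.weight ?C t"
      and J: "J \<in> blists n" for S J t
  proof -
    let ?g = "\<lambda>s. ?C * (A + S * U.weight ?C s) * m s"
    have "norm (U.rhs \<Phi> J s x - V.rhs \<Psi> J s x) \<le> ?C * \<mu> s + ?g s" for s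
    proof -
      have "norm (U.rhs \<Phi> J s x - V.rhs \<Psi> J s x) \<le> ?C * ((\<mu> s + m s * A) + m s * (S * U.weight ?C s))"
        unfolding U.rhs_def V.rhs_def
      proof (rule ev_chain_lipschitz [OF J U.m_nonneg])
        show "0 \<le> \<mu> s + m s * A" using A0 U.m_nonneg \<mu>(2) by simp
        show "0 \<le> S * U.weight ?C s" using S(1) w0 by simp
        fix I :: "'a list" assume I: "I \<in> blists n"
        show "norm (U I s (\<Phi> [] s x)) \<le> m s" by (rule U.bound_U [OF I])
        have "norm (U I s (\<Phi> [] s x) - U I s (\<Psi> [] s x)) \<le> m s * norm (\<Phi> [] s x - \<Psi> [] s x) powr \<beta>"
          by (rule U.holder_U [OF I])
        also have "\<dots> \<le> m s * A"
          unfolding A_def using U.\<beta> zero by (intro mult_left_mono powr_mono2 U.m_nonneg) auto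
        finally have "norm ((U I s (\<Psi> [] s x) - V I s (\<Psi> [] s x)) + (U I s (\<Phi> [] s x) - U I s (\<Psi> [] s x))) \<le>
            \<mu> s + m s * A"
          by (intro norm_triangle_le add_mono UV I)
        then show "norm (U I s (\<Phi> [] s x) - V I s (\<Psi> [] s x)) \<le> \<mu> s + m s * A" by simp
        assume I': "I \<noteq> []"
        show "norm (\<Phi> I s x) \<le> ?K" "norm (\<Psi> I s x) \<le> ?K"
          by (rule U.flow_le [OF I I'], rule V.flow_le [OF I I'])
        show "norm (\<Phi> I s x - \<Psi> I s x) \<le> S * U.weight ?C s"
          by (rule S(2) [OF I I'])
      qed
      then show ?thesis by (simp only: algebra_simps)
    qed
    then have "norm ((\<Phi> J t x - idjet J x) - (\<Psi> J t x - idjet J x)) \<le> (LINT s:{..t}|lebesgue. ?C * \<mu> s + ?g s)"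
      unfolding U.flow_minus_id [OF J] V.flow_minus_id [OF J]
      by (intro norm_set_LINT_diff_le U.integrable_rhs V.integrable_rhs U.adm V.adm J
          Bochner_Integration.integrable_add integrable_mult_right \<mu> U.integrable_weight_combination)
    also have "\<dots> = ?C * (LINT s:{..t}|lebesgue. \<mu> s) + (LINT s:{..t}|lebesgue. ?g s)"
      by (rule split [OF U.integrable_weight_combination])
    also have "\<dots> \<le> ?C * d + (?C * A * U.total + S / 2 * U.weight ?C t)"
      using I_\<mu> [of t] by (intro add_mono U.LINT_weight_le mult_left_mono C0 S(1) A0)
    also have "?C * A * U.total \<le> ?C * A * R"
      using A0 C0 U.total_le by (intro mult_left_mono) auto
    finally have "norm (\<Phi> J t x - \<Psi> J t x) \<le> E + S / 2 * U.weight ?C t"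
      by (simp add: E_def algebra_simps)
    also have "E \<le> E * U.weight ?C t"
      using mult_left_mono [OF w1 E0] by simp
    finally show ?thesis by (simp add: algebra_simps)
  qed
  have K1: "1 \<le> ?K" by (rule U.jet_bound_ge_1)
  have bnd: "norm (\<Phi> J t x - \<Psi> J t x) \<le> 2 * E * U.weight ?C t" if "J \<in> blists n" "J \<noteq> []" for J t
  proof -
    show ?thesis
    proof (rule U.uniform_halving_bound [where I = "blists n - {[]}" and B = "2 * ?K"])
      fix I :: "'a list" and s :: real assume I: "I \<in> blists n - {[]}"
      then have "norm (\<Phi> I s x - \<Psi> I s x) \<le> ?K + ?K"
        by (intro order.trans [OF norm_triangle_ineq4] add_mono U.flow_le V.flow_le) auto
      then show "norm (\<Phi> I s x - \<Psi> I s x) \<le> 2 * ?K" by simp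
      fix S :: real
      assume "0 \<le> S" "\<And>I s. I \<in> blists n - {[]} \<Longrightarrow> norm (\<Phi> I s x - \<Psi> I s x) \<le> S * U.weight ?C s"
      then show "norm (\<Phi> I s x - \<Psi> I s x) \<le> (E + S / 2) * U.weight ?C s"
        using step [of S I s] I by simp
    qed (use K1 E0 that in auto)
  qed
  have "norm (\<Phi> J t x - \<Psi> J t x) \<le> (E + 2 * E / 2) * U.weight ?C t"
    by (rule step) (use bnd E0 J in auto)
  also have "\<dots> \<le> 2 * E * exp ((4 * ?C + 1) * R)"
    using E0 U.weight_le_R [of ?C t] C0 by (auto intro!: mult_left_mono)
  \<comment> \<open>Since d \<le> 1, the linear term d is absorbed into d^\<beta>.\<close>
  also have "E \<le> ?C * (1 + c1 powr \<beta> * R) * d powr \<beta>"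
  proof -
    have "d \<le> d powr \<beta>"
      using d0 d(2) U.\<beta> by (intro powr_le_of_le_1)
    moreover have "A = c1 powr \<beta> * d powr \<beta>"
      using d0 by (simp add: A_def c1_def powr_mult)
    ultimately have "d + A * R \<le> (1 + c1 powr \<beta> * R) * d powr \<beta>"
      by (simp add: algebra_simps)
    from mult_left_mono [OF this C0] show ?thesis
      by (simp only: E_def mult.assoc)
  qed
  finally show ?thesis
    by (simp add: diff_const_def c1_def ac_simps)
qed

section \<open>Bochner integrable vector fields\<close>

text \<open>Completeness of Lebesgue measure makes measurability invariant under equality almost
  everywhere. If one function is not integrable, neither is the other, and both integrals have the
  default value 0.\<close>

lemma integrable_lebesgue_AE_eq:
  fixes f g :: "real \<Rightarrow> 'b::euclidean_space"
  assumes "AE s in lebesgue. f s = g s"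
  shows "integrable lebesgue f \<longleftrightarrow> integrable lebesgue g"
    and "integral\<^sup>L lebesgue f = integral\<^sup>L lebesgue g"
proof -
  have imp: "integrable lebesgue g'" if "integrable lebesgue f'" "AE s in lebesgue. f' s = g' s"
    for f' g' :: "real \<Rightarrow> 'b"
    using that by (intro integrable_cong_AE_imp [OF that(1) borel_measurable_AE [OF _ that(2)]]) auto
  have sym: "AE s in lebesgue. g s = f s" using assms by eventually_elim simp
  show iff: "integrable lebesgue f \<longleftrightarrow> integrable lebesgue g"
    using imp [OF _ assms] imp [OF _ sym] by blast
  show "integral\<^sup>L lebesgue f = integral\<^sup>L lebesgue g"
  proof (cases "integrable lebesgue f")
    case True
    with iff assms show ?thesis by (intro integral_cong_AE) auto
  qed (use iff in \<open>simp add: not_integrable_integral_eq\<close>)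
qed

lemma AE_not_0: "AE s in lebesgue. s \<noteq> (0 :: real)"
  by (intro AE_I' [of "{0}"]) auto

text \<open>Extending by zero to the whole line lets all time integrals start at \<open>-\<infinity>\<close>.\<close>

definition field_jet :: "(real \<Rightarrow> 'a \<Rightarrow> 'a) \<Rightarrow> 'a list \<Rightarrow> real \<Rightarrow> 'a \<Rightarrow> 'a::euclidean_space" where
  "field_jet u J s x = (if 0 < s \<and> s \<le> 1 then nderiv (u s) J x else 0)"

text \<open>The half-open interval makes this density vanish for s \<le> 0, as \<open>mass\<close>
  demands; the omitted endpoint is null.\<close>

definition cna_dist :: "nat \<Rightarrow> real \<Rightarrow> (real \<Rightarrow> 'a \<Rightarrow> 'a) \<Rightarrow> (real \<Rightarrow> 'a \<Rightarrow> 'a::euclidean_space) \<Rightarrow> real \<Rightarrow> real" where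
  "cna_dist n \<beta> u v s = (if 0 < s \<and> s \<le> 1 then enn2real (Cna_norm n \<beta> (\<lambda>x. u s x - v s x)) else 0)"

lemma cna_dist_nonneg: "0 \<le> cna_dist n \<beta> u v s"
  by (simp add: cna_dist_def)

lemma zero_C0_space: "(\<lambda>x. 0) \<in> C0_space n \<beta>"
  by (simp add: C0_space_def zero_Cn_map nderiv_zero mlin_norm_zero Cna_norm_zero)

lemma zero_bochner_fun: "(\<lambda>t x. 0) \<in> bochner_fun n \<beta>"
  by (rule simple_bochner_fun) (simp_all add: zero_C0_space)

lemma
  fixes u v :: "real \<Rightarrow> real^'d \<Rightarrow> real^'d"
  assumes uv: "u \<in> bochner_fun n \<beta>" "v \<in> bochner_fun n \<beta>"
  shows integrable_cna_dist: "integrable lebesgue (cna_dist n \<beta> u v)"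
    and LINT_cna_dist: "(LINT s|lebesgue. cna_dist n \<beta> u v s) = fun_dist n \<beta> u v"
proof -
  let ?M = "lebesgue_on {0..1::real}"
  let ?N = "\<lambda>s. Cna_norm n \<beta> (\<lambda>x. u s x - v s x)"
  let ?g = "\<lambda>s. enn2real (?N s)"
  have N: "?N \<in> borel_measurable ?M" by (rule bochner_fun_measurable [OF uv])
  have fin: "(\<integral>\<^sup>+s. ?N s \<partial>?M) < \<infinity>" by (rule bochner_fun_dist_finite [OF uv])
  have eq: "(\<integral>\<^sup>+s. ennreal (?g s) \<partial>?M) = (\<integral>\<^sup>+s. ?N s \<partial>?M)"
  proof (rule nn_integral_cong)
    fix s assume "s \<in> space ?M"
    then have "?N s < \<infinity>"
      by (intro C0_diff_finite bochner_fun_C0 [OF uv(1)] bochner_fun_C0 [OF uv(2)]) auto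
    then show "ennreal (?g s) = ?N s" by simp
  qed
  have g: "?g \<in> borel_measurable ?M" using N by measurable
  have "integrable ?M ?g"
    using fin by (intro integrableI_nonneg g) (auto simp: eq)
  then have int: "integrable lebesgue (\<lambda>s. indicat_real {0..1} s *\<^sub>R ?g s)"
    by (subst (asm) integrable_restrict_space) auto
  have "integral\<^sup>L ?M ?g = fun_dist n \<beta> u v"
    unfolding fun_dist_def eq [symmetric] by (rule integral_eq_nn_integral [OF g]) simp
  then have val: "(LINT s|lebesgue. indicat_real {0..1} s *\<^sub>R ?g s) = fun_dist n \<beta> u v"
    by (subst (asm) integral_restrict_space) auto
  have AE: "AE s in lebesgue. indicat_real {0..1} s *\<^sub>R ?g s = cna_dist n \<beta> u v s"
    using AE_not_0 by eventually_elim (auto simp: cna_dist_def indicator_def)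
  show "integrable lebesgue (cna_dist n \<beta> u v)"
    using int integrable_lebesgue_AE_eq(1) [OF AE] by simp
  show "(LINT s|lebesgue. cna_dist n \<beta> u v s) = fun_dist n \<beta> u v"
    using val integrable_lebesgue_AE_eq(2) [OF AE] by simp
qed

lemma norm_nderiv_diff_le:
  assumes f: "f \<in> C0_space n \<beta>" "g \<in> C0_space n \<beta>" and J: "J \<in> blists n"
  shows "norm (nderiv f J x - nderiv g J x) \<le> enn2real (Cna_norm n \<beta> (\<lambda>x. f x - g x))"
proof -
  have "nderiv (\<lambda>x. f x - g x) J x = nderiv f J x - nderiv g J x"
    using J by (subst nderiv_diff [OF C0_space_Cn_map [OF f(1)] C0_space_Cn_map [OF f(2)]]) (auto simp: blists_def)
  then show ?thesis
    using norm_jet_le_Cna_norm [OF C0_diff_finite [OF f] J, of x] by simp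
qed

text \<open>For a simple approximant, finitely many continuous functions composed with the path are
  glued along measurable sets. Convergence in the norm of \<open>Cna_norm\<close> at almost every
  time implies convergence of each derivative at the point \<open>y t\<close>.\<close>

lemma measurable_field_jet:
  fixes u :: "real \<Rightarrow> real^'d \<Rightarrow> real^'d"
  assumes u: "u \<in> bochner_fun n \<beta>" and J: "J \<in> blists n" and y: "y \<in> borel_measurable lebesgue"
  shows "(\<lambda>s. field_jet u J s (y s)) \<in> borel_measurable lebesgue"
proof -
  let ?M = "lebesgue_on {0..1::real}"
  obtain s where s: "\<And>k. simple_function ?M (s k)" "\<And>k t. t \<in> {0..1} \<Longrightarrow> s k t \<in> C0_space n \<beta>"
      "AE t in ?M. (\<lambda>k. Cna_norm n \<beta> (\<lambda>x. u t x - s k t x)) \<longlonglongrightarrow> 0"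
    using u unfolding bochner_fun_def by blast
  define F where "F k t = indicat_real {0..1} t *\<^sub>R nderiv (s k t) J (y t)" for k t
  have F: "F k \<in> borel_measurable lebesgue" for k
  proof -
    have "(\<lambda>t. nderiv (s k t) J (y t)) \<in> borel_measurable ?M"
    proof (rule measurable_compose_countable' [where g = "s k" and I = "s k ` space ?M" and f = "\<lambda>f t. nderiv f J (y t)"])
      show "s k \<in> ?M \<rightarrow>\<^sub>M count_space (s k ` space ?M)"
        using s(1) [of k] by (simp add: simple_function_def measurable_count_space_eq2)
      show "countable (s k ` space ?M)"
        using s(1) [of k] by (intro countable_finite) (simp add: simple_function_def)
      fix f assume "f \<in> s k ` space ?M"
      then have "f \<in> C0_space n \<beta>" using s(2) by auto
      then have "continuous_on UNIV (nderiv f J)"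
        by (intro jet_continuous [OF Cn_map_jet J] C0_space_Cn_map)
      then have "nderiv f J \<in> borel_measurable borel"
        by (rule borel_measurable_continuous_onI)
      then show "(\<lambda>t. nderiv f J (y t)) \<in> borel_measurable ?M"
        by (intro measurable_restrict_space1 measurable_compose [OF y])
    qed
    then show ?thesis
      unfolding F_def by (subst (asm) borel_measurable_restrict_space_iff) auto
  qed
  have "AE t in lebesgue. t \<in> {0..1} \<longrightarrow> (\<lambda>k. Cna_norm n \<beta> (\<lambda>x. u t x - s k t x)) \<longlonglongrightarrow> 0"
    using s(3) by (subst (asm) AE_restrict_space_iff) auto
  \<comment> \<open>\<open>lim\<close> of measurable functions is measurable even where the sequence
    diverges; equality with the target is needed almost everywhere only.\<close>
  then have "AE t in lebesgue. lim (\<lambda>k. F k t) = field_jet u J t (y t)"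
    using AE_not_0
  proof eventually_elim
    case (elim t)
    show ?case
    proof (cases "t \<in> {0..1}")
      case True
      then have lim: "(\<lambda>k. Cna_norm n \<beta> (\<lambda>x. u t x - s k t x)) \<longlonglongrightarrow> 0" using elim by simp
      have "(\<lambda>k. nderiv (s k t) J (y t)) \<longlonglongrightarrow> nderiv (u t) J (y t)"
      proof (rule metric_LIMSEQ_I)
        fix e :: real assume e: "0 < e"
        then have "\<forall>\<^sub>F k in sequentially. Cna_norm n \<beta> (\<lambda>x. u t x - s k t x) < ennreal e"
          using order_tendstoD(2) [OF lim, of "ennreal e"] by simp
        then obtain k0 where k0: "\<And>k. k \<ge> k0 \<Longrightarrow> Cna_norm n \<beta> (\<lambda>x. u t x - s k t x) < ennreal e"
          by (auto simp: eventually_sequentially)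
        have "dist (nderiv (s k t) J (y t)) (nderiv (u t) J (y t)) < e" if "k \<ge> k0" for k
        proof -
          have "dist (nderiv (s k t) J (y t)) (nderiv (u t) J (y t)) \<le> enn2real (Cna_norm n \<beta> (\<lambda>x. u t x - s k t x))"
            using norm_nderiv_diff_le [OF bochner_fun_C0 [OF u True] s(2) [OF True] J]
            by (simp add: dist_norm norm_minus_commute)
          also have "\<dots> < e"
            using k0 [OF that] e by (cases "Cna_norm n \<beta> (\<lambda>x. u t x - s k t x)") (auto simp: ennreal_less_iff)
          finally show ?thesis .
        qed
        then show "\<exists>k0. \<forall>k\<ge>k0. dist (nderiv (s k t) J (y t)) (nderiv (u t) J (y t)) < e" by blast
      qed
      then have "lim (\<lambda>k. nderiv (s k t) J (y t)) = nderiv (u t) J (y t)" by (rule limI)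
      then show ?thesis
        using True elim by (auto simp: F_def field_jet_def)
    qed (auto simp: F_def field_jet_def)
  qed
  moreover have "(\<lambda>t. lim (\<lambda>k. F k t)) \<in> borel_measurable lebesgue"
    using F by (rule borel_measurable_lim_metric)
  ultimately show ?thesis
    by (rule borel_measurable_AE [rotated])
qed

text \<open>The factor 2 * DIM is the constant of \<open>jet_holder\<close>; with it a single
  density controls derivatives and Hoelder constants together.\<close>

lemma vfield_field_jet:
  fixes u :: "real \<Rightarrow> real^'d \<Rightarrow> real^'d"
  assumes u: "u \<in> bochner_fun n \<beta>" and m: "mass m" "mass.total m \<le> R"
    and le: "\<And>s. 2 * DIM(real^'d) * cna_dist n \<beta> u (\<lambda>t x. 0) s \<le> m s"
    and n: "1 \<le> n" and \<beta>: "0 < \<beta>" "\<beta> \<le> 1"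
  shows "vfield m n \<beta> R (field_jet u)"
proof -
  interpret mass m by fact
  have C0: "u s \<in> C0_space n \<beta>" if "0 < s \<and> s \<le> 1" for s
    using that by (intro bochner_fun_C0 [OF u]) auto
  have N: "2 * DIM(real^'d) * enn2real (Cna_norm n \<beta> (u s)) \<le> m s" if "0 < s \<and> s \<le> 1" for s
    using le [of s] that by (simp add: cna_dist_def)
  have N1: "enn2real (Cna_norm n \<beta> (u s)) \<le> m s" if "0 < s \<and> s \<le> 1" for s
  proof -
    have "1 * enn2real (Cna_norm n \<beta> (u s)) \<le> (2 * DIM(real^'d)) * enn2real (Cna_norm n \<beta> (u s))"
      using DIM_positive [where 'a = "real^'d"] by (intro mult_right_mono) (linarith, simp)
    also note N [OF that]
    finally show ?thesis by simp
  qed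
  show ?thesis
  proof (intro vfield.intro vfield_axioms.intro m n \<beta>)
    fix s :: real
    show "jet n (\<lambda>J. field_jet u J s)"
    proof (cases "0 < s \<and> s \<le> 1")
      case True
      then show ?thesis
        using Cn_map_jet [OF C0_space_Cn_map [OF C0 [OF True]]] by (simp add: field_jet_def [abs_def])
    next
      case False
      then have "(\<lambda>J. field_jet u J s) = (\<lambda>J x. 0)" by (auto simp: field_jet_def fun_eq_iff)
      then show ?thesis by (simp add: jet_def)
    qed
    fix J :: "(real^'d) list" assume J: "J \<in> blists n"
    show "(field_jet u J s \<longlongrightarrow> 0) at_infinity"
    proof (cases "0 < s \<and> s \<le> 1")
      case True
      from C0 [OF this] have lim: "((\<lambda>x. mlin_norm (length J) (\<lambda>vs. nderiv (u s) vs x)) \<longlongrightarrow> 0) at_infinity"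
        using J by (auto simp: C0_space_def blists_def)
      have "(nderiv (u s) J \<longlongrightarrow> 0) at_infinity"
        unfolding tendsto_iff
      proof (intro allI impI)
        fix e :: real assume "0 < e"
        then have "\<forall>\<^sub>F x in at_infinity. mlin_norm (length J) (\<lambda>vs. nderiv (u s) vs x) < ennreal e"
          using order_tendstoD(2) [OF lim, of "ennreal e"] by simp
        then show "\<forall>\<^sub>F x in at_infinity. dist (nderiv (u s) J x) 0 < e"
        proof eventually_elim
          case (elim x)
          have "ennreal (norm (nderiv (u s) J x)) \<le> mlin_norm (length J) (\<lambda>vs. nderiv (u s) vs x)"
            using J by (intro mlin_norm_upper) (auto simp: blists_def)
          also note elim
          finally show ?case using \<open>0 < e\<close> by (simp add: ennreal_less_iff)
        qed
      qed
      with True show ?thesis by (simp add: field_jet_def [abs_def])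
    next
      case False
      then have "field_jet u J s = (\<lambda>x. 0)" by (auto simp: field_jet_def fun_eq_iff)
      then show ?thesis by simp
    qed
    fix x y :: "real^'d"
    show "norm (field_jet u J s x) \<le> m s"
    proof (cases "0 < s \<and> s \<le> 1")
      case True
      then have "norm (nderiv (u s) J x) \<le> enn2real (Cna_norm n \<beta> (u s))"
        by (intro norm_jet_le_Cna_norm [OF C0_space_finite [OF C0] J])
      with True N1 [OF True] show ?thesis by (simp add: field_jet_def)
    qed (use m_nonneg [of s] in \<open>auto simp: field_jet_def\<close>)
    show "norm (field_jet u J s x - field_jet u J s y) \<le> m s * norm (x - y) powr \<beta>"
    proof (cases "0 < s \<and> s \<le> 1")
      case True
      have "norm (nderiv (u s) J x - nderiv (u s) J y) \<le>
          2 * DIM(real^'d) * enn2real (Cna_norm n \<beta> (u s)) * norm (x - y) powr \<beta>"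
        using C0 [OF True] J \<beta> by (intro jet_holder C0_space_Cn_map C0_space_finite)
      also have "\<dots> \<le> m s * norm (x - y) powr \<beta>"
        by (intro mult_right_mono N True) auto
      finally show ?thesis using True by (simp add: field_jet_def)
    qed (use m_nonneg [of s] in \<open>auto simp: field_jet_def\<close>)
  qed (rule measurable_field_jet [OF u])
qed

section \<open>The flow equation and uniqueness of its solution\<close>

lemma is_flow_iff:
  "is_flow u \<Phi> \<longleftrightarrow> (\<forall>t\<in>{0..1}. \<forall>x. set_integrable lebesgue {..t} (\<lambda>s. field_jet u [] s (\<Phi> s x)) \<and>
     \<Phi> t x = x + (LINT s:{..t}|lebesgue. field_jet u [] s (\<Phi> s x)))"
proof -
  \<comment> \<open>The two integrands can differ only at s = 0.\<close>
  have AE: "AE s in lebesgue. indicat_real {0..t} s *\<^sub>R u s (\<Phi> s x) = indicat_real {..t} s *\<^sub>R field_jet u [] s (\<Phi> s x)"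
    if "t \<in> {0..1}" for t x
    using AE_not_0 by eventually_elim (use that in \<open>auto simp: field_jet_def indicator_def\<close>)
  show ?thesis
    unfolding is_flow_def set_integrable_def set_lebesgue_integral_def
    using integrable_lebesgue_AE_eq [OF AE] by (intro ball_cong all_cong refl) simp
qed

lemma is_flow_cong:
  assumes "\<And>t x. t \<in> {0..1} \<Longrightarrow> \<Phi> t x = \<Psi> t x"
  shows "is_flow u \<Phi> \<longleftrightarrow> is_flow u \<Psi>"
proof -
  have "set_integrable lebesgue {0..t} (\<lambda>s. u s (\<Phi> s x)) = set_integrable lebesgue {0..t} (\<lambda>s. u s (\<Psi> s x))"
    "(LINT s:{0..t}|lebesgue. u s (\<Phi> s x)) = (LINT s:{0..t}|lebesgue. u s (\<Psi> s x))"
    if "t \<in> {0..1}" for t x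
    unfolding set_integrable_def set_lebesgue_integral_def
    using assms that by (intro Bochner_Integration.integrable_cong Bochner_Integration.integral_cong refl;
        auto simp: indicator_def)+
  then show ?thesis
    using assms unfolding is_flow_def by (intro ball_cong all_cong refl) simp
qed

lemma is_flow_AE_cong:
  fixes u v :: "real \<Rightarrow> real^'d \<Rightarrow> real^'d"
  assumes "AE s in lebesgue_on {0..1}. u s = v s"
  shows "is_flow u \<Phi> \<longleftrightarrow> is_flow v \<Phi>"
proof -
  have "AE s in lebesgue. s \<in> {0..1} \<longrightarrow> u s = v s"
    using assms by (subst (asm) AE_restrict_space_iff) auto
  then have AE: "AE s in lebesgue. indicat_real {0..t} s *\<^sub>R u s (\<Phi> s x) = indicat_real {0..t} s *\<^sub>R v s (\<Phi> s x)"
    if "t \<in> {0..1}" for t x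
    by eventually_elim (use that in \<open>auto simp: indicator_def\<close>)
  show ?thesis
    unfolding is_flow_def set_integrable_def set_lebesgue_integral_def
    using integrable_lebesgue_AE_eq [OF AE] by (intro ball_cong all_cong refl) simp
qed

lemma flow_jet_is_flow:
  assumes "flow_jet m n \<beta> R (field_jet u) \<Phi>"
  shows "is_flow u (\<Phi> [])"
proof -
  interpret flow_jet m n \<beta> R "field_jet u" \<Phi> by fact
  have "set_integrable lebesgue {..t} (\<lambda>s. field_jet u [] s (\<Phi> [] s x))" for t x
    using integrable_rhs [OF adm blists_Nil] by (intro set_integrable_atMost) (simp add: rhs_Nil)
  moreover have "\<Phi> [] t x = x + (LINT s:{..t}|lebesgue. field_jet u [] s (\<Phi> [] s x))" for t x
    using fixpoint [OF blists_Nil, of t x] by (simp add: picard_def rhs_Nil)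
  ultimately show ?thesis unfolding is_flow_iff by blast
qed

text \<open>The competitor carries no regularity in x, so only the Lipschitz bound of order zero is
  available. Both velocities are bounded by \<open>m\<close>, which gives the initial bound 2 *
  \<open>total\<close>; halving with inhomogeneity 0 then forces equality.\<close>

lemma flow_jet_unique:
  fixes u :: "real \<Rightarrow> real^'d \<Rightarrow> real^'d"
  assumes "flow_jet m n \<beta> R (field_jet u) \<Phi>" and \<Psi>: "is_flow u \<Psi>" and t: "t \<in> {0..1}"
  shows "\<Psi> t x = \<Phi> [] t x"
proof -
  interpret flow_jet m n \<beta> R "field_jet u" \<Phi> by fact
  let ?D = "real DIM(real^'d)"
  \<comment> \<open>Outside the unit interval \<Psi> is arbitrary, so the difference is set to 0
    there. The unit argument only fits the indexed form of
    \<open>uniform_halving_bound\<close>.\<close>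
  define f where "f i t = (if t \<in> {0..1} then norm (\<Psi> t x - \<Phi> [] t x) else 0)" for i :: unit and t
  have int\<Psi>: "set_integrable lebesgue {..t} (\<lambda>s. field_jet u [] s (\<Psi> s x))"
    and eq\<Psi>: "\<Psi> t x = x + (LINT s:{..t}|lebesgue. field_jet u [] s (\<Psi> s x))" if "t \<in> {0..1}" for t
    using \<Psi> that unfolding is_flow_iff by blast+
  have int\<Phi>: "set_integrable lebesgue {..t} (\<lambda>s. field_jet u [] s (\<Phi> [] s x))"
    and eq\<Phi>: "\<Phi> [] t x = x + (LINT s:{..t}|lebesgue. field_jet u [] s (\<Phi> [] s x))" if "t \<in> {0..1}" for t
    using flow_jet_is_flow [OF assms(1)] that unfolding is_flow_iff by blast+
  have diff: "norm (\<Psi> t x - \<Phi> [] t x) \<le> (LINT s:{..t}|lebesgue. h s)"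
    if "t \<in> {0..1}" "integrable lebesgue h" "\<And>s. s \<le> t \<Longrightarrow> norm (field_jet u [] s (\<Psi> s x) - field_jet u [] s (\<Phi> [] s x)) \<le> h s"
    for t h
  proof -
    have "\<Psi> t x - \<Phi> [] t x = (LINT s:{..t}|lebesgue. field_jet u [] s (\<Psi> s x) - field_jet u [] s (\<Phi> [] s x))"
      using eq\<Psi> [OF that(1)] eq\<Phi> [OF that(1)] set_integral_diff(2) [OF int\<Psi> [OF that(1)] int\<Phi> [OF that(1)]] by simp
    also have "norm \<dots> \<le> (LINT s:{..t}|lebesgue. h s)"
      using set_integral_diff(1) [OF int\<Psi> [OF that(1)] int\<Phi> [OF that(1)]] set_integrable_atMost [OF that(2)] that(3)
      unfolding set_lebesgue_integral_def set_integrable_def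
      by (intro Bochner_Integration.integral_norm_bound_integral) (auto simp: indicator_def)
    finally show ?thesis .
  qed
  have "f () t \<le> 2 * 0 * weight ?D t"
  proof (rule uniform_halving_bound [where I = UNIV and B = "2 * total" and f = f])
    fix i t
    show "f i t \<le> 2 * total"
    proof (cases "t \<in> {0..1}")
      case True
      have "norm (field_jet u [] s y - field_jet u [] s z) \<le> m s + m s" for s y z
        by (intro order.trans [OF norm_triangle_ineq4] add_mono bound_U blists_Nil)
      then have "norm (\<Psi> t x - \<Phi> [] t x) \<le> (LINT s:{..t}|lebesgue. 2 * m s)"
        by (intro diff True integrable_mult_right integrable_m) simp
      also have "\<dots> \<le> 2 * total"
        using cmass_le_total [of t] by (simp add: cmass_def)
      finally show ?thesis using True by (simp add: f_def)
    qed (auto simp: f_def total_nonneg)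
    fix S :: real assume S: "0 \<le> S" "\<And>i t. i \<in> UNIV \<Longrightarrow> f i t \<le> S * weight ?D t"
    show "f i t \<le> (0 + S / 2) * weight ?D t"
    proof (cases "t \<in> {0..1}")
      case True
      have "norm (field_jet u [] s (\<Psi> s x) - field_jet u [] s (\<Phi> [] s x)) \<le> ?D * (0 + S * weight ?D s) * m s" for s
      proof (cases "s \<in> {0..1}")
        case True
        have "norm (field_jet u [] s (\<Psi> s x) - field_jet u [] s (\<Phi> [] s x)) \<le> ?D * m s * norm (\<Psi> s x - \<Phi> [] s x)"
          by (rule U_lipschitz)
        also have "\<dots> \<le> ?D * m s * (S * weight ?D s)"
          using S(2) [of "()" s] True by (intro mult_left_mono) (auto simp: f_def m_nonneg)
        finally show ?thesis by (simp add: ac_simps)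
      next
        case False
        then have "field_jet u [] s = (\<lambda>x. 0)" by (auto simp: field_jet_def fun_eq_iff)
        then show ?thesis
          using S(1) weight_nonneg [of ?D s] m_nonneg [of s] by simp
      qed
      then have "norm (\<Psi> t x - \<Phi> [] t x) \<le> (LINT s:{..t}|lebesgue. ?D * (0 + S * weight ?D s) * m s)"
        by (intro diff True integrable_weight_combination)
      also have "\<dots> \<le> ?D * 0 * total + S / 2 * weight ?D t"
        using S(1) by (intro LINT_weight_le) auto
      finally show ?thesis using True by (simp add: f_def)
    qed (use S(1) weight_nonneg in \<open>auto simp: f_def\<close>)
  qed (auto simp: total_nonneg)
  with t show ?thesis by (simp add: f_def)
qed

text \<open>A flow of one representative is a flow of all of them, since equality almost everywhere
  leaves the integral equation unchanged. Uniqueness on the unit interval together with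
  extensionality then settles the definite description.\<close>

lemma flow_map_eq:
  fixes U :: "(real \<Rightarrow> real^'d \<Rightarrow> real^'d) set"
  assumes U: "U \<in> bochner_fun n \<beta> // ae_rel n \<beta>" "u \<in> U" and \<Phi>: "flow_jet m n \<beta> R (field_jet u) \<Phi>"
  shows "flow_map U = restrict (\<Phi> []) {0..1}"
  unfolding flow_map_def
proof (rule the_equality)
  have "is_flow v (restrict (\<Phi> []) {0..1})" if "v \<in> U" for v
  proof -
    have "(u, v) \<in> ae_rel n \<beta>"
      using quotient_eq_iff [OF equiv_ae_rel U(1) U(1) U(2) that] by simp
    then have "is_flow u (\<Phi> []) \<longleftrightarrow> is_flow v (\<Phi> [])"
      by (intro is_flow_AE_cong) (simp add: ae_rel_def)
    moreover have "is_flow v (restrict (\<Phi> []) {0..1}) \<longleftrightarrow> is_flow v (\<Phi> [])"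
      by (intro is_flow_cong) simp
    ultimately show ?thesis
      using flow_jet_is_flow [OF \<Phi>] by simp
  qed
  then show "restrict (\<Phi> []) {0..1} \<in> extensional {0..1} \<and> (\<forall>u\<in>U. is_flow u (restrict (\<Phi> []) {0..1}))"
    by simp
next
  fix \<Psi> assume \<Psi>: "\<Psi> \<in> extensional {0..1} \<and> (\<forall>u\<in>U. is_flow u \<Psi>)"
  show "\<Psi> = restrict (\<Phi> []) {0..1}"
  proof (rule extensionalityI [of _ "{0..1}"])
    fix t :: real assume "t \<in> {0..1}"
    then show "\<Psi> t = restrict (\<Phi> []) {0..1} t"
      using flow_jet_unique [OF \<Phi>] \<Psi> U(2) by (simp add: fun_eq_iff)
  qed (use \<Psi> in auto)
qed

section \<open>The flow map\<close>

text \<open>\<rho> is the distance at which the two bounds meet. For |x - y| \<le> \<rho> the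
  Hoelder bound is split as r^(\<beta> - \<alpha>) * r^\<alpha>; beyond \<rho> the supremum bound is
  used at both points, whence the factor 2. Callers choose \<rho> so that \<rho>^\<beta> is the size
  of their supremum bound.\<close>

lemma Cna_norm_interpolate:
  fixes g :: "'a::euclidean_space list \<Rightarrow> 'a \<Rightarrow> 'b::real_normed_vector"
  assumes g: "jet n g" and \<alpha>: "0 < \<alpha>" "\<alpha> < \<beta>" and A: "0 \<le> A" and \<rho>: "0 \<le> \<rho>" "\<rho> \<le> 1"
    and g0: "\<And>J x. J \<in> blists n \<Longrightarrow> norm (g J x) \<le> A * \<rho> powr \<beta>"
    and g1: "\<And>J x y. J \<in> blists n \<Longrightarrow> norm (g J x - g J y) \<le> A * norm (x - y) powr \<beta>"
  shows "Cna_norm n \<alpha> (g []) \<le> ennreal (card (blists n :: 'a list set) * (2 * A * \<rho> powr (\<beta> - \<alpha>)))"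
proof (rule Cna_norm_jet_le [OF g])
  fix J :: "'a list" and x y assume J: "J \<in> blists n"
  have "norm (g J x) \<le> A * \<rho> powr \<beta>" by (rule g0 [OF J])
  also have "\<dots> \<le> (2 * A) * \<rho> powr (\<beta> - \<alpha>)"
    using \<rho> \<alpha> A powr_mono' [of "\<beta> - \<alpha>" \<beta> \<rho>] by (intro mult_mono) auto
  finally show "norm (g J x) \<le> 2 * A * \<rho> powr (\<beta> - \<alpha>)" .
  let ?r = "norm (x - y)"
  show "norm (g J x - g J y) \<le> 2 * A * \<rho> powr (\<beta> - \<alpha>) * ?r powr \<alpha>"
  proof (cases "?r \<le> \<rho>")
    case True
    have "norm (g J x - g J y) \<le> A * ?r powr \<beta>" by (rule g1 [OF J])
    also have "\<dots> = A * (?r powr (\<beta> - \<alpha>) * ?r powr \<alpha>)" by (simp flip: powr_add)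
    also have "\<dots> \<le> (2 * A) * (\<rho> powr (\<beta> - \<alpha>) * ?r powr \<alpha>)"
      using True \<alpha> A by (intro mult_mono powr_mono2) auto
    finally show ?thesis by (simp add: ac_simps)
  next
    case False
    have "norm (g J x - g J y) \<le> A * \<rho> powr \<beta> + A * \<rho> powr \<beta>"
      by (intro order.trans [OF norm_triangle_ineq4] add_mono g0 J)
    also have "\<dots> = 2 * A * (\<rho> powr (\<beta> - \<alpha>) * \<rho> powr \<alpha>)" by (simp flip: powr_add)
    also have "\<dots> \<le> 2 * A * (\<rho> powr (\<beta> - \<alpha>) * ?r powr \<alpha>)"
      using False \<alpha> \<rho> A by (intro mult_left_mono powr_mono2) auto
    finally show ?thesis by (simp add: ac_simps)
  qed
qed

context flow_jet
begin

lemma jet_flow_minus_id: "jet n (\<lambda>J x. \<Phi> J t x - idjet J x)"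
  by (intro jet_diff jet_flow jet_idjet)

lemma flow_C0_space:
  assumes \<alpha>: "0 < \<alpha>" "\<alpha> < \<beta>"
  shows "(\<lambda>x. \<Phi> [] t x - x) \<in> C0_space n \<alpha>"
proof -
  let ?g = "\<lambda>J x. \<Phi> J t x - idjet J x"
  note jet = jet_flow_minus_id [of t]
  have "?g [] \<in> C0_space n \<alpha>"
    unfolding C0_space_def mem_Collect_eq
  proof (intro conjI allI impI)
    show "Cn_map n (?g [])" by (rule jet_Cn_map [OF jet])
    let ?A = "\<bar>rhs_const TYPE('a) n R * R\<bar> + \<bar>holder_const TYPE('a) n \<beta> R\<bar>"
    \<comment> \<open>With \<rho> = 1 the interpolation is merely the embedding from exponent
      \<beta> into exponent \<alpha>.\<close>
    have "Cna_norm n \<alpha> (?g []) \<le> ennreal (card (blists n :: 'a list set) * (2 * ?A * 1 powr (\<beta> - \<alpha>)))"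
    proof (rule Cna_norm_interpolate [OF jet \<alpha>])
      fix J :: "'a list" and x y assume J: "J \<in> blists n"
      show "norm (?g J x) \<le> ?A * 1 powr \<beta>"
        using flow_minus_id_le [OF J, of t x] by simp
      have "norm (?g J x - ?g J y) \<le> holder_const TYPE('a) n \<beta> R * norm (x - y) powr \<beta>"
        by (rule flow_holder [OF J])
      also have "\<dots> \<le> ?A * norm (x - y) powr \<beta>"
        by (intro mult_right_mono) auto
      finally show "norm (?g J x - ?g J y) \<le> ?A * norm (x - y) powr \<beta>" .
    qed auto
    also have "\<dots> < \<infinity>" by simp
    finally show "Cna_norm n \<alpha> (?g []) < \<infinity>" .
    fix l assume l: "l \<le> n"
    have "((\<lambda>x. \<Sum>J\<in>blists_eq l. norm (?g J x)) \<longlongrightarrow> (\<Sum>J\<in>(blists_eq l :: 'a list set). 0)) at_infinity"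
      using blists_eq_subset [OF l] by (intro tendsto_sum tendsto_norm_zero flow_decay) auto
    then have "((\<lambda>x. ennreal (\<Sum>J\<in>blists_eq l. norm (?g J x))) \<longlongrightarrow> 0) at_infinity"
      using tendsto_ennrealI by fastforce
    then show "((\<lambda>x. mlin_norm l (\<lambda>vs. nderiv (?g []) vs x)) \<longlongrightarrow> 0) at_infinity"
      by (rule tendsto_sandwich [OF _ _ tendsto_const, rotated 2])
        (use mlin_norm_jet_le [OF jet l] in auto)
  qed
  then show ?thesis by simp
qed

text \<open>All derivatives are Lipschitz in the accumulated mass, without the loss to the power
  \<beta> seen in \<open>flow_diff\<close>. So \<rho>^\<beta> equals the mass increment, which
  explains the exponent (\<beta> - \<alpha>) / \<beta>. The Hoelder constant counts twice, once for
  each time.\<close>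

lemma flow_time_diff_Cna_le:
  assumes \<alpha>: "0 < \<alpha>" "\<alpha> < \<beta>" and st: "s \<le> t" "cmass t - cmass s \<le> 1"
  shows "Cna_norm n \<alpha> (\<lambda>x. \<Phi> [] t x - \<Phi> [] s x) \<le>
    ennreal (card (blists n :: 'a list set) *
      (2 * (rhs_const TYPE('a) n R + 2 * \<bar>holder_const TYPE('a) n \<beta> R\<bar>) * (cmass t - cmass s) powr ((\<beta> - \<alpha>) / \<beta>)))"
proof -
  let ?C = "rhs_const TYPE('a) n R" and ?H = "holder_const TYPE('a) n \<beta> R"
  let ?\<Delta> = "cmass t - cmass s" and ?g = "\<lambda>J x. \<Phi> J t x - \<Phi> J s x"
  define \<rho> where "\<rho> = ?\<Delta> powr (1 / \<beta>)"
  have \<Delta>: "0 \<le> ?\<Delta>" using cmass_mono [OF st(1)] by simp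
  have \<rho>: "0 \<le> \<rho>" "\<rho> \<le> 1" "\<rho> powr \<beta> = ?\<Delta>" "\<rho> powr (\<beta> - \<alpha>) = ?\<Delta> powr ((\<beta> - \<alpha>) / \<beta>)"
    using \<Delta> st(2) \<beta> powr_mono2 [of "1 / \<beta>" ?\<Delta> 1] by (auto simp: \<rho>_def powr_powr)
  have "Cna_norm n \<alpha> (?g []) \<le>
      ennreal (card (blists n :: 'a list set) * (2 * (?C + 2 * \<bar>?H\<bar>) * \<rho> powr (\<beta> - \<alpha>)))"
  proof (rule Cna_norm_interpolate [OF _ \<alpha>])
    show "jet n ?g" by (intro jet_diff jet_flow)
    fix J :: "'a list" and x y assume J: "J \<in> blists n"
    have "norm (?g J x) \<le> ?C * ?\<Delta>"
      by (rule flow_time_diff_le [OF J st(1)])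
    also have "\<dots> \<le> (?C + 2 * \<bar>?H\<bar>) * \<rho> powr \<beta>"
      unfolding \<rho>(3) using \<Delta> by (intro mult_right_mono) auto
    finally show "norm (?g J x) \<le> (?C + 2 * \<bar>?H\<bar>) * \<rho> powr \<beta>" .
    have "?g J x - ?g J y = ((\<Phi> J t x - idjet J x) - (\<Phi> J t y - idjet J y)) - ((\<Phi> J s x - idjet J x) - (\<Phi> J s y - idjet J y))"
      by simp
    also have "norm \<dots> \<le> ?H * norm (x - y) powr \<beta> + ?H * norm (x - y) powr \<beta>"
      by (intro order.trans [OF norm_triangle_ineq4] add_mono flow_holder J)
    also have "\<dots> = (2 * ?H) * norm (x - y) powr \<beta>" by simp
    also have "\<dots> \<le> (?C + 2 * \<bar>?H\<bar>) * norm (x - y) powr \<beta>"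
      using rhs_const_nonneg by (intro mult_right_mono) auto
    finally show "norm (?g J x - ?g J y) \<le> (?C + 2 * \<bar>?H\<bar>) * norm (x - y) powr \<beta>" .
  qed (use \<rho> rhs_const_nonneg in auto)
  then show ?thesis by (simp only: \<rho>(4))
qed

end

section \<open>Flows as continuous paths in the diffeomorphism group\<close>

lemma flow_det_pos:
  fixes U :: "(real^'d) list \<Rightarrow> real \<Rightarrow> real^'d \<Rightarrow> real^'d"
  assumes "flow_jet m n \<beta> R U \<Phi>"
  shows "det (jacobian (\<Phi> [] t) (at x)) > 0"
proof -
  interpret flow_jet m n \<beta> R U \<Phi> by fact
  define L where "L t v = (\<Sum>j\<in>Basis. (v \<bullet> j) *\<^sub>R \<Phi> [j] t x)" for t v
  have j: "[j] \<in> blists n" if "j \<in> Basis" for j :: "real^'d"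
    using that n_pos by (simp add: blists_def)
  have der: "(\<Phi> [] t has_derivative L t) (at x)" for t
    using jet_derivative [OF jet_flow blists_Nil, of t x] n_pos by (simp add: L_def [abs_def])
  have lin: "linear (L t)" for t
    using der by (rule has_derivative_linear)
  have jac: "jacobian (\<Phi> [] t) (at x) = matrix (L t)" for t
    unfolding jacobian_def using frechet_derivative_at [OF der, symmetric] by simp
  have nz: "det (matrix (L t)) \<noteq> 0" for t
    using flow_derivative_nonzero [of _ t x]
    by (auto simp: det_nz_iff_inj [OF lin] linear_injective_0 [OF lin] L_def)
  have one: "det (matrix (L t)) = 1" if "t \<le> 0" for t
  proof -
    have "L t = (\<lambda>v. v)"
      using that by (auto simp: L_def flow_0 j euclidean_representation)
    then show ?thesis by (simp add: matrix_id_mat_1 [unfolded id_def])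
  qed
  have "continuous_on UNIV (\<lambda>t. L t v)" for v
    unfolding L_def by (intro continuous_on_sum continuous_on_scaleR continuous_on_const continuous_flow j)
  then have cont: "continuous_on S (\<lambda>t. det (matrix (L t)))" for S
    unfolding det_def matrix_def
    by (auto intro!: continuous_intros continuous_on_subset [of UNIV _ S] continuous_on_component)
  have "det (matrix (L t)) > 0"
  proof (rule ccontr)
    assume "\<not> det (matrix (L t)) > 0"
    then have neg: "det (matrix (L t)) \<le> 0" "0 \<le> t"
      using one [of t] by (auto simp: not_less) (cases "t \<le> 0"; simp)
    then have "\<exists>s\<ge>0. s \<le> t \<and> det (matrix (L s)) = 0"
      by (intro IVT2' cont) (auto simp: one)
    with nz show False by blast
  qed
  then show ?thesis by (simp only: jac)
qed

lemma mspace_diff_metric: "mspace (diff_metric n \<alpha>) = diff_group n \<alpha>"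
  and mdist_diff_metric: "mdist (diff_metric n \<alpha>) = diff_dist n \<alpha>"
  by (simp_all add: diff_metric_def Metric_space.mspace_metric [OF Metric_space_diff_group]
      Metric_space.mdist_metric [OF Metric_space_diff_group])

lemma mspace_L1_metric: "mspace (L1_metric n \<beta>) = bochner_fun n \<beta> // ae_rel n \<beta>"
  and mdist_L1_metric: "mdist (L1_metric n \<beta>) = L1_dist n \<beta>"
  by (simp_all add: L1_metric_def Metric_space.mspace_metric [OF Metric_space_L1]
      Metric_space.mdist_metric [OF Metric_space_L1])

lemma flow_diff_group:
  assumes "flow_jet m n \<beta> R U \<Phi>" "0 < \<alpha>" "\<alpha> < \<beta>"
  shows "\<Phi> [] t \<in> diff_group n \<alpha>"
  using flow_jet.flow_C0_space [OF assms] flow_det_pos [OF assms(1)] by (simp add: diff_group_def)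

lemma diff_dist_le:
  assumes "f \<in> diff_group n \<alpha>" "g \<in> diff_group n \<alpha>" "Cna_norm n \<alpha> (\<lambda>x. f x - g x) \<le> ennreal c" "0 \<le> c"
  shows "diff_dist n \<alpha> f g \<le> c"
  using assms by (simp add: diff_dist_def enn2real_leI)

lemma flow_in_path_metric:
  assumes \<Phi>: "flow_jet m n \<beta> R U \<Phi>" and \<alpha>: "0 < \<alpha>" "\<alpha> < \<beta>"
  shows "restrict (\<Phi> []) {0..1} \<in> mspace (path_metric n \<alpha>)"
proof -
  interpret flow_jet m n \<beta> R U \<Phi> by fact
  interpret D: Metric_space "diff_group n \<alpha>" "diff_dist n \<alpha>" by (rule Metric_space_diff_group)
  let ?X = "top_of_set {0..1::real}"
  note grp = flow_diff_group [OF \<Phi> \<alpha>]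
  define c where "c = card (blists n :: (real^'a) list set) *
    (2 * (rhs_const TYPE(real^'a) n R + 2 * \<bar>holder_const TYPE(real^'a) n \<beta> R\<bar>))"
  have c: "0 \<le> c" using rhs_const_nonneg by (simp add: c_def)
  have dist: "diff_dist n \<alpha> (\<Phi> [] s) (\<Phi> [] t) \<le> c * \<bar>cmass t - cmass s\<bar> powr ((\<beta> - \<alpha>) / \<beta>)"
    if "\<bar>cmass t - cmass s\<bar> \<le> 1" for s t
  proof -
    have *: "diff_dist n \<alpha> (\<Phi> [] t) (\<Phi> [] s) \<le> c * \<bar>cmass t - cmass s\<bar> powr ((\<beta> - \<alpha>) / \<beta>)"
      if "s \<le> t" "\<bar>cmass t - cmass s\<bar> \<le> 1" for s t
    proof (rule diff_dist_le [OF grp grp])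
      show "Cna_norm n \<alpha> (\<lambda>x. \<Phi> [] t x - \<Phi> [] s x) \<le> ennreal (c * \<bar>cmass t - cmass s\<bar> powr ((\<beta> - \<alpha>) / \<beta>))"
        using flow_time_diff_Cna_le [OF \<alpha> that(1)] that(2) cmass_mono [OF that(1)] by (simp add: c_def ac_simps)
    qed (use c in simp)
    show ?thesis
    proof (cases "s \<le> t")
      case True
      then show ?thesis using * [OF True that] by (simp add: D.commute)
    next
      case False
      then show ?thesis using * [of t s] that by (simp add: abs_minus_commute)
    qed
  qed
  have "continuous_map ?X D.mtopology (\<Phi> [])"
    unfolding D.continuous_map_to_metric
  proof (intro ballI allI impI)
    fix s and e :: real assume s: "s \<in> topspace ?X" and e: "0 < e"
    \<comment> \<open>h t < 1 expresses both requirements at once: small mass difference, so that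
      \<open>dist\<close> applies, and a distance bound below e. A single open preimage then
      suffices.\<close>
    define h where "h t = max \<bar>cmass t - cmass s\<bar> (c * \<bar>cmass t - cmass s\<bar> powr ((\<beta> - \<alpha>) / \<beta>) / e)" for t
    have "continuous_on {0..1} h"
      unfolding h_def using \<alpha> \<beta> e
      by (intro continuous_on_max continuous_intros continuous_cmass continuous_on_powr') auto
    then have "openin ?X ({0..1} \<inter> h -` {..<1})"
      by (intro continuous_openin_preimage_gen) auto
    moreover have "s \<in> {0..1} \<inter> h -` {..<1}"
      using s by (simp add: h_def)
    moreover have "\<Phi> [] t \<in> D.mball (\<Phi> [] s) e" if "t \<in> {0..1} \<inter> h -` {..<1}" for t
    proof -
      from that have "\<bar>cmass t - cmass s\<bar> \<le> 1" "c * \<bar>cmass t - cmass s\<bar> powr ((\<beta> - \<alpha>) / \<beta>) < e"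
        using e by (auto simp: h_def)
      with dist [of t s] show ?thesis by (simp add: grp)
    qed
    ultimately show "\<exists>W. openin ?X W \<and> s \<in> W \<and> (\<forall>t\<in>W. \<Phi> [] t \<in> D.mball (\<Phi> [] s) e)" by blast
  qed
  then have "continuous_map ?X (mtopology_of (diff_metric n \<alpha>)) (restrict (\<Phi> []) {0..1})"
    unfolding diff_metric_def D.mtopology_of by (rule continuous_map_eq) simp
  \<comment> \<open>Boundedness, which membership in \<open>cfunspace\<close> includes, comes from
    compactness of the unit interval.\<close>
  moreover have "compactin ?X (topspace ?X)" by (simp add: compactin_subtopology)
  ultimately show ?thesis
    unfolding path_metric_def
    by (subst compactin_mspace_cfunspace) (auto simp: mspace_diff_metric grp)
qed

text \<open>The sum of the two densities dominates both fields, so their flows live over the same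
  mass, weights and constants, as \<open>flow_diff\<close> demands.\<close>

lemma flow_jets_exist:
  fixes u v :: "real \<Rightarrow> real^'d \<Rightarrow> real^'d"
  assumes uv: "u \<in> bochner_fun n \<beta>" "v \<in> bochner_fun n \<beta>" and n: "1 \<le> n" and \<beta>: "0 < \<beta>" "\<beta> \<le> 1"
    and R: "2 * DIM(real^'d) * (fun_dist n \<beta> u (\<lambda>t x. 0) + fun_dist n \<beta> v (\<lambda>t x. 0)) \<le> R"
  obtains m \<Phi> \<Psi> where "flow_jet m n \<beta> R (field_jet u) \<Phi>" "flow_jet m n \<beta> R (field_jet v) \<Psi>"
proof -
  let ?D = "2 * real DIM(real^'d)"
  define m where "m s = ?D * cna_dist n \<beta> u (\<lambda>t x. 0) s + ?D * cna_dist n \<beta> v (\<lambda>t x. 0) s" for s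
  note int = integrable_cna_dist [OF uv(1) zero_bochner_fun] integrable_cna_dist [OF uv(2) zero_bochner_fun]
  have m: "mass m"
  proof
    show "integrable lebesgue m"
      unfolding m_def by (intro Bochner_Integration.integrable_add integrable_mult_right int)
    show "0 \<le> m s" "s \<le> 0 \<Longrightarrow> m s = 0" for s
      by (auto simp: m_def cna_dist_nonneg) (simp_all add: cna_dist_def)
  qed
  have "mass.total m = (LINT s|lebesgue. m s)"
    by (rule mass.total_def [OF m])
  also have "\<dots> = ?D * (fun_dist n \<beta> u (\<lambda>t x. 0) + fun_dist n \<beta> v (\<lambda>t x. 0))"
    unfolding m_def using int
    by (subst Bochner_Integration.integral_add)
      (simp_all add: LINT_cna_dist [OF uv(1) zero_bochner_fun] LINT_cna_dist [OF uv(2) zero_bochner_fun] distrib_left)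
  finally have tot: "mass.total m \<le> R" using R by simp
  have le: "2 * DIM(real^'d) * cna_dist n \<beta> u (\<lambda>t x. 0) s \<le> m s"
    "2 * DIM(real^'d) * cna_dist n \<beta> v (\<lambda>t x. 0) s \<le> m s" for s
    by (auto simp: m_def cna_dist_nonneg)
  obtain \<Phi> where "flow_jet m n \<beta> R (field_jet u) \<Phi>"
    using vfield.flow_jet_exists [OF vfield_field_jet [OF uv(1) m tot le(1) n \<beta>]] by blast
  moreover obtain \<Psi> where "flow_jet m n \<beta> R (field_jet v) \<Psi>"
    using vfield.flow_jet_exists [OF vfield_field_jet [OF uv(2) m tot le(2) n \<beta>]] by blast
  ultimately show thesis by (rule that)
qed

section \<open>Local Hoelder continuity of the flow map\<close>

definition flow_const :: "'a::euclidean_space itself \<Rightarrow> nat \<Rightarrow> real \<Rightarrow> real \<Rightarrow> real" where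
  "flow_const T n \<beta> R = card (blists n :: 'a list set) * (2 * (\<bar>diff_const T n \<beta> R\<bar> + 2 * \<bar>holder_const T n \<beta> R\<bar>))"

text \<open>Interpolation with \<rho> equal to the distance of the fields, since
  \<open>flow_diff\<close> bounds the supremum by a multiple of its power \<beta>.\<close>

lemma flow_dist_le:
  fixes u v :: "real \<Rightarrow> real^'d \<Rightarrow> real^'d"
  assumes \<Phi>: "flow_jet m n \<beta> R (field_jet u) \<Phi>" and \<Psi>: "flow_jet m n \<beta> R (field_jet v) \<Psi>"
    and \<alpha>: "0 < \<alpha>" "\<alpha> < \<beta>" and uv: "u \<in> bochner_fun n \<beta>" "v \<in> bochner_fun n \<beta>"
    and d: "fun_dist n \<beta> u v \<le> 1"
  shows "mdist (diff_metric n \<alpha>) (\<Phi> [] t) (\<Psi> [] t) \<le> flow_const TYPE(real^'d) n \<beta> R * fun_dist n \<beta> u v powr (\<beta> - \<alpha>)"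
proof -
  interpret U: flow_jet m n \<beta> R "field_jet u" \<Phi> by fact
  interpret V: flow_jet m n \<beta> R "field_jet v" \<Psi> by fact
  let ?E = "diff_const TYPE(real^'d) n \<beta> R" and ?H = "holder_const TYPE(real^'d) n \<beta> R"
  let ?g = "\<lambda>J x. \<Phi> J t x - \<Psi> J t x" and ?d = "fun_dist n \<beta> u v"
  have d0: "0 \<le> ?d" by (simp add: fun_dist_def)
  have diff: "norm (field_jet u I s x - field_jet v I s x) \<le> cna_dist n \<beta> u v s" if I: "I \<in> blists n" for I s x
    using norm_nderiv_diff_le [OF bochner_fun_C0 [OF uv(1), of s] bochner_fun_C0 [OF uv(2), of s] I, of x]
    by (auto simp: field_jet_def cna_dist_def)
  have "Cna_norm n \<alpha> (?g []) \<le> ennreal (card (blists n :: (real^'d) list set) *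
      (2 * (\<bar>?E\<bar> + 2 * \<bar>?H\<bar>) * ?d powr (\<beta> - \<alpha>)))"
  proof (rule Cna_norm_interpolate [OF _ \<alpha>])
    show "jet n ?g" by (intro jet_diff U.jet_flow V.jet_flow)
    fix J :: "(real^'d) list" and x y assume J: "J \<in> blists n"
    have "norm (?g J x) \<le> ?E * ?d powr \<beta>"
      by (rule flow_diff [OF \<Phi> \<Psi> integrable_cna_dist [OF uv] cna_dist_nonneg diff LINT_cna_dist [OF uv] d J])
    also have "\<dots> \<le> (\<bar>?E\<bar> + 2 * \<bar>?H\<bar>) * ?d powr \<beta>"
      by (intro mult_right_mono) auto
    finally show "norm (?g J x) \<le> (\<bar>?E\<bar> + 2 * \<bar>?H\<bar>) * ?d powr \<beta>" .
    have "?g J x - ?g J y = ((\<Phi> J t x - idjet J x) - (\<Phi> J t y - idjet J y)) - ((\<Psi> J t x - idjet J x) - (\<Psi> J t y - idjet J y))"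
      by simp
    also have "norm \<dots> \<le> ?H * norm (x - y) powr \<beta> + ?H * norm (x - y) powr \<beta>"
      by (intro order.trans [OF norm_triangle_ineq4] add_mono U.flow_holder V.flow_holder J)
    also have "\<dots> = (2 * ?H) * norm (x - y) powr \<beta>" by simp
    also have "\<dots> \<le> (\<bar>?E\<bar> + 2 * \<bar>?H\<bar>) * norm (x - y) powr \<beta>"
      by (intro mult_right_mono) auto
    finally show "norm (?g J x - ?g J y) \<le> (\<bar>?E\<bar> + 2 * \<bar>?H\<bar>) * norm (x - y) powr \<beta>" .
  qed (use d0 d in auto)
  then show ?thesis
    unfolding mdist_diff_metric
    by (intro diff_dist_le flow_diff_group [OF \<Phi> \<alpha>] flow_diff_group [OF \<Psi> \<alpha>]) (auto simp: flow_const_def ac_simps)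
qed

lemma flow_const_nonneg: "0 \<le> flow_const T n \<beta> R"
  by (simp add: flow_const_def)

lemma L1_representative:
  assumes "U \<in> bochner_fun n \<beta> // ae_rel n \<beta>"
  obtains u where "u \<in> U" "u \<in> bochner_fun n \<beta>"
  using assms equiv_class_self [OF equiv_ae_rel [of n \<beta>]] by (auto elim!: quotientE)

lemma flow_map_in_path_metric:
  fixes U :: "(real \<Rightarrow> real^'d \<Rightarrow> real^'d) set"
  assumes U: "U \<in> bochner_fun n \<beta> // ae_rel n \<beta>" and n: "1 \<le> n" and \<alpha>: "0 < \<alpha>" "\<alpha> < \<beta>" "\<beta> \<le> 1"
  shows "flow_map U \<in> mspace (path_metric n \<alpha>)"
proof -
  obtain u where u: "u \<in> U" "u \<in> bochner_fun n \<beta>" using L1_representative [OF U] .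
  have \<beta>: "0 < \<beta>" using \<alpha> by simp
  obtain m \<Phi> R where "flow_jet m n \<beta> R (field_jet u) \<Phi>"
    using flow_jets_exist [OF u(2) u(2) n \<beta> \<alpha>(3) order.refl] by blast
  with flow_map_eq [OF U u(1) this] show ?thesis
    using flow_in_path_metric \<alpha> by metis
qed

lemma locally_holder_map_imp_continuous_map:
  assumes "locally_holder_map \<gamma> m1 m2 T" and \<gamma>: "0 < \<gamma>"
  shows "continuous_map (mtopology_of m1) (mtopology_of m2) T"
proof -
  interpret m1: Metric_space "mspace m1" "mdist m1" by (rule Metric_space_mspace_mdist)
  interpret m2: Metric_space "mspace m2" "mdist m2" by (rule Metric_space_mspace_mdist)
  have T: "T ` mspace m1 \<subseteq> mspace m2" using assms(1) by (simp add: locally_holder_map_def)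
  have "continuous_map m1.mtopology m2.mtopology T"
    unfolding m1.metric_continuous_map [OF m2.Metric_space_axioms]
  proof (intro conjI T ballI allI impI)
    fix w and e :: real assume w: "w \<in> mspace m1" and e: "0 < e"
    obtain N C where N: "openin m1.mtopology N" "w \<in> N"
      and C: "\<And>u v. u \<in> N \<Longrightarrow> v \<in> N \<Longrightarrow> u \<noteq> v \<Longrightarrow> mdist m2 (T u) (T v) / mdist m1 u v powr \<gamma> \<le> C"
      using assms(1) w unfolding locally_holder_map_def mtopology_of_def by metis
    obtain r where r: "0 < r" "m1.mball w r \<subseteq> N"
      using N m1.openin_mtopology by blast
    \<comment> \<open>A positive constant is needed for the radius (e / D)^(1 / \<gamma>), while C
      might be 0 or negative.\<close>
    define D where "D = max C 1"
    have D: "0 < D" "C \<le> D" by (auto simp: D_def)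
    show "\<exists>\<delta>>0. \<forall>x. x \<in> mspace m1 \<and> mdist m1 w x < \<delta> \<longrightarrow> mdist m2 (T w) (T x) < e"
    proof (intro exI conjI allI impI)
      show "0 < min r ((e / D) powr (1 / \<gamma>))" using r e D by simp
      fix x assume x: "x \<in> mspace m1 \<and> mdist m1 w x < min r ((e / D) powr (1 / \<gamma>))"
      then have "x \<in> N" using r w by auto
      show "mdist m2 (T w) (T x) < e"
      proof (cases "x = w")
        case True
        then show ?thesis using w T e by (simp add: image_subset_iff)
      next
        case False
        then have pos: "0 < mdist m1 w x" using w x by (auto simp: less_le)
        then have "mdist m2 (T w) (T x) / mdist m1 w x powr \<gamma> \<le> D"
          using C [OF N(2) \<open>x \<in> N\<close>] False D by auto
        then have "mdist m2 (T w) (T x) \<le> D * mdist m1 w x powr \<gamma>"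
          using pos by (simp add: pos_divide_le_eq)
        also have "mdist m1 w x powr \<gamma> < ((e / D) powr (1 / \<gamma>)) powr \<gamma>"
          using x \<gamma> by (intro powr_less_mono2) auto
        also have "((e / D) powr (1 / \<gamma>)) powr \<gamma> = e / D"
          using e D \<gamma> by (simp add: powr_powr)
        finally show ?thesis using D by simp
      qed
    qed
  qed
  then show ?thesis by (simp add: mtopology_of_def)
qed

theorem theorem5p6:
  fixes n :: nat and \<alpha> \<beta> :: real
  assumes "n \<ge> 2" and "0 < \<alpha>" and "\<alpha> < \<beta>" and "\<beta> \<le> 1"
  shows "continuous_map (mtopology_of (L1_metric n \<beta>)) (mtopology_of (path_metric n \<alpha>))
           (flow_map :: (real \<Rightarrow> real^'d \<Rightarrow> real^'d) set \<Rightarrow> (real \<Rightarrow> real^'d \<Rightarrow> real^'d))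
       \<and> locally_holder_map (\<beta> - \<alpha>) (L1_metric n \<beta>) (path_metric n \<alpha>)
           (flow_map :: (real \<Rightarrow> real^'d \<Rightarrow> real^'d) set \<Rightarrow> (real \<Rightarrow> real^'d \<Rightarrow> real^'d))"
proof -
  let ?Q = "bochner_fun n \<beta> // ae_rel n \<beta> :: (real \<Rightarrow> real^'d \<Rightarrow> real^'d) set set"
  let ?z = "\<lambda>t x. 0 :: real^'d"
  interpret L1: Metric_space ?Q "L1_dist n \<beta>" by (rule Metric_space_L1)
  have n: "1 \<le> n" and \<beta>: "0 < \<beta>" using assms by auto
  have "locally_holder_map (\<beta> - \<alpha>) (L1_metric n \<beta>) (path_metric n \<alpha>)
      (flow_map :: (real \<Rightarrow> real^'d \<Rightarrow> real^'d) set \<Rightarrow> (real \<Rightarrow> real^'d \<Rightarrow> real^'d))"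
    unfolding locally_holder_map_def mspace_L1_metric mdist_L1_metric
  proof (intro conjI ballI)
    show "flow_map ` ?Q \<subseteq> mspace (path_metric n \<alpha>)"
      using flow_map_in_path_metric n assms by blast
    fix W assume W: "W \<in> ?Q"
    obtain w where w: "w \<in> W" "w \<in> bochner_fun n \<beta>" using L1_representative [OF W] .
    \<comment> \<open>Twice DIM times the sum of two norms, each at most the norm of w plus the
      radius. Radius 1/2 also keeps any two fields of the ball within distance 1, as required by
      \<open>flow_dist_le\<close>.\<close>
    define R where "R = 4 * real DIM(real^'d) * (fun_dist n \<beta> w ?z + 1 / 2)"
    have holder: "mdist (path_metric n \<alpha>) (flow_map U) (flow_map V) / L1_dist n \<beta> U V powr (\<beta> - \<alpha>) \<le>
        flow_const TYPE(real^'d) n \<beta> R"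
      if U: "U \<in> L1.mball W (1 / 2)" and V: "V \<in> L1.mball W (1 / 2)" for U V
    proof -
      have Q: "U \<in> ?Q" "V \<in> ?Q" using U V by auto
      obtain u where u: "u \<in> U" "u \<in> bochner_fun n \<beta>" using L1_representative [OF Q(1)] .
      obtain v where v: "v \<in> V" "v \<in> bochner_fun n \<beta>" using L1_representative [OF Q(2)] .
      have wu: "fun_dist n \<beta> w u < 1 / 2" and wv: "fun_dist n \<beta> w v < 1 / 2"
        using U V L1_dist_eq [OF W Q(1) w(1) u(1)] L1_dist_eq [OF W Q(2) w(1) v(1)] by auto
      have d: "fun_dist n \<beta> u v \<le> 1"
        using fun_dist_triangle [OF u(2) w(2) v(2)] fun_dist_commute [OF u(2) w(2)] wu wv by simp
      have "fun_dist n \<beta> u ?z \<le> fun_dist n \<beta> w ?z + 1 / 2"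
        using fun_dist_triangle [OF u(2) w(2) zero_bochner_fun] fun_dist_commute [OF u(2) w(2)] wu by simp
      moreover have "fun_dist n \<beta> v ?z \<le> fun_dist n \<beta> w ?z + 1 / 2"
        using fun_dist_triangle [OF v(2) w(2) zero_bochner_fun] fun_dist_commute [OF v(2) w(2)] wv by simp
      ultimately have "2 * DIM(real^'d) * (fun_dist n \<beta> u ?z + fun_dist n \<beta> v ?z) \<le>
          2 * DIM(real^'d) * (2 * (fun_dist n \<beta> w ?z + 1 / 2))"
        by (intro mult_left_mono) auto
      then have R: "2 * DIM(real^'d) * (fun_dist n \<beta> u ?z + fun_dist n \<beta> v ?z) \<le> R"
        by (simp add: R_def)
      obtain m \<Phi> \<Psi> where \<Phi>: "flow_jet m n \<beta> R (field_jet u) \<Phi>" and \<Psi>: "flow_jet m n \<beta> R (field_jet v) \<Psi>"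
        using flow_jets_exist [OF u(2) v(2) n \<beta> assms(4) R] .
      let ?c = "flow_const TYPE(real^'d) n \<beta> R" and ?d = "fun_dist n \<beta> u v powr (\<beta> - \<alpha>)"
      have "mdist (path_metric n \<alpha>) (flow_map U) (flow_map V) \<le> ?c * ?d"
        unfolding path_metric_def flow_map_eq [OF Q(1) u(1) \<Phi>] flow_map_eq [OF Q(2) v(1) \<Psi>]
        using flow_dist_le [OF \<Phi> \<Psi> assms(2,3) u(2) v(2) d]
        by (intro mdist_cfunspace_le mult_nonneg_nonneg flow_const_nonneg) auto
      \<comment> \<open>The case U = V is included; there the quotient has the default value
        0.\<close>
      then show ?thesis
        unfolding L1_dist_eq [OF Q u(1) v(1)]
        by (cases "?d = 0") (simp_all add: flow_const_nonneg pos_divide_le_eq less_le)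
    qed
    have "openin (mtopology_of (L1_metric n \<beta>)) (L1.mball W (1 / 2))"
      unfolding L1_metric_def L1.mtopology_of by (rule L1.openin_mball)
    moreover have "W \<in> L1.mball W (1 / 2)" using W by simp
    ultimately show "\<exists>N. openin (mtopology_of (L1_metric n \<beta>)) N \<and> W \<in> N \<and>
        (\<exists>C. \<forall>U\<in>N. \<forall>V\<in>N. U \<noteq> V \<longrightarrow>
          mdist (path_metric n \<alpha>) (flow_map U) (flow_map V) / L1_dist n \<beta> U V powr (\<beta> - \<alpha>) \<le> C)"
      using holder by blast
  qed
  with locally_holder_map_imp_continuous_map [OF this] assms(3) show ?thesis by simp
qed

end
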